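(* (i) There is a constant $K>0$ such that for all $\kappa,d>0$ with $\kappa d>K$, bifurcation of asymmetric solutions occurs somewhere along the curve of symmetric solutions; that is, there is a point $(\phi^*,a^*,h^* )\in\mathcal S_{\kappa,d}$ which is the limit, in $C^1[-d,d]\times C^1[-d,d]\times\mathbb R$, of a sequence of asymmetric solutions $(\phi_n,a_n,h_n)$. (ii) For every $\kappa>0$ there is $d_0=d_0(\kappa)$ such that for every $d>d_0$ there is a continuum of asymmetric solutions connecting the curve of symmetric solutions to an asymmetric normal state; that is, there is a set $\mathcal C$ of asymmetric solutions $(\phi,a,h)$ which is connected (after identifying each asymmetric solution with its reflection) and whose closure in $C^1[-d,d]\times C^1[-d,d]\times\mathbb R$ contains both a point of the curve $\mathcal S_{\kappa,d}$ and an asymmetric normal state $(0,\,h_1(x+c_1),\,h_1)$ with $c_1\neq 0$ and $h_1>0$.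
   Context: For $\kappa,d>0$ consider the boundary value problem on $[-d,d]$ with parameter $h>0$: $$\phi''=\kappa^2\phi(\phi^2+a^2-1),\qquad a''=\phi^2a,\qquad \phi'(\pm d)=0,\quad a'(\pm d)=h.$$ A solution means a triple $(\phi,a,h)$ with $h>0$ satisfying this problem and with $\phi>0$ on $[-d,d]$. A solution is symmetric if $\phi$ is even and $a$ is odd in $x$, and asymmetric otherwise. The reflection of $(\phi,a,h)$ is $(\phi(-x),-a(-x),h)$, which is again a solution. Normal states are the trivial triples $(0,\,h(x+c),\,h)$ with $h>0$, $c\in\mathbb R$; a normal state is asymmetric if $c\ne0$. Curve of symmetric solutions $\mathcal S_{\kappa,d}$: by a known result of Kwong, for each $\alpha\in(0,1)$ there is a unique $\delta=\delta_0(\alpha)>0$ such that the solution of the two differential equations with $\phi(0)=\alpha$, $\phi'(0)=0$, $a(0)=0$, $a'(0)=\delta$ exists and has $\phi>0$ on $[0,d]$ and satisfies $\phi'(d)=0$. Extending $\phi$ as an even function and $a$ as an odd function to $[-d,d]$ and setting $h=a'(d)$ gives a symmetric solution. $\mathcal S_{\kappa,d}$ is the set of all symmetric solutions so obtained as $\alpha$ ranges over $(0,1)$. *)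

theory Defs
  imports "HOL-Analysis.Analysis"
begin

subsection \<open>The space $C^1[-d,d]$\<close>

text \<open>
  Elements are extensional functions, so that equality of elements is equality on $[-d,d]$.
  Derivatives at the endpoints are one-sided. The space \<open>C1_space d\<close> is meant for \<open>d > 0\<close> only.
\<close>

definition C1_space :: "real \<Rightarrow> (real \<Rightarrow> real) set" where
  "C1_space d = {f \<in> extensional {-d..d}.
     \<exists>f'. continuous_on {-d..d} f' \<and>
          (\<forall>x\<in>{-d..d}. (f has_real_derivative f' x) (at x within {-d..d}))}"

definition C1_deriv :: "real \<Rightarrow> (real \<Rightarrow> real) \<Rightarrow> real \<Rightarrow> real" where
  "C1_deriv d f x = vector_derivative f (at x within {-d..d})"

text \<open>
  Outside of \<open>C1_space d\<close> the value \<open>0\<close> is immaterial; it is only there because the locale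
  \<open>Metric_space\<close> requires nonnegativity on the whole type.
\<close>

definition C1_dist :: "real \<Rightarrow> (real \<Rightarrow> real) \<Rightarrow> (real \<Rightarrow> real) \<Rightarrow> real" where
  "C1_dist d f g =
     (if f \<in> C1_space d \<and> g \<in> C1_space d
      then (SUP x\<in>{-d..d}. \<bar>f x - g x\<bar>) + (SUP x\<in>{-d..d}. \<bar>C1_deriv d f x - C1_deriv d g x\<bar>)
      else 0)"

definition C1_topology :: "real \<Rightarrow> (real \<Rightarrow> real) topology" where
  "C1_topology d = Metric_space.mtopology (C1_space d) (C1_dist d)"

type_synonym state = "(real \<Rightarrow> real) \<times> (real \<Rightarrow> real) \<times> real"

definition state_topology :: "real \<Rightarrow> state topology" where
  "state_topology d = prod_topology (C1_topology d) (prod_topology (C1_topology d) euclideanreal)"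

lemma C1_space_deriv:
  assumes "d > 0" "f \<in> C1_space d"
  shows "continuous_on {-d..d} f" "continuous_on {-d..d} (C1_deriv d f)"
    and "\<And>x. x \<in> {-d..d} \<Longrightarrow> (f has_real_derivative C1_deriv d f x) (at x within {-d..d})"
proof -
  obtain f' where f': "continuous_on {-d..d} f'"
    "\<And>x. x \<in> {-d..d} \<Longrightarrow> (f has_real_derivative f' x) (at x within {-d..d})"
    using assms(2) by (auto simp: C1_space_def)
  have eq: "C1_deriv d f x = f' x" if "x \<in> {-d..d}" for x
    unfolding C1_deriv_def
    using f'(2)[OF that] assms(1) that
    by (intro vector_derivative_within_closed_interval)
       (auto simp: has_real_derivative_iff_has_vector_derivative)
  show "continuous_on {-d..d} f"
    using f'(2) by (rule DERIV_continuous_on)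
  show "continuous_on {-d..d} (C1_deriv d f)"
    using continuous_on_cong[of "{-d..d}" "{-d..d}" "C1_deriv d f" f'] f'(1) eq by blast
  show "(f has_real_derivative C1_deriv d f x) (at x within {-d..d})" if "x \<in> {-d..d}" for x
    using f'(2)[OF that] eq[OF that] by simp
qed

lemma bdd_above_abs_diff:
  fixes f g :: "real \<Rightarrow> real"
  assumes "continuous_on {-d..d} f" "continuous_on {-d..d} g"
  shows "bdd_above ((\<lambda>x. \<bar>f x - g x\<bar>) ` {-d..d})"
proof -
  have "continuous_on {-d..d} (\<lambda>x. \<bar>f x - g x\<bar>)"
    using assms by (intro continuous_intros)
  then have "compact ((\<lambda>x. \<bar>f x - g x\<bar>) ` {-d..d})"
    by (rule compact_continuous_image) simp
  then show ?thesis by (intro bounded_imp_bdd_above compact_imp_bounded)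
qed

lemma Metric_space_C1:
  assumes "d > 0"
  shows "Metric_space (C1_space d) (C1_dist d)"
proof
  note D = C1_space_deriv(1,2)[OF assms]
  have ne: "0 \<in> {-d..d}" using assms by auto
  have Sup_nonneg: "0 \<le> (SUP x\<in>{-d..d}. \<bar>f x - g x\<bar>)"
    if "continuous_on {-d..d} f" "continuous_on {-d..d} g" for f g :: "real \<Rightarrow> real"
    by (rule cSUP_upper2[OF bdd_above_abs_diff[OF that] ne]) auto
  have Sup_tri: "(SUP x\<in>{-d..d}. \<bar>f x - k x\<bar>)
       \<le> (SUP x\<in>{-d..d}. \<bar>f x - g x\<bar>) + (SUP x\<in>{-d..d}. \<bar>g x - k x\<bar>)"
    if "continuous_on {-d..d} f" "continuous_on {-d..d} g" "continuous_on {-d..d} k"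
    for f g k :: "real \<Rightarrow> real"
  proof (rule cSUP_least)
    fix x assume x: "x \<in> {-d..d}"
    have "\<bar>f x - g x\<bar> \<le> (SUP x\<in>{-d..d}. \<bar>f x - g x\<bar>)"
      by (rule cSUP_upper[OF x bdd_above_abs_diff]) (use that in auto)
    moreover have "\<bar>g x - k x\<bar> \<le> (SUP x\<in>{-d..d}. \<bar>g x - k x\<bar>)"
      by (rule cSUP_upper[OF x bdd_above_abs_diff]) (use that in auto)
    ultimately show "\<bar>f x - k x\<bar>
      \<le> (SUP x\<in>{-d..d}. \<bar>f x - g x\<bar>) + (SUP x\<in>{-d..d}. \<bar>g x - k x\<bar>)" by linarith
  qed (use ne in auto)
  show "0 \<le> C1_dist d f g" for f g
    using Sup_nonneg D by (auto simp: C1_dist_def intro!: add_nonneg_nonneg)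
  show "C1_dist d f g = C1_dist d g f" for f g
    by (auto simp: C1_dist_def abs_minus_commute)
  show "C1_dist d f g = 0 \<longleftrightarrow> f = g" if fg: "f \<in> C1_space d" "g \<in> C1_space d" for f g
  proof
    assume "C1_dist d f g = 0"
    then have 0: "(SUP x\<in>{-d..d}. \<bar>f x - g x\<bar>) \<le> 0"
      using Sup_nonneg[OF D(2)[OF fg(1)] D(2)[OF fg(2)]] fg by (simp add: C1_dist_def)
    show "f = g"
    proof (rule extensionalityI[of _ "{-d..d}"])
      fix x assume x: "x \<in> {-d..d}"
      have "\<bar>f x - g x\<bar> \<le> (SUP x\<in>{-d..d}. \<bar>f x - g x\<bar>)"
        by (rule cSUP_upper[OF x bdd_above_abs_diff]) (use fg D in auto)
      with 0 show "f x = g x" by linarith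
    qed (use fg in \<open>auto simp: C1_space_def\<close>)
  next
    assume "f = g"
    then show "C1_dist d f g = 0" using ne by (auto simp: C1_dist_def)
  qed
  show "C1_dist d f k \<le> C1_dist d f g + C1_dist d g k"
    if fgk: "f \<in> C1_space d" "g \<in> C1_space d" "k \<in> C1_space d" for f g k
    using Sup_tri[OF D(1)[OF fgk(1)] D(1)[OF fgk(2)] D(1)[OF fgk(3)]]
      Sup_tri[OF D(2)[OF fgk(1)] D(2)[OF fgk(2)] D(2)[OF fgk(3)]] fgk
    by (simp add: C1_dist_def)
qed

lemma topspace_state_topology:
  "d > 0 \<Longrightarrow> topspace (state_topology d) = C1_space d \<times> C1_space d \<times> UNIV"
  by (simp add: state_topology_def C1_topology_def
      Metric_space.topspace_mtopology[OF Metric_space_C1])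


subsection \<open>Solutions of the boundary value problem\<close>

text \<open>The functions \<open>\<phi>'\<close> and \<open>a'\<close> are the derivatives of \<open>\<phi>\<close> and \<open>a\<close>.\<close>

definition GL_system ::
  "real \<Rightarrow> real set \<Rightarrow> (real \<Rightarrow> real) \<Rightarrow> (real \<Rightarrow> real) \<Rightarrow> (real \<Rightarrow> real) \<Rightarrow> (real \<Rightarrow> real) \<Rightarrow> bool" where
  "GL_system \<kappa> J \<phi> \<phi>' a a' \<longleftrightarrow>
     (\<forall>x\<in>J. (\<phi> has_real_derivative \<phi>' x) (at x within J) \<and>
            (\<phi>' has_real_derivative \<kappa>\<^sup>2 * \<phi> x * ((\<phi> x)\<^sup>2 + (a x)\<^sup>2 - 1)) (at x within J) \<and>
            (a has_real_derivative a' x) (at x within J) \<and>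
            (a' has_real_derivative (\<phi> x)\<^sup>2 * a x) (at x within J))"

definition GL_solutions :: "real \<Rightarrow> real \<Rightarrow> state set" where
  "GL_solutions \<kappa> d = {(\<phi>, a, h).
     \<phi> \<in> extensional {-d..d} \<and> a \<in> extensional {-d..d} \<and> h > 0 \<and>
     (\<forall>x\<in>{-d..d}. \<phi> x > 0) \<and>
     (\<exists>\<phi>' a'. GL_system \<kappa> {-d..d} \<phi> \<phi>' a a' \<and>
        \<phi>' (-d) = 0 \<and> \<phi>' d = 0 \<and> a' (-d) = h \<and> a' d = h)}"

definition symmetric_state :: "real \<Rightarrow> state \<Rightarrow> bool" where
  "symmetric_state d = (\<lambda>(\<phi>, a, h). \<forall>x\<in>{-d..d}. \<phi> (-x) = \<phi> x \<and> a (-x) = - a x)"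

definition asymmetric_solutions :: "real \<Rightarrow> real \<Rightarrow> state set" where
  "asymmetric_solutions \<kappa> d = {p \<in> GL_solutions \<kappa> d. \<not> symmetric_state d p}"

definition normal_state :: "real \<Rightarrow> real \<Rightarrow> real \<Rightarrow> state" where
  "normal_state d c h = (restrict (\<lambda>x. 0) {-d..d}, restrict (\<lambda>x. h * (x + c)) {-d..d}, h)"

lemma GL_solutions_subset_topspace:
  assumes "d > 0"
  shows "GL_solutions \<kappa> d \<subseteq> topspace (state_topology d)"
proof clarify
  fix \<phi> a h assume "(\<phi>, a, h) \<in> GL_solutions \<kappa> d"
  then obtain \<phi>' a' where *: "\<phi> \<in> extensional {-d..d}" "a \<in> extensional {-d..d}"
    and S: "GL_system \<kappa> {-d..d} \<phi> \<phi>' a a'" by (auto simp: GL_solutions_def)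
  have "continuous_on {-d..d} \<phi>'" "continuous_on {-d..d} a'"
    using S by (auto simp: GL_system_def intro!: DERIV_continuous_on)
  then have "\<phi> \<in> C1_space d" "a \<in> C1_space d"
    using * S by (auto simp: C1_space_def GL_system_def)
  then show "(\<phi>, a, h) \<in> topspace (state_topology d)"
    by (simp add: topspace_state_topology[OF assms])
qed


subsection \<open>The curve of symmetric solutions\<close>

definition shooting_solution ::
  "real \<Rightarrow> real \<Rightarrow> real \<Rightarrow> real \<Rightarrow> (real \<Rightarrow> real) \<Rightarrow> (real \<Rightarrow> real) \<Rightarrow> (real \<Rightarrow> real) \<Rightarrow> (real \<Rightarrow> real) \<Rightarrow> bool"
where
  "shooting_solution \<kappa> d \<alpha> \<delta> u u' b b' \<longleftrightarrow>
     GL_system \<kappa> {0..d} u u' b b' \<and>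
     u 0 = \<alpha> \<and> u' 0 = 0 \<and> b 0 = 0 \<and> b' 0 = \<delta> \<and>
     (\<forall>x\<in>{0..d}. u x > 0) \<and> u' d = 0"

text \<open>
  By a theorem of Kwong, for each \<open>\<alpha>\<close> in $(0,1)$ there is exactly one \<open>\<delta> > 0\<close> for which the
  shooting problem is solvable, so the existential quantifier over \<open>\<delta>\<close> ranges over the single
  value $\delta_0(\alpha)$.
\<close>

definition symmetric_curve :: "real \<Rightarrow> real \<Rightarrow> state set" where
  "symmetric_curve \<kappa> d = {(\<phi>, a, h).
     \<exists>\<alpha>\<in>{0<..<1}. \<exists>\<delta>>0. \<exists>u u' b b'.
       shooting_solution \<kappa> d \<alpha> \<delta> u u' b b' \<and>
       \<phi> = restrict (\<lambda>x. if 0 \<le> x then u x else u (-x)) {-d..d} \<and>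
       a = restrict (\<lambda>x. if 0 \<le> x then b x else - b (-x)) {-d..d} \<and>
       h = b' d}"

lemma has_derivative_reflect:
  assumes "(f has_real_derivative f1) (at (-x) within uminus ` S)"
  shows "((\<lambda>x::real. f (-x)) has_real_derivative - f1) (at x within S)"
proof -
  have "(uminus has_real_derivative -1) (at x within S)"
    by (auto intro!: derivative_eq_intros)
  from DERIV_image_chain[OF assms this] show ?thesis by (simp add: o_def)
qed

lemma has_derivative_glue:
  fixes f f' :: "real \<Rightarrow> real"
  assumes "d > 0" "x \<in> {-d..d}"
    and f: "\<And>x. x \<in> {0..d} \<Longrightarrow> (f has_real_derivative f' x) (at x within {0..d})"
    and s: "s = 1 \<or> s = -1" and 0: "f 0 = s * f 0" "f' 0 = - s * f' 0"
  shows "((\<lambda>x. if 0 \<le> x then f x else s * f (-x)) has_real_derivative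
          (if 0 \<le> x then f' x else - s * f' (-x))) (at x within {-d..d})"
proof -
  define F where "F = (\<lambda>x. if 0 \<le> x then f x else s * f (-x))"
  define D where "D = (if 0 \<le> x then f' x else - s * f' (-x))"
  have bot: "at x within T = bot" if "closed T" "x \<notin> T" for T
    using that closed_limpt[of T] trivial_limit_within[of x T] by blast
  have "(F has_real_derivative D) (at x within {0..d})"
  proof (cases "x \<in> {0..d}")
    case True
    show ?thesis
      by (rule has_field_derivative_transform_within[OF _ zero_less_one True, of f])
         (use f True in \<open>auto simp: F_def D_def\<close>)
  qed (simp add: bot has_field_derivative_iff)
  moreover have "(F has_real_derivative D) (at x within {-d..0})"
  proof (cases "x \<in> {-d..0}")
    case True
    have "((\<lambda>x. s * f (-x)) has_real_derivative s * (- f' (-x))) (at x within {-d..0})"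
      by (intro DERIV_cmult has_derivative_reflect) (use f[of "-x"] True in auto)
    moreover have "s * (- f' (-x)) = D"
      using True 0 by (cases "x = 0") (auto simp: D_def)
    ultimately have "((\<lambda>x. s * f (-x)) has_real_derivative D) (at x within {-d..0})" by simp
    then show ?thesis
      by (rule has_field_derivative_transform_within[OF _ zero_less_one True])
         (use 0 in \<open>auto simp: F_def\<close>)
  qed (simp add: bot has_field_derivative_iff)
  ultimately have "(F has_real_derivative D) (at x within {0..d} \<union> {-d..0})"
    by (simp add: has_field_derivative_iff Lim_within_Un)
  moreover have "{0..d} \<union> {-d..0} = {-d..d}" using assms(1) by auto
  ultimately show ?thesis by (simp add: F_def D_def)
qed

lemma has_derivative_glue_even:
  fixes f f' :: "real \<Rightarrow> real"
  assumes "d > 0" "x \<in> {-d..d}"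
    and "\<And>x. x \<in> {0..d} \<Longrightarrow> (f has_real_derivative f' x) (at x within {0..d})" and "f' 0 = 0"
  shows "((\<lambda>x. if 0 \<le> x then f x else f (-x)) has_real_derivative
          (if 0 \<le> x then f' x else - f' (-x))) (at x within {-d..d})"
  using has_derivative_glue[of d x f f' 1] assms by (simp only: mult_1_left mult_minus1) simp

lemma has_derivative_glue_odd:
  fixes f f' :: "real \<Rightarrow> real"
  assumes "d > 0" "x \<in> {-d..d}"
    and "\<And>x. x \<in> {0..d} \<Longrightarrow> (f has_real_derivative f' x) (at x within {0..d})" and "f 0 = 0"
  shows "((\<lambda>x. if 0 \<le> x then f x else - f (-x)) has_real_derivative
          (if 0 \<le> x then f' x else f' (-x))) (at x within {-d..d})"
  using has_derivative_glue[of d x f f' "-1"] assms by (simp only: mult_1_left mult_minus1 minus_minus) simp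

lemma symmetric_curve_solutions:
  assumes d: "d > 0" and p: "p \<in> symmetric_curve \<kappa> d"
  shows "p \<in> GL_solutions \<kappa> d" "symmetric_state d p"
proof -
  obtain \<phi> a h \<alpha> \<delta> u u' b b' where p_eq: "p = (\<phi>, a, h)" and \<delta>: "\<delta> > 0"
    and S: "shooting_solution \<kappa> d \<alpha> \<delta> u u' b b'"
    and \<phi>: "\<phi> = restrict (\<lambda>x. if 0 \<le> x then u x else u (-x)) {-d..d}"
    and a: "a = restrict (\<lambda>x. if 0 \<le> x then b x else - b (-x)) {-d..d}"
    and h: "h = b' d"
    using p by (auto simp: symmetric_curve_def)
  have sys: "GL_system \<kappa> {0..d} u u' b b'" and b0: "b 0 = 0" "b' 0 = \<delta>" "u' 0 = 0" "u' d = 0"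
    and pos: "\<And>x. x \<in> {0..d} \<Longrightarrow> u x > 0"
    using S by (auto simp: shooting_solution_def)
  define \<phi>1 where "\<phi>1 = (\<lambda>x. if 0 \<le> x then u' x else - u' (-x))"
  define a1 where "a1 = (\<lambda>x. if 0 \<le> x then b' x else b' (-x))"
  show "symmetric_state d p"
    using b0 by (auto simp: symmetric_state_def p_eq \<phi> a)
  have tr: "(restrict f {-d..d} has_real_derivative D) (at x within {-d..d})"
    if "(f has_real_derivative D) (at x within {-d..d})" "x \<in> {-d..d}" for f D x
    using has_field_derivative_transform_within[OF that(1) zero_less_one that(2)] by auto
  have sys': "GL_system \<kappa> {-d..d} \<phi> \<phi>1 a a1"
    unfolding GL_system_def
  proof (intro ballI conjI)
    fix x assume x: "x \<in> {-d..d}"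
    show "(\<phi> has_real_derivative \<phi>1 x) (at x within {-d..d})"
      unfolding \<phi> \<phi>1_def
      by (rule tr[OF has_derivative_glue_even[OF d x] x]) (use sys b0 in \<open>auto simp: GL_system_def\<close>)
    show "(a has_real_derivative a1 x) (at x within {-d..d})"
      unfolding a a1_def
      by (rule tr[OF has_derivative_glue_odd[OF d x] x]) (use sys b0 in \<open>auto simp: GL_system_def\<close>)
    have "(\<phi>1 has_real_derivative
        (if 0 \<le> x then \<kappa>\<^sup>2 * u x * ((u x)\<^sup>2 + (b x)\<^sup>2 - 1)
         else \<kappa>\<^sup>2 * u (-x) * ((u (-x))\<^sup>2 + (b (-x))\<^sup>2 - 1))) (at x within {-d..d})"
      unfolding \<phi>1_def
      by (rule has_derivative_glue_odd[OF d x]) (use sys b0 in \<open>auto simp: GL_system_def\<close>)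
    then show "(\<phi>1 has_real_derivative \<kappa>\<^sup>2 * \<phi> x * ((\<phi> x)\<^sup>2 + (a x)\<^sup>2 - 1)) (at x within {-d..d})"
      using x by (simp add: \<phi> a split: if_splits)
    have "(a1 has_real_derivative
        (if 0 \<le> x then (u x)\<^sup>2 * b x else - ((u (-x))\<^sup>2 * b (-x)))) (at x within {-d..d})"
      unfolding a1_def
      by (rule has_derivative_glue_even[OF d x]) (use sys b0 in \<open>auto simp: GL_system_def\<close>)
    then show "(a1 has_real_derivative (\<phi> x)\<^sup>2 * a x) (at x within {-d..d})"
      using x by (simp add: \<phi> a split: if_splits)
  qed
  have "b' d > 0"
  proof -
    have contb: "continuous_on {0..d} b" and contb': "continuous_on {0..d} b'"
      using sys by (auto simp: GL_system_def intro!: DERIV_continuous_on)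
    have at: "(f has_real_derivative D) (at x)"
      if "(f has_real_derivative D) (at x within {0..d})" "0 < x" "x < d" for f D x
      using that by (simp add: at_within_Icc_at)
    have derb: "\<And>x. 0 < x \<Longrightarrow> x < d \<Longrightarrow> (b has_real_derivative b' x) (at x)"
      and derb': "\<And>x. 0 < x \<Longrightarrow> x < d \<Longrightarrow> (b' has_real_derivative (u x)\<^sup>2 * b x) (at x)"
      using sys at by (auto simp: GL_system_def)
    text \<open>If $b'$ had a zero $z$, then $b b'$, which is nondecreasing, would vanish at both
      ends of $[0,z]$, hence throughout, and so would its derivative $b'^2 + u^2 b^2$.\<close>
    have "b' x > 0" if x: "x \<in> {0..d}" for x
    proof (rule ccontr)
      assume "\<not> b' x > 0"
      moreover have "continuous_on {0..x} b'"
        by (rule continuous_on_subset[OF contb']) (use x in auto)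
      ultimately obtain z where z: "0 \<le> z" "z \<le> x" "b' z = 0"
        using IVT2'[of b' x 0 0] b0 \<delta> x by auto
      then have z0: "z > 0" using b0 \<delta> by (cases "z = 0") auto
      have zd: "z \<le> d" using z x by auto
      define G where "G = (\<lambda>x. b x * b' x)"
      have contG: "continuous_on {0..z} G"
        unfolding G_def using zd
        by (intro continuous_on_mult continuous_on_subset[OF contb] continuous_on_subset[OF contb']) auto
      have derG: "(G has_real_derivative (b' y)\<^sup>2 + (u y)\<^sup>2 * (b y)\<^sup>2) (at y)" if "0 < y" "y < z" for y
        unfolding G_def using that zd
        by (auto intro!: derivative_eq_intros derb derb' simp: power2_eq_square)
      have mono: "G s \<le> G t" if "0 \<le> s" "s \<le> t" "t \<le> z" for s t
      proof (rule DERIV_nonneg_imp_increasing_open[of s t G])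
        show "s \<le> t" by fact
        show "continuous_on {s..t} G" by (rule continuous_on_subset[OF contG]) (use that in auto)
        show "\<exists>D. (G has_real_derivative D) (at y) \<and> 0 \<le> D" if "s < y" "y < t" for y
          using derG[of y] that \<open>0 \<le> s\<close> \<open>t \<le> z\<close> by (intro exI[of _ "(b' y)\<^sup>2 + (u y)\<^sup>2 * (b y)\<^sup>2"]) auto
      qed
      have G0: "G s = 0" if "s \<in> {0..z}" for s
        using mono[of 0 s] mono[of s z] that z b0 by (simp add: G_def)
      have "(G has_real_derivative 0) (at y)" if "0 < y" "y < z" for y
        by (rule has_field_derivative_transform_within_open[OF DERIV_const, of "{0<..<z}" _ 0])
           (use that G0 in auto)
      then have "(b' y)\<^sup>2 + (u y)\<^sup>2 * (b y)\<^sup>2 = 0" if "0 < y" "y < z" for y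
        using DERIV_unique[OF derG] that by blast
      then have b'0: "b' y = 0" if "0 < y" "y < z" for y
        using that by (metis add_nonneg_eq_0_iff zero_le_mult_iff zero_le_power2 zero_eq_power2)
      have "closure {0<..<z} = {0..z}" using z0 by simp
      then have "b' 0 = 0"
        using continuous_constant_on_closure[of "{0<..<z}" b' 0 0] b'0 z0 zd
          continuous_on_subset[OF contb', of "{0..z}"] by auto
      then show False using b0 \<delta> by simp
    qed
    then show ?thesis using d by simp
  qed
  then show "p \<in> GL_solutions \<kappa> d"
    unfolding p_eq GL_solutions_def mem_Collect_eq case_prod_conv
    by (intro conjI exI[of _ \<phi>1] exI[of _ a1] sys')
       (use d b0 pos h in \<open>auto simp: \<phi>1_def a1_def \<phi> a\<close>)
qed


subsection \<open>Identification of asymmetric solutions with their reflections\<close>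

definition reflection :: "real \<Rightarrow> state \<Rightarrow> state" where
  "reflection d = (\<lambda>(\<phi>, a, h).
     (restrict (\<lambda>x. \<phi> (-x)) {-d..d}, restrict (\<lambda>x. - a (-x)) {-d..d}, h))"

definition reflection_class :: "real \<Rightarrow> state \<Rightarrow> state set" where
  "reflection_class d p = {p, reflection d p}"

definition quotient_topology :: "'a topology \<Rightarrow> ('a \<Rightarrow> 'b) \<Rightarrow> 'b topology" where
  "quotient_topology X f =
     topology (\<lambda>U. U \<subseteq> f ` topspace X \<and> openin X {x \<in> topspace X. f x \<in> U})"

definition asymmetric_quotient :: "real \<Rightarrow> real \<Rightarrow> state set topology" where
  "asymmetric_quotient \<kappa> d =
     quotient_topology (subtopology (state_topology d) (asymmetric_solutions \<kappa> d)) (reflection_class d)"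

lemma openin_quotient_topology:
  "openin (quotient_topology X f) U \<longleftrightarrow>
     U \<subseteq> f ` topspace X \<and> openin X {x \<in> topspace X. f x \<in> U}"
proof -
  have "istopology (\<lambda>U. U \<subseteq> f ` topspace X \<and> openin X {x \<in> topspace X. f x \<in> U})"
    unfolding istopology_def
  proof (intro conjI allI impI)
    fix S T
    assume *: "S \<subseteq> f ` topspace X \<and> openin X {x \<in> topspace X. f x \<in> S}"
      "T \<subseteq> f ` topspace X \<and> openin X {x \<in> topspace X. f x \<in> T}"
    have "{x \<in> topspace X. f x \<in> S \<inter> T} =
        {x \<in> topspace X. f x \<in> S} \<inter> {x \<in> topspace X. f x \<in> T}" by auto
    then show "openin X {x \<in> topspace X. f x \<in> S \<inter> T}" using * by auto
    show "S \<inter> T \<subseteq> f ` topspace X" using * by auto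
  next
    fix K
    assume *: "\<forall>S\<in>K. S \<subseteq> f ` topspace X \<and> openin X {x \<in> topspace X. f x \<in> S}"
    have "{x \<in> topspace X. f x \<in> \<Union>K} = (\<Union>S\<in>K. {x \<in> topspace X. f x \<in> S})" by auto
    then show "openin X {x \<in> topspace X. f x \<in> \<Union>K}" using * by auto
    show "\<Union>K \<subseteq> f ` topspace X" using * by auto
  qed
  then show ?thesis by (simp add: quotient_topology_def topology_inverse')
qed

lemma quotient_map_quotient_topology: "quotient_map X (quotient_topology X f) f"
proof -
  have "topspace (quotient_topology X f) = f ` topspace X"
  proof (rule antisym)
    show "topspace (quotient_topology X f) \<subseteq> f ` topspace X"
      using openin_quotient_topology[of X f "topspace (quotient_topology X f)"] by simp
    have "{x \<in> topspace X. f x \<in> f ` topspace X} = topspace X" by auto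
    then have "openin (quotient_topology X f) (f ` topspace X)"
      by (simp add: openin_quotient_topology)
    then show "f ` topspace X \<subseteq> topspace (quotient_topology X f)"
      by (rule openin_subset)
  qed
  then show ?thesis by (simp add: quotient_map_def openin_quotient_topology)
qed

lemma reflection_asymmetric_solutions:
  assumes p: "p \<in> asymmetric_solutions \<kappa> d"
  shows "reflection d p \<in> asymmetric_solutions \<kappa> d" "reflection d (reflection d p) = p"
proof -
  obtain \<phi> a h where p_eq: "p = (\<phi>, a, h)" by (cases p)
  obtain \<phi>' a' where ext: "\<phi> \<in> extensional {-d..d}" "a \<in> extensional {-d..d}"
    and h: "h > 0" and pos: "\<forall>x\<in>{-d..d}. \<phi> x > 0"
    and sys: "GL_system \<kappa> {-d..d} \<phi> \<phi>' a a'"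
    and bc: "\<phi>' (-d) = 0" "\<phi>' d = 0" "a' (-d) = h" "a' d = h"
    and asym: "\<not> symmetric_state d (\<phi>, a, h)"
    using p by (auto simp: p_eq asymmetric_solutions_def GL_solutions_def)
  show "reflection d (reflection d p) = p"
    using ext by (auto simp: p_eq reflection_def fun_eq_iff extensional_def restrict_def)
  have refl_der: "((\<lambda>x. f (-x)) has_real_derivative - f1) (at x within {-d..d})"
    if "(f has_real_derivative f1) (at (-x) within {-d..d})" for f f1 x
    using has_derivative_reflect[of f f1 x "{-d..d}"] that by simp
  have tr: "(restrict f {-d..d} has_real_derivative D) (at x within {-d..d})"
    if "(f has_real_derivative D) (at x within {-d..d})" "x \<in> {-d..d}" for f D x
    using has_field_derivative_transform_within[OF that(1) zero_less_one that(2)] by auto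
  have "GL_system \<kappa> {-d..d} (restrict (\<lambda>x. \<phi> (-x)) {-d..d}) (\<lambda>x. - \<phi>' (-x))
      (restrict (\<lambda>x. - a (-x)) {-d..d}) (\<lambda>x. a' (-x))"
    unfolding GL_system_def
  proof (intro ballI conjI)
    fix x assume x: "x \<in> {-d..d}"
    then have x': "-x \<in> {-d..d}" by auto
    note s = sys[unfolded GL_system_def, rule_format, OF x']
    show "(restrict (\<lambda>x. \<phi> (-x)) {-d..d} has_real_derivative - \<phi>' (-x)) (at x within {-d..d})"
      using s x by (intro tr refl_der) auto
    show "(restrict (\<lambda>x. - a (-x)) {-d..d} has_real_derivative a' (-x)) (at x within {-d..d})"
      using s x DERIV_minus[OF refl_der[of a]] by (intro tr) fastforce+
    show "((\<lambda>x. - \<phi>' (-x)) has_real_derivative \<kappa>\<^sup>2 * restrict (\<lambda>x. \<phi> (-x)) {-d..d} x *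
        ((restrict (\<lambda>x. \<phi> (-x)) {-d..d} x)\<^sup>2 + (restrict (\<lambda>x. - a (-x)) {-d..d} x)\<^sup>2 - 1))
        (at x within {-d..d})"
      using DERIV_minus[OF refl_der[of \<phi>']] s x by fastforce
    show "((\<lambda>x. a' (-x)) has_real_derivative (restrict (\<lambda>x. \<phi> (-x)) {-d..d} x)\<^sup>2 *
        restrict (\<lambda>x. - a (-x)) {-d..d} x) (at x within {-d..d})"
      using refl_der[of a'] s x by fastforce
  qed
  then have "reflection d p \<in> GL_solutions \<kappa> d"
    unfolding p_eq reflection_def GL_solutions_def mem_Collect_eq case_prod_conv
    by (intro conjI exI[of _ "\<lambda>x. - \<phi>' (-x)"] exI[of _ "\<lambda>x. a' (-x)"]) (use h pos bc in auto)
  moreover have "\<not> symmetric_state d (reflection d p)"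
  proof -
    obtain x where "x \<in> {-d..d}" "\<phi> (-x) \<noteq> \<phi> x \<or> a (-x) \<noteq> - a x"
      using asym by (auto simp: symmetric_state_def)
    then show ?thesis
      by (auto simp: p_eq symmetric_state_def reflection_def intro!: bexI[of _ x])
  qed
  ultimately show "reflection d p \<in> asymmetric_solutions \<kappa> d"
    by (simp add: asymmetric_solutions_def)
qed

end

theory Submission
  imports Defs
begin

text \<open>The idea is to centre a solution at the zero \<open>z\<close> of \<open>a\<close>. With \<open>\<phi> = \<alpha> \<psi>\<close> and \<open>a = \<delta> s\<close>, the part
  to the right of \<open>z\<close> and the reflection of the part to the left solve the same initial value
  problem, on intervals of lengths \<open>d - z\<close> and \<open>d + z\<close> and with slopes \<open>\<psi>' = \<rho>\<close> and
  \<open>\<psi>' = - \<rho>\<close> at \<open>0\<close>. The logarithmic derivative \<open>\<psi>' / \<psi>\<close> at the end increases with \<open>\<rho>\<close> and with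
  \<open>\<delta>\<close>, so for every \<open>(z, \<alpha>)\<close> in the rectangle $[0,d] \times [0,1]$ exactly one pair
  \<open>(\<rho>, \<delta>)\<close> makes \<open>\<psi>'\<close> vanish at both ends, and it depends continuously on \<open>(z, \<alpha>)\<close>.

  The remaining condition is that the gap, the difference of the two end values of \<open>s'\<close>, is zero. It
  vanishes on the side \<open>z = 0\<close>, which consists of the symmetric solutions, and on the side
  \<open>\<alpha> = 0\<close>, which consists of the normal states with \<open>c = - z\<close>. Inside the rectangle it is negative
  near \<open>z = d\<close> and near \<open>\<alpha> = 1\<close>. If \<open>\<kappa> d > 4000\<close> it is positive near the corner \<open>(0, 0)\<close>. Hence a
  connected set of zeros in the interior separates this corner from the other two sides, so its
  closure meets both \<open>z = 0\<close>, which is bifurcation from the symmetric curve, and \<open>\<alpha> = 0\<close>.\<close>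

section \<open>Ordinary differential equations\<close>

text \<open>Reflection changes the sign of \<open>z\<close>, hence the restriction to
  \<open>z \<ge> 0\<close>. Dividing by \<alpha> normalises \<psi> to the value 1 at the zero of
  \<open>a\<close>, so the side \<open>\<alpha> = 0\<close> carries a nondegenerate linear
  eigenvalue problem and the branch can be followed up to it. The obstacle is that the gap vanishes
  on the sides \<open>z = 0\<close> and \<open>\<alpha> = 0\<close>, so continuity says nothing
  about its sign next to them. Every estimate of the gap therefore keeps the factor
  \<open>\<alpha>\<^sup>2\<close>, and those that reach down to \<open>z = 0\<close> are relative to
  the deficit \<open>X = - \<psi>'\<close> that the left half still has at distance
  \<open>d - z\<close>, which shrinks with \<open>z\<close>. There the right half leads in
  \<open>s'\<close> by an amount proportional to \<open>\<alpha>\<^sup>2 X\<close>, while the left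
  half still gains \<open>s'\<close> on \<open>[d-z, d+z]\<close>, where it closes its deficit. Near
  the corner the potential on that stretch is at least
  \<open>\<kappa>\<^sup>2 x\<^sup>2 - 1\<close>; if \<open>\<kappa> d\<close> is large the deficit
  is closed at little cost in \<open>s'\<close>, and the gap is positive. In a weak field the cost
  is high and the gap negative. The number 4000 makes the comparison work with crude
  constants.\<close>

lemma gronwall_norm:
  fixes y y' :: "real \<Rightarrow> 'a::real_inner"
  assumes y: "\<And>x. x \<in> {0..t} \<Longrightarrow> (y has_vector_derivative y' x) (at x)"
    and le: "\<And>x. x \<in> {0..t} \<Longrightarrow> norm (y' x) \<le> C * norm (y x)"
    and t: "0 \<le> t"
  shows "norm (y t) \<le> norm (y 0) * exp (C * t)"
proof -
  define g where "g x = (y x \<bullet> y x) * exp (- 2 * C * x)" for x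
  have "g t \<le> g 0"
  proof (rule DERIV_nonpos_imp_nonincreasing[OF t])
    fix x assume x: "0 \<le> x" "x \<le> t"
    have "((\<lambda>x. y x \<bullet> y x) has_real_derivative 2 * (y x \<bullet> y' x)) (at x)"
      using has_derivative_inner[OF y[unfolded has_vector_derivative_def] y[unfolded has_vector_derivative_def], of x] x
      by (simp add: has_field_derivative_def inner_commute algebra_simps mult_commute_abs)
    then have "(g has_real_derivative
        2 * (y x \<bullet> y' x) * exp (- 2 * C * x) + (y x \<bullet> y x) * (exp (- 2 * C * x) * (- 2 * C))) (at x)"
      unfolding g_def by (auto intro!: derivative_eq_intros)
    moreover have "y x \<bullet> y' x \<le> C * (y x \<bullet> y x)"
    proof -
      have "y x \<bullet> y' x \<le> norm (y x) * norm (y' x)" by (rule norm_cauchy_schwarz)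
      also have "\<dots> \<le> norm (y x) * (C * norm (y x))"
        using le[of x] x by (intro mult_left_mono) auto
      finally show ?thesis by (simp add: dot_square_norm power2_eq_square algebra_simps)
    qed
    then have "2 * (y x \<bullet> y' x) * exp (- 2 * C * x) + (y x \<bullet> y x) * (exp (- 2 * C * x) * (- 2 * C)) \<le> 0"
      by (simp add: algebra_simps mult_right_mono)
    ultimately show "\<exists>D. (g has_real_derivative D) (at x) \<and> D \<le> 0" by blast
  qed
  then have "(norm (y t))\<^sup>2 \<le> (norm (y 0))\<^sup>2 * exp (2 * C * t)"
    by (simp add: g_def dot_square_norm exp_minus divide_simps)
  also have "\<dots> = (norm (y 0) * exp (C * t))\<^sup>2"
    by (simp add: power_mult_distrib exp_double[symmetric] algebra_simps)
  finally show ?thesis by (rule power2_le_imp_le) simp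
qed

lemma gronwall_norm_abs:
  fixes y y' :: "real \<Rightarrow> 'a::real_inner"
  assumes y: "\<And>x. \<bar>x\<bar> \<le> \<bar>t\<bar> \<Longrightarrow> (y has_vector_derivative y' x) (at x)"
    and le: "\<And>x. \<bar>x\<bar> \<le> \<bar>t\<bar> \<Longrightarrow> norm (y' x) \<le> C * norm (y x)"
  shows "norm (y t) \<le> norm (y 0) * exp (C * \<bar>t\<bar>)"
proof (cases "0 \<le> t")
  case True
  then show ?thesis using gronwall_norm[of t y y' C] assms by auto
next
  case False
  have "norm (y (- \<bar>t\<bar>)) \<le> norm (y (- 0)) * exp (C * \<bar>t\<bar>)"
  proof (rule gronwall_norm[of "\<bar>t\<bar>" "\<lambda>x. y (-x)" "\<lambda>x. - y' (-x)" C])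
    fix x assume x: "x \<in> {0..\<bar>t\<bar>}"
    have "((y \<circ> uminus) has_vector_derivative (-1) *\<^sub>R y' (-x)) (at x)"
      by (rule vector_diff_chain_at) (use y[of "-x"] x in \<open>auto intro!: derivative_eq_intros\<close>)
    then show "((\<lambda>x. y (-x)) has_vector_derivative - y' (-x)) (at x)" by (simp add: o_def)
    show "norm (- y' (-x)) \<le> C * norm (y (-x))" using le[of "-x"] x by auto
  qed auto
  then show ?thesis using False by simp
qed

lemma antiderivative_real_line:
  fixes g :: "real \<Rightarrow> 'a::banach"
  assumes "continuous_on UNIV g"
  obtains A where "A 0 = 0" "\<And>t. (A has_vector_derivative g t) (at t)"
proof -
  \<comment> \<open>One of the two integrals is over an empty interval or a single point, so this is
    the signed integral from 0 to \<open>t\<close> for either sign of \<open>t\<close>.\<close>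
  define A where "A t = integral {0..t} g - integral {t..0} g" for t
  have int: "g integrable_on {a..b}" for a b
    by (rule integrable_continuous_real) (rule continuous_on_subset[OF assms], simp)
  have "(A has_vector_derivative g t) (at t)" for t
  proof -
    define T where "T = \<bar>t\<bar> + 1"
    have "((\<lambda>x. integral {-T..x} g) has_vector_derivative g t) (at t within {-T..T})"
      by (rule integral_has_vector_derivative)
        (use continuous_on_subset[OF assms] in \<open>auto simp: T_def\<close>)
    then have "((\<lambda>x. integral {-T..x} g) has_vector_derivative g t) (at t)"
      by (simp add: T_def at_within_Icc_at)
    then have *: "((\<lambda>x. integral {-T..x} g - integral {-T..0} g) has_vector_derivative g t) (at t)"
      by (auto intro!: derivative_eq_intros)
    have eq: "integral {-T..x} g - integral {-T..0} g = A x" if "x \<in> {-T<..<T}" for x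
    proof (cases "0 \<le> x")
      case True
      have "integral {-T..0} g + integral {0..x} g = integral {-T..x} g"
        by (rule Henstock_Kurzweil_Integration.integral_combine) (use True int in \<open>auto simp: T_def\<close>)
      moreover have "integral {x..0} g = 0" using True by (cases "x = 0") auto
      ultimately show ?thesis by (simp add: A_def algebra_simps)
    next
      case False
      have "integral {-T..x} g + integral {x..0} g = integral {-T..0} g"
        by (rule Henstock_Kurzweil_Integration.integral_combine) (use False int that in auto)
      then show ?thesis using False by (simp add: A_def algebra_simps)
    qed
    show ?thesis
      by (rule has_vector_derivative_transform_within_open[OF *, of "{-T<..<T}"])
        (use eq in \<open>auto simp: T_def\<close>)
  qed
  moreover have "A 0 = 0" by (simp add: A_def)
  ultimately show ?thesis using that by blast
qed

text \<open>Integrating an exponential of rate \<open>c\<close> gains the factor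
  \<open>1 / c\<close>; with a weight of large rate, integration thus becomes a contraction.\<close>

lemma norm_increment_bound:
  fixes f :: "real \<Rightarrow> 'a::real_normed_vector"
  assumes f: "\<And>x. (f has_vector_derivative f' x) (at x)" and f0: "f 0 = 0"
    and b: "\<And>x. norm (f' x) \<le> B * exp (c * \<bar>x\<bar>)" and c: "c > 0" and B: "B \<ge> 0"
  shows "norm (f t) \<le> B / c * exp (c * \<bar>t\<bar>)"
proof -
  have main: "norm (g r) \<le> B / c * exp (c * r)"
    if r: "0 \<le> r" and g: "\<And>x. (g has_vector_derivative g' x) (at x)" and g0: "g 0 = 0"
      and bg: "\<And>x. norm (g' x) \<le> B * exp (c * \<bar>x\<bar>)" for g g' :: "real \<Rightarrow> 'a" and r
  proof (cases "r = 0")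
    case True
    then show ?thesis using g0 B c by simp
  next
    case False
    have "norm (g r - g 0) \<le> B / c * exp (c * r) - B / c * exp (c * 0)"
    proof (rule differentiable_bound_general[where f' = g' and \<phi>' = "\<lambda>x. B * exp (c * x)"])
      show "continuous_on {0..r} g"
        by (rule continuous_at_imp_continuous_on) (use g has_vector_derivative_continuous in blast)
      show "continuous_on {0..r} (\<lambda>x. B / c * exp (c * x))"
        by (intro continuous_intros)
      show "((\<lambda>x. B / c * exp (c * x)) has_vector_derivative B * exp (c * x)) (at x)" for x
        using c unfolding has_real_derivative_iff_has_vector_derivative[symmetric]
        by (auto intro!: derivative_eq_intros)
    qed (use r False g bg in \<open>auto intro: order_trans[OF bg]\<close>)
    moreover have "0 \<le> B / c" using B c by simp
    ultimately show ?thesis using g0 by simp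
  qed
  show ?thesis
  proof (cases "0 \<le> t")
    case True
    then show ?thesis using main[of t f f'] assms by simp
  next
    case False
    have "((\<lambda>x. f (-x)) has_vector_derivative - f' (-x)) (at x)" for x
    proof -
      have "((f \<circ> uminus) has_vector_derivative (-1) *\<^sub>R f' (-x)) (at x)"
        by (rule vector_diff_chain_at) (use f in \<open>auto intro!: derivative_eq_intros\<close>)
      then show ?thesis by (simp add: o_def)
    qed
    then have "norm (f (- (-t))) \<le> B / c * exp (c * - t)"
      using False f0 b[of "- x" for x]
      by (intro main[of "-t" "\<lambda>x. f (-x)" "\<lambda>x. - f' (-x)"]) auto
    then show ?thesis using False by simp
  qed
qed

text \<open>The Picard iterates contract by the factor \<open>1/2\<close> in the norm weighted with
  $e^{-2L|t|}$.\<close>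

lemma lipschitz_ode_solution:
  fixes f :: "'a::banach \<Rightarrow> 'a"
  assumes lip: "\<And>x y. norm (f x - f y) \<le> L * norm (x - y)"
  obtains y where "y 0 = y0" "\<And>t::real. (y has_vector_derivative f (y t)) (at t)"
proof -
  \<comment> \<open>\<open>L\<close> itself may be zero. A value of at least 1 keeps the weight rate
    \<open>2 * L'\<close> positive and makes the first increment, of size
    \<open>B / (2 * L')\<close>, at most \<open>B\<close>.\<close>
  define L' where "L' = max L 1"
  have L': "L' > 0" "norm (f x - f y) \<le> L' * norm (x - y)" for x y
    using lip[of x y] mult_right_mono[of L L' "norm (x - y)"] by (auto simp: L'_def)
  have contf: "continuous_on UNIV f"
    by (rule lipschitz_on_continuous_on[of L'], rule lipschitz_onI) (use L' in \<open>auto simp: dist_norm\<close>)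
  define C :: "(real \<Rightarrow> 'a) set" where "C = {y. continuous_on UNIV y}"
  have "\<exists>z. z 0 = y0 \<and> (\<forall>t. (z has_vector_derivative f (y t)) (at t))" if "y \<in> C" for y
  proof -
    have "continuous_on UNIV (\<lambda>t. f (y t))"
      using that continuous_on_compose2[OF contf, of UNIV y] by (auto simp: C_def)
    then obtain A where "A 0 = 0" "\<And>t. (A has_vector_derivative f (y t)) (at t)"
      using antiderivative_real_line by blast
    then show ?thesis
      by (intro exI[of _ "\<lambda>t. y0 + A t"]) (auto intro!: derivative_eq_intros)
  qed
  then obtain P where P: "\<And>y. y \<in> C \<Longrightarrow> P y 0 = y0"
    "\<And>y t. y \<in> C \<Longrightarrow> (P y has_vector_derivative f (y t)) (at t)"
    by metis
  have PC: "P y \<in> C" if "y \<in> C" for y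
    unfolding C_def mem_Collect_eq
    by (rule continuous_at_imp_continuous_on) (use P(2)[OF that] has_vector_derivative_continuous in blast)
  have contr: "norm (P y t - P z t) \<le> B / 2 * exp (2 * L' * \<bar>t\<bar>)"
    if "y \<in> C" "z \<in> C" "\<And>t. norm (y t - z t) \<le> B * exp (2 * L' * \<bar>t\<bar>)" "B \<ge> 0" for y z B t
  proof -
    have "norm (P y t - P z t) \<le> (L' * B) / (2 * L') * exp (2 * L' * \<bar>t\<bar>)"
    proof (rule norm_increment_bound[where f = "\<lambda>t. P y t - P z t" and f' = "\<lambda>t. f (y t) - f (z t)"])
      show "((\<lambda>t. P y t - P z t) has_vector_derivative f (y x) - f (z x)) (at x)" for x
        using P(2) that by (auto intro!: derivative_eq_intros)
      show "norm (f (y x) - f (z x)) \<le> L' * B * exp (2 * L' * \<bar>x\<bar>)" for x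
        using order_trans[OF L'(2)[of "y x" "z x"] mult_left_mono[OF that(3)[of x], of L']] L'(1)
        by (simp add: mult.assoc)
    qed (use P that L' in auto)
    then show ?thesis using L'(1) by simp
  qed
  define w where "w n = (P ^^ n) (\<lambda>_. y0)" for n
  have wC: "w n \<in> C" for n
    by (induction n) (auto simp: w_def C_def PC[unfolded C_def, simplified])
  have wS: "w (Suc n) = P (w n)" for n by (simp add: w_def)
  define B where "B = norm (f y0)"
  have step: "norm (w (Suc n) t - w n t) \<le> B * (1/2)^n * exp (2 * L' * \<bar>t\<bar>)" for n t
  proof (induction n arbitrary: t)
    case 0
    have "norm (P (w 0) t - y0) \<le> B / (2 * L') * exp (2 * L' * \<bar>t\<bar>)"
    proof (rule norm_increment_bound[where f = "\<lambda>t. P (w 0) t - y0" and f' = "\<lambda>t. f y0"])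
      show "((\<lambda>t. P (w 0) t - y0) has_vector_derivative f y0) (at x)" for x
        using P(2)[OF wC[of 0], of x] by (auto intro!: derivative_eq_intros simp: w_def)
      show "norm (f y0) \<le> B * exp (2 * L' * \<bar>x\<bar>)" for x
        using L' mult_left_mono[of 1 "exp (2 * L' * \<bar>x\<bar>)" B] by (simp add: B_def)
    qed (use P wC L' in \<open>auto simp: B_def\<close>)
    moreover have "B / (2 * L') \<le> B"
      using frac_le[of B B 1 "2 * L'"] by (simp add: L'_def B_def)
    ultimately show ?case
      using order_trans[OF _ mult_right_mono[of "B / (2 * L')" B "exp (2 * L' * \<bar>t\<bar>)"]]
      unfolding wS by (simp add: w_def)
  next
    case (Suc n)
    show ?case
      using contr[OF wC wC Suc.IH, of t] unfolding wS[symmetric] by (simp add: B_def)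
  qed
  have summ: "summable (\<lambda>n. w (Suc n) t - w n t)" for t
  proof (rule summable_comparison_test')
    show "summable (\<lambda>n. B * (1/2)^n * exp (2 * L' * \<bar>t\<bar>))"
      by (intro summable_mult2 summable_mult summable_geometric) simp
    show "norm (w (Suc n) t - w n t) \<le> B * (1/2)^n * exp (2 * L' * \<bar>t\<bar>)" for n
      by (rule step)
  qed
  define y where "y t = w 0 t + (\<Sum>n. w (Suc n) t - w n t)" for t
  have tail: "norm (y t - w n t) \<le> B * 2 * (1/2)^n * exp (2 * L' * \<bar>t\<bar>)" for n t
  proof -
    have "(\<Sum>i<n. w (Suc i) t - w i t) = w n t - w 0 t" by (rule sum_lessThan_telescope)
    then have "y t - w n t = (\<Sum>i. w (Suc (i + n)) t - w (i + n) t)"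
      using suminf_split_initial_segment[OF summ, of t n] by (simp add: y_def)
    also have "norm \<dots> \<le> (\<Sum>i. B * (1/2)^(i + n) * exp (2 * L' * \<bar>t\<bar>))"
    proof (rule norm_suminf_le)
      show "norm (w (Suc (i + n)) t - w (i + n) t) \<le> B * (1/2)^(i + n) * exp (2 * L' * \<bar>t\<bar>)" for i
        by (rule step)
      show "summable (\<lambda>i. B * (1/2)^(i + n) * exp (2 * L' * \<bar>t\<bar>))"
        by (rule summable_ignore_initial_segment)
          (intro summable_mult2 summable_mult summable_geometric, simp)
    qed
    also have "\<dots> = (\<Sum>i. (B * (1/2)^n * exp (2 * L' * \<bar>t\<bar>)) * (1/2)^i)"
      by (simp add: power_add algebra_simps)
    also have "\<dots> = (B * (1/2)^n * exp (2 * L' * \<bar>t\<bar>)) * (\<Sum>i. (1/2)^i)"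
      by (rule suminf_mult) (simp add: summable_geometric)
    also have "(\<Sum>i. (1/2::real)^i) = 2"
      using suminf_geometric[of "1/2::real"] by simp
    finally show ?thesis by (simp add: algebra_simps)
  qed
  \<comment> \<open>The iterates converge uniformly on bounded intervals only, which suffices for
    continuity at each point.\<close>
  have "continuous_on {-T<..<T} y" for T
  proof (rule uniform_limit_theorem[OF _ _ trivial_limit_sequentially])
    show "\<forall>\<^sub>F n in sequentially. continuous_on {-T<..<T} (w n)"
      using continuous_on_subset[OF wC[unfolded C_def mem_Collect_eq]] by (intro always_eventually allI) blast
    show "uniform_limit {-T<..<T} w y sequentially"
      unfolding uniform_limit_iff
    proof (intro allI impI)
      fix e :: real assume e: "e > 0"
      define D where "D = B * 2 * exp (2 * L' * \<bar>T\<bar>)"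
      have "(\<lambda>n. D * (1/2)^n) \<longlonglongrightarrow> D * 0"
        by (intro tendsto_mult_left LIMSEQ_realpow_zero) auto
      then have "\<forall>\<^sub>F n in sequentially. D * (1/2)^n < e"
        using e order_tendstoD(2) by force
      then show "\<forall>\<^sub>F n in sequentially. \<forall>x\<in>{-T<..<T}. dist (w n x) (y x) < e"
      proof eventually_elim
        case (elim n)
        show ?case
        proof
          fix x assume "x \<in> {-T<..<T}"
          then have "exp (2 * L' * \<bar>x\<bar>) \<le> exp (2 * L' * \<bar>T\<bar>)" using L'(1) by auto
          then have "B * 2 * (1/2)^n * exp (2 * L' * \<bar>x\<bar>) \<le> B * 2 * (1/2)^n * exp (2 * L' * \<bar>T\<bar>)"
            by (intro mult_left_mono) (auto simp: B_def)
          then show "dist (w n x) (y x) < e"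
            using tail[of x n] elim by (simp add: D_def dist_norm norm_minus_commute algebra_simps)
        qed
      qed
    qed
  qed
  then have "isCont y t" for t
    using continuous_on_eq_continuous_at[of "{-(\<bar>t\<bar>+1)<..<\<bar>t\<bar>+1}" y]
    by (meson abs_ge_minus_self abs_ge_self greaterThanLessThan_iff le_less_trans less_add_one minus_le_iff
        neg_less_iff_less open_greaterThanLessThan minus_less_iff)
  then have yC: "y \<in> C" by (simp add: C_def continuous_at_imp_continuous_on)
  \<comment> \<open>By the contraction, \<open>P y\<close> and \<open>y\<close> are both within a
    multiple of \<open>(1/2)^n\<close> of the iterate \<open>w (Suc n)\<close>.\<close>
  have "P y t = y t" for t
  proof -
    define E where "E = exp (2 * L' * \<bar>t\<bar>)"
    have "norm (P y t - y t) \<le> B * 2 * E * (1/2)^n" for n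
    proof -
      have "norm (P y t - w (Suc n) t) \<le> (B * 2 * (1/2)^n) / 2 * E"
        unfolding wS E_def by (rule contr[OF yC wC tail]) (simp add: B_def)
      moreover have "norm (y t - w (Suc n) t) \<le> B * 2 * (1/2)^(Suc n) * E"
        unfolding E_def by (rule tail)
      moreover have "norm (P y t - y t) \<le> norm (P y t - w (Suc n) t) + norm (y t - w (Suc n) t)"
        using norm_triangle_ineq4[of "P y t - w (Suc n) t" "y t - w (Suc n) t"] by simp
      ultimately show ?thesis by (simp add: algebra_simps)
    qed
    moreover have "(\<lambda>n. B * 2 * E * (1/2)^n) \<longlonglongrightarrow> B * 2 * E * 0"
      by (intro tendsto_mult_left LIMSEQ_realpow_zero) auto
    ultimately have "norm (P y t - y t) \<le> 0"
      by (intro LIMSEQ_le_const[of "\<lambda>n. B * 2 * E * (1/2)^n" "B * 2 * E * 0", simplified mult_zero_right]) auto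
    then show ?thesis by simp
  qed
  then have Py: "P y = y" by auto
  show ?thesis
    by (rule that[of y]) (use P(1)[OF yC] P(2)[OF yC] Py in auto)
qed

section \<open>The truncated system\<close>

lemma lipschitz_ode_dependence:
  fixes f :: "'a::real_inner \<Rightarrow> 'a"
  assumes lip: "\<And>x y. norm (f x - f y) \<le> L * norm (x - y)"
    and y: "\<And>t. (y has_vector_derivative f (y t)) (at t)"
    and z: "\<And>t. (z has_vector_derivative f (z t)) (at t)"
  shows "norm (y t - z t) \<le> norm (y 0 - z 0) * exp (L * \<bar>t\<bar>)"
  by (rule gronwall_norm_abs[where y = "\<lambda>t. y t - z t" and y' = "\<lambda>t. f (y t) - f (z t)"])
     (use y z lip in \<open>auto intro!: has_vector_derivative_diff\<close>)

text \<open>For joint continuity, the initial value is moved first and the time afterwards, along a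
  fixed trajectory; the first move costs the factor \<open>exp (L * \<bar>t\<bar>)\<close>, which is
  locally bounded.\<close>

lemma lipschitz_ode_flow:
  fixes f :: "'a::{banach,real_inner} \<Rightarrow> 'a"
  assumes lip: "\<And>x y. norm (f x - f y) \<le> L * norm (x - y)"
  obtains Y where "\<And>y0. Y y0 0 = y0" "\<And>y0 t::real. (Y y0 has_vector_derivative f (Y y0 t)) (at t)"
    "continuous_on UNIV (\<lambda>(y0, t). Y y0 t)"
proof -
  have "\<exists>y. y 0 = y0 \<and> (\<forall>t::real. (y has_vector_derivative f (y t)) (at t))" for y0
    by (rule lipschitz_ode_solution[OF lip, where ?y0.0 = y0]) blast+
  then obtain Y where Y: "\<And>y0. Y y0 0 = y0" "\<And>y0 t. (Y y0 has_vector_derivative f (Y y0 t)) (at t)"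
    by metis
  have "isCont (\<lambda>(y0, t). Y y0 t) (z0, t0)" for z0 t0
  proof -
    have "(((\<lambda>(y0, t). Y y0 t) \<longlongrightarrow> Y z0 t0) (at (z0, t0)))"
    proof (rule LIM_zero_cancel, rule Lim_null_comparison)
      show "\<forall>\<^sub>F x in at (z0, t0). norm ((case x of (y0, t) \<Rightarrow> Y y0 t) - Y z0 t0) \<le>
          norm (fst x - z0) * exp (L * \<bar>snd x\<bar>) + norm (Y z0 (snd x) - Y z0 t0)"
      proof (rule always_eventually, clarify)
        fix y0 t
        have "norm (Y y0 t - Y z0 t) \<le> norm (y0 - z0) * exp (L * \<bar>t\<bar>)"
          using lipschitz_ode_dependence[OF lip Y(2) Y(2), of y0 t z0] Y(1) by simp
        then show "norm (Y y0 t - Y z0 t0) \<le>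
          norm (fst (y0, t) - z0) * exp (L * \<bar>snd (y0, t)\<bar>) + norm (Y z0 (snd (y0, t)) - Y z0 t0)"
          using norm_triangle_ineq[of "Y y0 t - Y z0 t" "Y z0 t - Y z0 t0"] by simp
      qed
      have "isCont (Y z0) t0"
        by (rule has_vector_derivative_continuous[OF Y(2)])
      moreover have fst: "((\<lambda>x::'a \<times> real. fst x) \<longlongrightarrow> z0) (at (z0, t0))"
        using tendsto_fst[OF tendsto_ident_at, of "(z0, t0)" UNIV] by simp
      moreover have snd: "((\<lambda>x::'a \<times> real. snd x) \<longlongrightarrow> t0) (at (z0, t0))"
        using tendsto_snd[OF tendsto_ident_at, of "(z0, t0)" UNIV] by simp
      ultimately have "((\<lambda>x. Y z0 (snd x)) \<longlongrightarrow> Y z0 t0) (at (z0, t0))"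
        by (intro isCont_tendsto_compose[of t0 "Y z0" snd])
      with fst snd have "((\<lambda>x. norm (fst x - z0) * exp (L * \<bar>snd x\<bar>) + norm (Y z0 (snd x) - Y z0 t0))
          \<longlongrightarrow> norm (z0 - z0) * exp (L * \<bar>t0\<bar>) + norm (Y z0 t0 - Y z0 t0)) (at (z0, t0))"
        by (intro tendsto_intros)
      then show "((\<lambda>x. norm (fst x - z0) * exp (L * \<bar>snd x\<bar>) + norm (Y z0 (snd x) - Y z0 t0))
          \<longlongrightarrow> 0) (at (z0, t0))" by simp
    qed
    then show ?thesis by (simp add: isCont_def)
  qed
  then have "continuous_on UNIV (\<lambda>(y0, t). Y y0 t)"
    by (intro continuous_at_imp_continuous_on) auto
  then show ?thesis using that Y by blast
qed

text \<open>Products preserve the Lipschitz property only for bounded factors. With both properties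
  in one predicate, the clipped vector field is seen to be globally Lipschitz by following its
  syntax.\<close>

definition bounded_lipschitz :: "('a::real_normed_vector \<Rightarrow> 'b::real_normed_vector) \<Rightarrow> bool" where
  "bounded_lipschitz f \<longleftrightarrow>
     (\<exists>B L. \<forall>x y. norm (f x) \<le> B \<and> norm (f x - f y) \<le> L * norm (x - y))"

lemma bounded_lipschitz_const: "bounded_lipschitz (\<lambda>_. c)"
  unfolding bounded_lipschitz_def by (rule exI[of _ "norm c"], rule exI[of _ 0]) auto

lemma bounded_lipschitz_add:
  assumes "bounded_lipschitz f" "bounded_lipschitz g"
  shows "bounded_lipschitz (\<lambda>x. f x + g x)"
proof -
  obtain B L B' L' where *: "\<And>x. norm (f x) \<le> B" "\<And>x y. norm (f x - f y) \<le> L * norm (x - y)"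
    "\<And>x. norm (g x) \<le> B'" "\<And>x y. norm (g x - g y) \<le> L' * norm (x - y)"
    using assms unfolding bounded_lipschitz_def by metis
  have "norm (f x + g x) \<le> B + B'" for x
    using norm_triangle_le[of "f x" "g x" "B + B'"] *(1)[of x] *(3)[of x] by linarith
  moreover have "norm (f x + g x - (f y + g y)) \<le> (L + L') * norm (x - y)" for x y
    using norm_triangle_ineq[of "f x - f y" "g x - g y"] *(2)[of x y] *(4)[of x y]
    by (simp add: algebra_simps)
  ultimately show ?thesis unfolding bounded_lipschitz_def by blast
qed

lemma bounded_lipschitz_mult:
  fixes f g :: "'a::real_normed_vector \<Rightarrow> real"
  assumes "bounded_lipschitz f" "bounded_lipschitz g"
  shows "bounded_lipschitz (\<lambda>x. f x * g x)"
proof -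
  obtain B L B' L' where *: "\<And>x. norm (f x) \<le> B" "\<And>x y. norm (f x - f y) \<le> L * norm (x - y)"
    "\<And>x. norm (g x) \<le> B'" "\<And>x y. norm (g x - g y) \<le> L' * norm (x - y)"
    using assms unfolding bounded_lipschitz_def by metis
  have pos: "B \<ge> 0" "B' \<ge> 0" using *(1,3) norm_ge_zero order_trans by blast+
  have "norm (f x * g x) \<le> B * B'" for x
    unfolding norm_mult by (intro mult_mono * pos) auto
  moreover have "norm (f x * g x - f y * g y) \<le> (B * L' + L * B') * norm (x - y)" for x y
  proof -
    have "f x * g x - f y * g y = f x * (g x - g y) + (f x - f y) * g y" by (simp add: algebra_simps)
    also have "norm \<dots> \<le> norm (f x) * norm (g x - g y) + norm (f x - f y) * norm (g y)"
      by (metis norm_mult norm_triangle_ineq)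
    also have "\<dots> \<le> B * (L' * norm (x - y)) + (L * norm (x - y)) * B'"
      by (intro add_mono mult_mono * pos order_trans[OF norm_ge_zero *(2)[of x y]]) auto
    finally show ?thesis by (simp add: algebra_simps)
  qed
  ultimately show ?thesis unfolding bounded_lipschitz_def by blast
qed

lemma bounded_lipschitz_Pair:
  assumes "bounded_lipschitz f" "bounded_lipschitz g"
  shows "bounded_lipschitz (\<lambda>x. (f x, g x))"
proof -
  obtain B L B' L' where *: "\<And>x. norm (f x) \<le> B" "\<And>x y. norm (f x - f y) \<le> L * norm (x - y)"
    "\<And>x. norm (g x) \<le> B'" "\<And>x y. norm (g x - g y) \<le> L' * norm (x - y)"
    using assms unfolding bounded_lipschitz_def by metis
  have "norm (f x, g x) \<le> B + B'" for x
    using norm_Pair_le[of "f x" "g x"] *(1)[of x] *(3)[of x] by linarith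
  moreover have "norm ((f x, g x) - (f y, g y)) \<le> (L + L') * norm (x - y)" for x y
    using norm_Pair_le[of "f x - f y" "g x - g y"] *(2)[of x y] *(4)[of x y]
    by (simp add: algebra_simps)
  ultimately show ?thesis unfolding bounded_lipschitz_def by blast
qed

text \<open>Covers \<open>min 1\<close> and \<open>max 0\<close>, the pieces of the cut-off field
  that are not polynomial.\<close>

lemma bounded_lipschitz_1_lipschitz:
  fixes f :: "'a::real_normed_vector \<Rightarrow> real"
  assumes "bounded_lipschitz f" and h: "\<And>u v::real. \<bar>h u - h v\<bar> \<le> \<bar>u - v\<bar>"
  shows "bounded_lipschitz (\<lambda>x. h (f x) :: real)"
proof -
  obtain B L where *: "\<And>x. norm (f x) \<le> B" "\<And>x y. norm (f x - f y) \<le> L * norm (x - y)"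
    using assms unfolding bounded_lipschitz_def by metis
  have "norm (h (f x)) \<le> \<bar>h 0\<bar> + B" for x
    using h[of "f x" 0] *(1)[of x] by (auto simp: abs_if split: if_splits)
  moreover have "norm (h (f x) - h (f y)) \<le> L * norm (x - y)" for x y
    using h[of "f x" "f y"] *(2)[of x y] by simp
  ultimately show ?thesis unfolding bounded_lipschitz_def by blast
qed

definition clip :: "real \<Rightarrow> real \<Rightarrow> real" where
  "clip M u = max (- M) (min M u)"

lemma clip_eq: "\<bar>u\<bar> \<le> M \<Longrightarrow> clip M u = u"
  by (auto simp: clip_def)

lemma abs_clip_le: "M \<ge> 0 \<Longrightarrow> \<bar>clip M u\<bar> \<le> \<bar>u\<bar>"
  by (auto simp: clip_def)

lemma clip_minus: "M \<ge> 0 \<Longrightarrow> clip M (- u) = - clip M u"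
  by (auto simp: clip_def)

lemma bounded_lipschitz_clip:
  fixes g :: "'a::real_normed_vector \<Rightarrow> real"
  assumes "bounded_linear g" "M \<ge> 0"
  shows "bounded_lipschitz (\<lambda>x. clip M (g x))"
proof -
  interpret bounded_linear g by fact
  obtain L where L: "\<And>x. norm (g x) \<le> norm x * L" using bounded by blast
  have "\<bar>clip M (g x) - clip M (g y)\<bar> \<le> L * norm (x - y)" for x y
  proof -
    have "\<bar>clip M (g x) - clip M (g y)\<bar> \<le> \<bar>g x - g y\<bar>" by (auto simp: clip_def)
    also have "\<dots> \<le> L * norm (x - y)" using L[of "x - y"] by (simp add: diff mult.commute)
    finally show ?thesis .
  qed
  moreover have "\<bar>clip M u\<bar> \<le> M" for u using assms(2) by (auto simp: clip_def)
  ultimately show ?thesis unfolding bounded_lipschitz_def real_norm_def by blast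
qed

text \<open>Cutting \<open>\<phi>\<close> off at height \<open>1\<close> in the potential and at \<open>0\<close> in the force does not
  affect solutions of the boundary value problem and makes all solutions global; here
  $\phi = \alpha\psi$ and $a = \delta s$.\<close>

definition cutoff :: "real \<Rightarrow> real \<Rightarrow> real" where
  "cutoff \<alpha> u = min 1 ((\<alpha> * u)\<^sup>2)"

definition force :: "real \<Rightarrow> real \<Rightarrow> real \<Rightarrow> real \<Rightarrow> real \<Rightarrow> real" where
  "force k \<alpha> \<delta> u v = k * max 0 u * (cutoff \<alpha> u + (\<delta> * v)\<^sup>2 - 1)"

lemma cutoff_bounds: "0 \<le> cutoff \<alpha> u" "cutoff \<alpha> u \<le> 1"
  by (auto simp: cutoff_def)

text \<open>Clipping never increases an absolute value, so the Gronwall rates, and with them these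
  bounds, do not depend on the level \<open>M\<close>; a level above all of them is then inactive up
  to time \<tau>. The pair \<open>(v, q)\<close> comes first because it grows at rate at most 1
  whatever \<open>u\<close> does; it bounds the potential by \<open>V\<close> in the linear estimate
  for \<open>(u, p)\<close>.\<close>

lemma truncated_bounds:
  fixes u p v q :: "real \<Rightarrow> real" and k M R \<tau> :: real
  defines "c \<equiv> clip M" and "V \<equiv> 1 + (R * exp \<tau>)\<^sup>2"
  assumes k: "0 \<le> k" and M: "0 \<le> M" and R: "0 \<le> R" and \<delta>: "\<delta> \<in> {0..R}" and p0: "\<bar>p 0\<bar> \<le> R"
    and init: "u 0 = 1" "v 0 = 0" "q 0 = 1"
    and der: "\<And>t. (u has_real_derivative c (p t)) (at t)"
      "\<And>t. (p has_real_derivative force k (c \<alpha>) (c \<delta>) (c (u t)) (c (v t))) (at t)"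
      "\<And>t. (v has_real_derivative c (q t)) (at t)"
      "\<And>t. (q has_real_derivative cutoff (c \<alpha>) (c (u t)) * c (v t)) (at t)"
    and t: "\<bar>t\<bar> \<le> \<tau>"
  shows "\<bar>u t\<bar> \<le> (1 + R) * exp ((1 + k * V) * \<tau>)" "\<bar>p t\<bar> \<le> (1 + R) * exp ((1 + k * V) * \<tau>)"
    "\<bar>v t\<bar> \<le> exp \<tau>" "\<bar>q t\<bar> \<le> exp \<tau>"
proof -
  have V: "V \<ge> 1" by (simp add: V_def)
  have sq: "\<bar>v t\<bar> \<le> exp \<tau>" "\<bar>q t\<bar> \<le> exp \<tau>" if t: "\<bar>t\<bar> \<le> \<tau>" for t
  proof -
    have "norm (v t, q t) \<le> norm (v 0, q 0) * exp (1 * \<bar>t\<bar>)"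
    proof (rule gronwall_norm_abs[where y = "\<lambda>t. (v t, q t)"])
      fix x
      show "((\<lambda>t. (v t, q t)) has_vector_derivative
         (c (q x), cutoff (c \<alpha>) (c (u x)) * c (v x))) (at x)"
        by (rule has_vector_derivative_Pair)
          (use der in \<open>auto simp: has_real_derivative_iff_has_vector_derivative[symmetric]\<close>)
      have "\<bar>cutoff (c \<alpha>) (c (u x)) * c (v x)\<bar> \<le> 1 * \<bar>v x\<bar>"
        unfolding abs_mult by (rule mult_mono)
          (use cutoff_bounds abs_clip_le[OF M] in \<open>auto simp: c_def\<close>)
      moreover have "\<bar>c (q x)\<bar> \<le> \<bar>q x\<bar>" using abs_clip_le[OF M] by (auto simp: c_def)
      ultimately show "norm (c (q x), cutoff (c \<alpha>) (c (u x)) * c (v x))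
          \<le> 1 * norm (v x, q x)"
        by (simp add: norm_Pair add.commute add_mono abs_le_square_iff)
    qed
    also have "\<dots> \<le> exp \<tau>" using t by (simp add: init)
    finally have "norm (v t, q t) \<le> exp \<tau>" .
    then show "\<bar>v t\<bar> \<le> exp \<tau>" "\<bar>q t\<bar> \<le> exp \<tau>"
      using norm_fst_le[of "v t" "q t"] norm_snd_le[of "q t" "v t"] by auto
  qed
  have up: "\<bar>u t\<bar> \<le> (1 + R) * exp ((1 + k * V) * \<tau>)" "\<bar>p t\<bar> \<le> (1 + R) * exp ((1 + k * V) * \<tau>)"
    if t: "\<bar>t\<bar> \<le> \<tau>" for t
  proof -
    have "norm (u t, p t) \<le> norm (u 0, p 0) * exp ((1 + k * V) * \<bar>t\<bar>)"
    proof (rule gronwall_norm_abs[where y = "\<lambda>t. (u t, p t)"])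
      fix x assume x: "\<bar>x\<bar> \<le> \<bar>t\<bar>"
      show "((\<lambda>t. (u t, p t)) has_vector_derivative
         (c (p x), force k (c \<alpha>) (c \<delta>) (c (u x)) (c (v x)))) (at x)"
        by (rule has_vector_derivative_Pair)
          (use der in \<open>auto simp: has_real_derivative_iff_has_vector_derivative[symmetric]\<close>)
      have "\<bar>c \<delta> * c (v x)\<bar> \<le> R * exp \<tau>"
        unfolding abs_mult
        by (rule mult_mono) (use sq[of x] x t \<delta> abs_clip_le[OF M, of \<delta>]
            abs_clip_le[OF M, of "v x"] R in \<open>auto simp: c_def\<close>)
      then have "(c \<delta> * c (v x))\<^sup>2 \<le> (R * exp \<tau>)\<^sup>2"
        using abs_le_square_iff[of "c \<delta> * c (v x)" "R * exp \<tau>"] R by auto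
      then have "\<bar>cutoff (c \<alpha>) (c (u x)) + (c \<delta> * c (v x))\<^sup>2 - 1\<bar> \<le> V"
        using cutoff_bounds[of "c \<alpha>" "c (u x)"] zero_le_power2[of "c \<delta> * c (v x)"]
        unfolding V_def by linarith
      then have "\<bar>k * max 0 (c (u x))\<bar> * \<bar>cutoff (c \<alpha>) (c (u x)) + (c \<delta> * c (v x))\<^sup>2 - 1\<bar>
          \<le> (k * \<bar>u x\<bar>) * V"
        using k abs_clip_le[OF M, of "u x"] unfolding abs_mult c_def
        by (intro mult_mono) auto
      then have 1: "\<bar>force k (c \<alpha>) (c \<delta>) (c (u x)) (c (v x))\<bar> \<le> k * V * \<bar>u x\<bar>"
        by (simp add: force_def abs_mult mult_ac)
      have 2: "\<bar>c (p x)\<bar> \<le> \<bar>p x\<bar>" using abs_clip_le[OF M] by (auto simp: c_def)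
      have "norm (c (p x), force k (c \<alpha>) (c \<delta>) (c (u x)) (c (v x)))
          \<le> \<bar>p x\<bar> + k * V * \<bar>u x\<bar>"
        by (rule order_trans[OF norm_Pair_le]) (use 1 2 in simp)
      also have "\<dots> \<le> norm (u x, p x) + k * V * norm (u x, p x)"
        using norm_fst_le[of "u x" "p x"] norm_snd_le[of "p x" "u x"] k V
        by (intro add_mono mult_left_mono) auto
      finally show "norm (c (p x), force k (c \<alpha>) (c \<delta>) (c (u x)) (c (v x)))
          \<le> (1 + k * V) * norm (u x, p x)"
        by (simp add: algebra_simps)
    qed
    also have "\<dots> \<le> (1 + R) * exp ((1 + k * V) * \<tau>)"
      using t p0 k V norm_Pair_le[of "1::real" "p 0"]
      by (intro mult_mono) (auto simp: init intro!: mult_left_mono)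
    finally have "norm (u t, p t) \<le> (1 + R) * exp ((1 + k * V) * \<tau>)" .
    then show "\<bar>u t\<bar> \<le> (1 + R) * exp ((1 + k * V) * \<tau>)" "\<bar>p t\<bar> \<le> (1 + R) * exp ((1 + k * V) * \<tau>)"
      using norm_fst_le[of "u t" "p t"] norm_snd_le[of "p t" "u t"] by auto
  qed
  show "\<bar>u t\<bar> \<le> (1 + R) * exp ((1 + k * V) * \<tau>)" "\<bar>p t\<bar> \<le> (1 + R) * exp ((1 + k * V) * \<tau>)"
    "\<bar>v t\<bar> \<le> exp \<tau>" "\<bar>q t\<bar> \<le> exp \<tau>" by (rule up[OF t] sq[OF t])+
qed

text \<open>The parameters \<alpha> and \<delta> are carried as state components with zero
  derivative, so joint continuity in all arguments is continuity of a single flow in initial value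
  and time. The reflection rule holds for the clipped field, hence without restriction on the
  arguments; it turns the left half of a solution into a right half with slope
  \<open>-\<rho>\<close>.\<close>

lemma truncated_flow:
  fixes k R \<tau> :: real
  assumes k: "k \<ge> 0" and R: "R \<ge> 0" and \<tau>: "\<tau> \<ge> 0"
  obtains \<psi> p s q :: "real \<Rightarrow> real \<Rightarrow> real \<Rightarrow> real \<Rightarrow> real" where
    "\<And>\<alpha> \<rho> \<delta>. \<psi> \<alpha> \<rho> \<delta> 0 = 1" "\<And>\<alpha> \<rho> \<delta>. p \<alpha> \<rho> \<delta> 0 = \<rho>"
    "\<And>\<alpha> \<rho> \<delta>. s \<alpha> \<rho> \<delta> 0 = 0" "\<And>\<alpha> \<rho> \<delta>. q \<alpha> \<rho> \<delta> 0 = 1"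
    "\<And>\<alpha> \<rho> \<delta> t. \<alpha> \<in> {0..1} \<Longrightarrow> \<rho> \<in> {-R..R} \<Longrightarrow> \<delta> \<in> {0..R} \<Longrightarrow> \<bar>t\<bar> \<le> \<tau> \<Longrightarrow>
       (\<psi> \<alpha> \<rho> \<delta> has_real_derivative p \<alpha> \<rho> \<delta> t) (at t) \<and>
       (p \<alpha> \<rho> \<delta> has_real_derivative force k \<alpha> \<delta> (\<psi> \<alpha> \<rho> \<delta> t) (s \<alpha> \<rho> \<delta> t)) (at t) \<and>
       (s \<alpha> \<rho> \<delta> has_real_derivative q \<alpha> \<rho> \<delta> t) (at t) \<and>
       (q \<alpha> \<rho> \<delta> has_real_derivative cutoff \<alpha> (\<psi> \<alpha> \<rho> \<delta> t) * s \<alpha> \<rho> \<delta> t) (at t)"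
    "continuous_on UNIV (\<lambda>(\<alpha>, \<rho>, \<delta>, t). (\<psi> \<alpha> \<rho> \<delta> t, p \<alpha> \<rho> \<delta> t, s \<alpha> \<rho> \<delta> t, q \<alpha> \<rho> \<delta> t))"
    "\<And>\<alpha> \<rho> \<delta> t. \<psi> \<alpha> (-\<rho>) \<delta> t = \<psi> \<alpha> \<rho> \<delta> (-t) \<and> p \<alpha> (-\<rho>) \<delta> t = - p \<alpha> \<rho> \<delta> (-t) \<and>
       s \<alpha> (-\<rho>) \<delta> t = - s \<alpha> \<rho> \<delta> (-t) \<and> q \<alpha> (-\<rho>) \<delta> t = q \<alpha> \<rho> \<delta> (-t)"
proof -
  define V where "V = 1 + (R * exp \<tau>)\<^sup>2"
  \<comment> \<open>Above everything that is clipped: \<open>1\<close> and \<open>R\<close> for the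
    parameters, \<open>exp \<tau>\<close> for \<open>s\<close> and \<open>q\<close>, the last term
    for \<psi> and \<open>p\<close>.\<close>
  define M where "M = 1 + R + exp \<tau> + (1 + R) * exp ((1 + k * V) * \<tau>)"
  have M: "M \<ge> 1 + R" "M \<ge> 1 + R + exp \<tau>" "M \<ge> (1 + R) * exp ((1 + k * V) * \<tau>)" "M \<ge> 0"
    using R by (auto simp: M_def)
  define c where "c = clip M"
  define f :: "real \<times> real \<times> real \<times> real \<times> real \<times> real \<Rightarrow> real \<times> real \<times> real \<times> real \<times> real \<times> real" where
    "f = (\<lambda>Z. case Z of (\<alpha>, \<delta>, u, p, v, q) \<Rightarrow>
       (0, 0, c p, force k (c \<alpha>) (c \<delta>) (c u) (c v), c q, cutoff (c \<alpha>) (c u) * c v))"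
  have clipc: "bounded_lipschitz (\<lambda>Z. c (g Z))" if "bounded_linear g"
    for g :: "real \<times> real \<times> real \<times> real \<times> real \<times> real \<Rightarrow> real"
    unfolding c_def by (rule bounded_lipschitz_clip[OF that M(4)])
  have blT: "bounded_lipschitz (\<lambda>Z. cutoff (g Z) (h Z))"
    if "bounded_lipschitz g" "bounded_lipschitz h"
    for g h :: "real \<times> real \<times> real \<times> real \<times> real \<times> real \<Rightarrow> real"
    unfolding cutoff_def power2_eq_square
    by (rule bounded_lipschitz_1_lipschitz[where h = "min 1"], (rule bounded_lipschitz_mult that)+)
      (auto simp: min_def)
  have bl: "bounded_lipschitz f"
    unfolding f_def case_prod_beta force_def power2_eq_square diff_conv_add_uminus
    by (intro bounded_lipschitz_Pair bounded_lipschitz_const bounded_lipschitz_add bounded_lipschitz_mult blT clipc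
        bounded_linear_intros bounded_lipschitz_1_lipschitz[where h = "max 0"]) auto
  then obtain L where lip: "\<And>x y. norm (f x - f y) \<le> L * norm (x - y)"
    unfolding bounded_lipschitz_def by blast
  obtain Y where Y0: "\<And>y0. Y y0 0 = y0"
    and Y1: "\<And>y0 t::real. (Y y0 has_vector_derivative f (Y y0 t)) (at t)"
    and Yc: "continuous_on UNIV (\<lambda>(y0, t). Y y0 t)"
    using lipschitz_ode_flow[OF lip] by metis
  define X where "X \<alpha> \<rho> \<delta> t = Y (\<alpha>, \<delta>, 1, \<rho>, 0, 1) t" for \<alpha> \<rho> \<delta> t
  define A where "A \<alpha> \<rho> \<delta> t = fst (X \<alpha> \<rho> \<delta> t)" for \<alpha> \<rho> \<delta> t
  define D where "D \<alpha> \<rho> \<delta> t = fst (snd (X \<alpha> \<rho> \<delta> t))" for \<alpha> \<rho> \<delta> t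
  define \<psi> where "\<psi> \<alpha> \<rho> \<delta> t = fst (snd (snd (X \<alpha> \<rho> \<delta> t)))" for \<alpha> \<rho> \<delta> t
  define p where "p \<alpha> \<rho> \<delta> t = fst (snd (snd (snd (X \<alpha> \<rho> \<delta> t))))" for \<alpha> \<rho> \<delta> t
  define s where "s \<alpha> \<rho> \<delta> t = fst (snd (snd (snd (snd (X \<alpha> \<rho> \<delta> t)))))" for \<alpha> \<rho> \<delta> t
  define q where "q \<alpha> \<rho> \<delta> t = snd (snd (snd (snd (snd (X \<alpha> \<rho> \<delta> t)))))" for \<alpha> \<rho> \<delta> t
  note defs = A_def D_def \<psi>_def p_def s_def q_def
  have X: "X \<alpha> \<rho> \<delta> t = (A \<alpha> \<rho> \<delta> t, D \<alpha> \<rho> \<delta> t, \<psi> \<alpha> \<rho> \<delta> t, p \<alpha> \<rho> \<delta> t, s \<alpha> \<rho> \<delta> t, q \<alpha> \<rho> \<delta> t)" for \<alpha> \<rho> \<delta> t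
    by (simp add: defs)
  have X1: "(X \<alpha> \<rho> \<delta> has_vector_derivative f (X \<alpha> \<rho> \<delta> t)) (at t)" for \<alpha> \<rho> \<delta> t
    unfolding X_def using Y1 by (simp add: has_vector_derivative_def)
  note vf = bounded_linear.has_vector_derivative[OF bounded_linear_fst]
    and vs = bounded_linear.has_vector_derivative[OF bounded_linear_snd]
  have der: "(A \<alpha> \<rho> \<delta> has_real_derivative 0) (at t)"
    "(D \<alpha> \<rho> \<delta> has_real_derivative 0) (at t)"
    "(\<psi> \<alpha> \<rho> \<delta> has_real_derivative c (p \<alpha> \<rho> \<delta> t)) (at t)"
    "(p \<alpha> \<rho> \<delta> has_real_derivative
       force k (c (A \<alpha> \<rho> \<delta> t)) (c (D \<alpha> \<rho> \<delta> t)) (c (\<psi> \<alpha> \<rho> \<delta> t)) (c (s \<alpha> \<rho> \<delta> t))) (at t)"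
    "(s \<alpha> \<rho> \<delta> has_real_derivative c (q \<alpha> \<rho> \<delta> t)) (at t)"
    "(q \<alpha> \<rho> \<delta> has_real_derivative cutoff (c (A \<alpha> \<rho> \<delta> t)) (c (\<psi> \<alpha> \<rho> \<delta> t)) * c (s \<alpha> \<rho> \<delta> t)) (at t)"
    for \<alpha> \<rho> \<delta> t
    using vf[OF X1[of \<alpha> \<rho> \<delta> t]] vf[OF vs[OF X1[of \<alpha> \<rho> \<delta> t]]] vf[OF vs[OF vs[OF X1[of \<alpha> \<rho> \<delta> t]]]]
      vf[OF vs[OF vs[OF vs[OF X1[of \<alpha> \<rho> \<delta> t]]]]] vf[OF vs[OF vs[OF vs[OF vs[OF X1[of \<alpha> \<rho> \<delta> t]]]]]]
      vs[OF vs[OF vs[OF vs[OF vs[OF X1[of \<alpha> \<rho> \<delta> t]]]]]]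
    unfolding has_real_derivative_iff_has_vector_derivative defs[abs_def]
    by (simp_all add: f_def case_prod_beta)
  have init: "A \<alpha> \<rho> \<delta> 0 = \<alpha>" "D \<alpha> \<rho> \<delta> 0 = \<delta>" "\<psi> \<alpha> \<rho> \<delta> 0 = 1" "p \<alpha> \<rho> \<delta> 0 = \<rho>" "s \<alpha> \<rho> \<delta> 0 = 0" "q \<alpha> \<rho> \<delta> 0 = 1"
    for \<alpha> \<rho> \<delta> by (simp_all add: defs X_def Y0)
  have AD: "A \<alpha> \<rho> \<delta> t = \<alpha>" "D \<alpha> \<rho> \<delta> t = \<delta>" for \<alpha> \<rho> \<delta> t
    using DERIV_isconst_all[of "A \<alpha> \<rho> \<delta>" t 0] DERIV_isconst_all[of "D \<alpha> \<rho> \<delta>" t 0] der(1,2) init(1,2) by metis+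
  note der = der(3-6)[unfolded AD]
  have der': "(\<psi> \<alpha> \<rho> \<delta> has_real_derivative p \<alpha> \<rho> \<delta> t) (at t) \<and>
       (p \<alpha> \<rho> \<delta> has_real_derivative force k \<alpha> \<delta> (\<psi> \<alpha> \<rho> \<delta> t) (s \<alpha> \<rho> \<delta> t)) (at t) \<and>
       (s \<alpha> \<rho> \<delta> has_real_derivative q \<alpha> \<rho> \<delta> t) (at t) \<and>
       (q \<alpha> \<rho> \<delta> has_real_derivative cutoff \<alpha> (\<psi> \<alpha> \<rho> \<delta> t) * s \<alpha> \<rho> \<delta> t) (at t)"
    if "\<alpha> \<in> {0..1}" "\<rho> \<in> {-R..R}" "\<delta> \<in> {0..R}" "\<bar>t\<bar> \<le> \<tau>" for \<alpha> \<rho> \<delta> t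
  proof -
    have "c \<alpha> = \<alpha>" "c \<delta> = \<delta>" "c (\<psi> \<alpha> \<rho> \<delta> t) = \<psi> \<alpha> \<rho> \<delta> t" "c (p \<alpha> \<rho> \<delta> t) = p \<alpha> \<rho> \<delta> t"
      "c (s \<alpha> \<rho> \<delta> t) = s \<alpha> \<rho> \<delta> t" "c (q \<alpha> \<rho> \<delta> t) = q \<alpha> \<rho> \<delta> t"
      unfolding c_def using that M R truncated_bounds[OF k M(4) R that(3) _ init(3,5,6)
        der[of \<alpha> \<rho> \<delta>, unfolded c_def] that(4)]
      by (auto intro!: clip_eq simp: init V_def abs_le_iff)
    then show ?thesis using der[of \<alpha> \<rho> \<delta> t] by simp
  qed
  have "continuous_on UNIV (\<lambda>(\<alpha>, \<rho>, \<delta>, t). X \<alpha> \<rho> \<delta> t)"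
    unfolding X_def case_prod_beta
    using continuous_on_compose2[OF Yc, of UNIV "\<lambda>(\<alpha>, \<rho>, \<delta>, t). ((\<alpha>, \<delta>, 1, \<rho>, 0, 1), t)"]
    by (simp add: case_prod_beta continuous_intros)
  then have cont: "continuous_on UNIV
      (\<lambda>(\<alpha>, \<rho>, \<delta>, t). (\<psi> \<alpha> \<rho> \<delta> t, p \<alpha> \<rho> \<delta> t, s \<alpha> \<rho> \<delta> t, q \<alpha> \<rho> \<delta> t))"
    unfolding defs case_prod_beta by (intro continuous_intros)
  \<comment> \<open>\<open>r\<close> conjugates the field to its time reversal, because the force is
    even and the right-hand side of the equation for \<open>q\<close> is odd in
    \<open>s\<close>.\<close>
  define r :: "real \<times> real \<times> real \<times> real \<times> real \<times> real \<Rightarrow> real \<times> real \<times> real \<times> real \<times> real \<times> real"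
    where "r = (\<lambda>(\<alpha>, \<delta>, u, p, v, q). (\<alpha>, \<delta>, u, - p, - v, q))"
  have rl: "bounded_linear r"
    unfolding r_def case_prod_beta by (intro bounded_linear_intros bounded_linear_minus)
  have "X \<alpha> (-\<rho>) \<delta> t = r (X \<alpha> \<rho> \<delta> (-t))" for \<alpha> \<rho> \<delta> t
  proof -
    have "((\<lambda>t. r (X \<alpha> \<rho> \<delta> (-t))) has_vector_derivative f (r (X \<alpha> \<rho> \<delta> (-t)))) (at t)" for t
    proof -
      have "((X \<alpha> \<rho> \<delta> \<circ> uminus) has_vector_derivative (-1) *\<^sub>R f (X \<alpha> \<rho> \<delta> (-t))) (at t)"
        by (rule vector_diff_chain_at) (use X1 in \<open>auto intro!: derivative_eq_intros\<close>)
      from bounded_linear.has_vector_derivative[OF rl this]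
      have "((\<lambda>t. r (X \<alpha> \<rho> \<delta> (-t))) has_vector_derivative r ((-1) *\<^sub>R f (X \<alpha> \<rho> \<delta> (-t)))) (at t)"
        by (simp add: o_def)
      moreover have "r ((-1) *\<^sub>R f Z) = f (r Z)" for Z
        using clip_minus[OF M(4)]
        by (auto simp: r_def f_def case_prod_beta force_def cutoff_def c_def prod_eq_iff)
      ultimately show ?thesis by simp
    qed
    then have "norm (X \<alpha> (-\<rho>) \<delta> t - r (X \<alpha> \<rho> \<delta> (-t)))
        \<le> norm (X \<alpha> (-\<rho>) \<delta> 0 - r (X \<alpha> \<rho> \<delta> (-0))) * exp (L * \<bar>t\<bar>)"
      by (intro lipschitz_ode_dependence[OF lip X1, where z = "\<lambda>t. r (X \<alpha> \<rho> \<delta> (-t))"])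
    then show ?thesis by (simp add: X_def Y0 r_def)
  qed
  then have refl: "\<psi> \<alpha> (-\<rho>) \<delta> t = \<psi> \<alpha> \<rho> \<delta> (-t) \<and> p \<alpha> (-\<rho>) \<delta> t = - p \<alpha> \<rho> \<delta> (-t) \<and>
       s \<alpha> (-\<rho>) \<delta> t = - s \<alpha> \<rho> \<delta> (-t) \<and> q \<alpha> (-\<rho>) \<delta> t = q \<alpha> \<rho> \<delta> (-t)" for \<alpha> \<rho> \<delta> t
    by (simp add: defs r_def case_prod_beta)
  show ?thesis
  proof (rule that[of \<psi> p s q])
    fix \<alpha> \<rho> \<delta> t :: real
    show "\<psi> \<alpha> \<rho> \<delta> 0 = 1" by (rule init)
    show "p \<alpha> \<rho> \<delta> 0 = \<rho>" by (rule init)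
    show "s \<alpha> \<rho> \<delta> 0 = 0" by (rule init)
    show "q \<alpha> \<rho> \<delta> 0 = 1" by (rule init)
    show "\<psi> \<alpha> (-\<rho>) \<delta> t = \<psi> \<alpha> \<rho> \<delta> (-t) \<and> p \<alpha> (-\<rho>) \<delta> t = - p \<alpha> \<rho> \<delta> (-t) \<and>
       s \<alpha> (-\<rho>) \<delta> t = - s \<alpha> \<rho> \<delta> (-t) \<and> q \<alpha> (-\<rho>) \<delta> t = q \<alpha> \<rho> \<delta> (-t)"
      by (rule refl)
    assume "\<alpha> \<in> {0..1}" "\<rho> \<in> {-R..R}" "\<delta> \<in> {0..R}" "\<bar>t\<bar> \<le> \<tau>"
    then show "(\<psi> \<alpha> \<rho> \<delta> has_real_derivative p \<alpha> \<rho> \<delta> t) (at t) \<and>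
       (p \<alpha> \<rho> \<delta> has_real_derivative force k \<alpha> \<delta> (\<psi> \<alpha> \<rho> \<delta> t) (s \<alpha> \<rho> \<delta> t)) (at t) \<and>
       (s \<alpha> \<rho> \<delta> has_real_derivative q \<alpha> \<rho> \<delta> t) (at t) \<and>
       (q \<alpha> \<rho> \<delta> has_real_derivative cutoff \<alpha> (\<psi> \<alpha> \<rho> \<delta> t) * s \<alpha> \<rho> \<delta> t) (at t)"
      by (rule der')
  qed (rule cont)
qed

section \<open>Half solutions\<close>

lemma derivative_continuous_on:
  fixes f f' :: "real \<Rightarrow> real"
  assumes "\<And>x. a \<le> x \<Longrightarrow> x \<le> b \<Longrightarrow> (f has_real_derivative f' x) (at x)"
  shows "continuous_on {a..b} f"
  by (rule DERIV_continuous_on[of _ _ f'], rule has_field_derivative_at_within) (use assms in auto)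

lemma derivative_nonneg_le:
  fixes f f' :: "real \<Rightarrow> real"
  assumes "a \<le> b" "\<And>x. a \<le> x \<Longrightarrow> x \<le> b \<Longrightarrow> (f has_real_derivative f' x) (at x)"
    "\<And>x. a \<le> x \<Longrightarrow> x \<le> b \<Longrightarrow> 0 \<le> f' x"
  shows "f a \<le> f b"
  using DERIV_nonneg_imp_nondecreasing[of a b f] assms by blast

lemma derivative_nonpos_ge:
  fixes f f' :: "real \<Rightarrow> real"
  assumes "a \<le> b" "\<And>x. a \<le> x \<Longrightarrow> x \<le> b \<Longrightarrow> (f has_real_derivative f' x) (at x)"
    "\<And>x. a \<le> x \<Longrightarrow> x \<le> b \<Longrightarrow> f' x \<le> 0"
  shows "f b \<le> f a"
  using DERIV_nonpos_imp_nonincreasing[of a b f] assms by blast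

lemma derivative_pos_less:
  fixes f f' :: "real \<Rightarrow> real"
  assumes "a < b" "\<And>x. a \<le> x \<Longrightarrow> x \<le> b \<Longrightarrow> (f has_real_derivative f' x) (at x)"
    "\<And>x. a < x \<Longrightarrow> x < b \<Longrightarrow> 0 < f' x"
  shows "f a < f b"
proof (rule DERIV_pos_imp_increasing_open[OF assms(1)])
  show "\<exists>y. (f has_real_derivative y) (at x) \<and> 0 < y" if "a < x" "x < b" for x
    using assms(2)[of x] assms(3)[of x] that by auto
  show "continuous_on {a..b} f"
    by (rule derivative_continuous_on) (rule assms(2))
qed

lemma first_zero:
  fixes f :: "real \<Rightarrow> real"
  assumes cont: "continuous_on {a..b} f" and a: "0 < f a" and x: "a \<le> x" "x \<le> b" "f x \<le> 0"
  obtains y where "a < y" "y \<le> x" "f y = 0" "\<And>t. a \<le> t \<Longrightarrow> t < y \<Longrightarrow> 0 < f t"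
proof -
  define S where "S = {t \<in> {a..x}. f t \<le> 0}"
  have contx: "continuous_on {a..x} f" by (rule continuous_on_subset[OF cont]) (use x in auto)
  have "closed ({a..x} \<inter> f -` {..0})"
    by (rule continuous_closed_preimage[OF contx]) auto
  then have "closed S" by (simp add: S_def Int_def vimage_def)
  moreover have "bounded S" by (rule bounded_subset[of "{a..x}"]) (auto simp: S_def)
  ultimately have "compact S" by (simp add: compact_eq_bounded_closed)
  moreover have "S \<noteq> {}" using x by (auto simp: S_def)
  ultimately obtain y where y: "y \<in> S" "\<And>t. t \<in> S \<Longrightarrow> y \<le> t"
    using compact_attains_inf by meson
  have pos: "0 < f t" if "a \<le> t" "t < y" for t
    using y that by (force simp: S_def)
  have ya: "a < y" using y(1) a by (cases "y = a") (auto simp: S_def)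
  have "f y = 0"
  proof (rule ccontr)
    assume "f y \<noteq> 0"
    then have "f y < 0" using y(1) by (simp add: S_def)
    moreover have "continuous_on {a..y} f"
      by (rule continuous_on_subset[OF contx]) (use y(1) in \<open>auto simp: S_def\<close>)
    ultimately obtain t where "a \<le> t" "t \<le> y" "f t = 0"
      using IVT2'[of f y 0 a] a ya by auto
    then show False using pos[of t] \<open>f y < 0\<close> by (cases "t = y") auto
  qed
  then show ?thesis using that[of y] ya y(1) pos by (auto simp: S_def)
qed

text \<open>Comparison principle for \<open>D'' \<ge> c D\<close> with \<open>c \<ge> 0\<close>. The
  weak initial signs are made strict by adding \<open>\<epsilon> * exp (M * x)\<close>, itself a
  subsolution as \<open>M * M \<ge> M \<ge> c\<close>. Then \<open>E\<close> has no first zero,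
  because up to it \<open>D\<close> is positive and \<open>E\<close> nondecreasing.\<close>

lemma second_order_nonneg:
  fixes D E e c :: "real \<Rightarrow> real"
  assumes D: "\<And>x. 0 \<le> x \<Longrightarrow> x \<le> y \<Longrightarrow> (D has_real_derivative E x) (at x)"
    and E: "\<And>x. 0 \<le> x \<Longrightarrow> x \<le> y \<Longrightarrow> (E has_real_derivative e x) (at x)"
    and e: "\<And>x. 0 \<le> x \<Longrightarrow> x \<le> y \<Longrightarrow> c x * D x \<le> e x"
    and c: "\<And>x. 0 \<le> x \<Longrightarrow> x \<le> y \<Longrightarrow> 0 \<le> c x \<and> c x \<le> M" and M: "1 \<le> M"
    and init: "0 \<le> D 0" "0 \<le> E 0" and x: "0 \<le> x" "x \<le> y"
  shows "0 \<le> D x" "0 \<le> E x"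
proof -
  have *: "0 < D x + \<epsilon> * exp (M * x) \<and> 0 < E x + \<epsilon> * M * exp (M * x)"
    if \<epsilon>: "\<epsilon> > 0" and x: "0 \<le> x" "x \<le> y" for \<epsilon> x
  proof -
    define D1 where "D1 x = D x + \<epsilon> * exp (M * x)" for x
    define E1 where "E1 x = E x + \<epsilon> * M * exp (M * x)" for x
    have D1: "(D1 has_real_derivative E1 x) (at x)" if "0 \<le> x" "x \<le> y" for x
      unfolding D1_def E1_def using D that by (auto intro!: derivative_eq_intros)
    have E1: "(E1 has_real_derivative e x + \<epsilon> * M * (exp (M * x) * M)) (at x)" if "0 \<le> x" "x \<le> y" for x
      unfolding E1_def using E that by (auto intro!: derivative_eq_intros)
    have D1pos: "0 < D1 z" if z: "0 \<le> z" "z \<le> y" "\<And>t. 0 \<le> t \<Longrightarrow> t < z \<Longrightarrow> 0 < E1 t" for z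
    proof -
      have "D1 0 \<le> D1 z"
      proof (rule DERIV_nonneg_imp_increasing_open[OF z(1)])
        show "continuous_on {0..z} D1" by (rule derivative_continuous_on[OF D1]) (use z in auto)
        show "\<exists>D. (D1 has_real_derivative D) (at t) \<and> 0 \<le> D" if "0 < t" "t < z" for t
          using D1[of t] z(2) z(3)[of t] that by (auto intro!: exI)
      qed
      moreover have "0 < D1 0" using init \<epsilon> by (simp add: D1_def)
      ultimately show ?thesis by linarith
    qed
    have E1pos: "0 < E1 x" if x: "0 \<le> x" "x \<le> y" for x
    proof (rule ccontr)
      assume "\<not> 0 < E1 x"
      moreover have "0 < E1 0" using init \<epsilon> M by (simp add: E1_def add_nonneg_pos)
      moreover have "continuous_on {0..x} E1"
        by (rule derivative_continuous_on[OF E1]) (use x in auto)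
      ultimately obtain z where z: "0 < z" "z \<le> x" "E1 z = 0" "\<And>t. 0 \<le> t \<Longrightarrow> t < z \<Longrightarrow> 0 < E1 t"
        using first_zero[of 0 x E1 x] x by auto
      have "E1 0 \<le> E1 z"
      proof (rule derivative_nonneg_le[where f = E1 and f' = "\<lambda>t. e t + \<epsilon> * M * (exp (M * t) * M)"])
        fix t assume t: "0 \<le> t" "t \<le> z"
        then show "(E1 has_real_derivative e t + \<epsilon> * M * (exp (M * t) * M)) (at t)" using E1 z x by auto
        have "0 < D1 t" using D1pos[of t] t z x by auto
        moreover have "c t \<le> M" using c[of t] t z x by auto
        then have "c t \<le> M * M" using M mult_left_mono[of 1 M M] by linarith
        ultimately have "0 \<le> c t * D1 t + (M * M - c t) * (\<epsilon> * exp (M * t))"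
          using c[of t] t z x \<epsilon> by (intro add_nonneg_nonneg mult_nonneg_nonneg) auto
        also have "\<dots> \<le> e t + \<epsilon> * M * (exp (M * t) * M)"
          using e[of t] t z x by (simp add: D1_def algebra_simps)
        finally show "0 \<le> e t + \<epsilon> * M * (exp (M * t) * M)" .
      qed (use z in auto)
      then show False using z \<open>0 < E1 0\<close> by simp
    qed
    show ?thesis
      using D1pos[of x] E1pos x by (simp add: D1_def E1_def)
  qed
  \<comment> \<open>For fixed \<open>x\<close> the perturbation is rescaled so that its size at
    \<open>x\<close> is exactly \<epsilon>.\<close>
  have "0 \<le> D x + \<epsilon>" "0 \<le> E x + \<epsilon>" if "\<epsilon> > 0" for \<epsilon>
    using *[of "\<epsilon> / exp (M * x)" x] *[of "\<epsilon> / (M * exp (M * x))" x] that x M by auto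
  then show "0 \<le> D x" "0 \<le> E x" by (meson field_le_epsilon)+
qed

section \<open>The initial value problem on one side of the zero of \<open>a\<close>\<close>

locale half_solution =
  fixes k \<alpha> \<delta> l :: real and \<psi> p s q :: "real \<Rightarrow> real"
  assumes k: "0 < k" and \<alpha>: "0 \<le> \<alpha>" "\<alpha> \<le> 1" and \<delta>: "0 \<le> \<delta>" and l: "0 \<le> l"
    and init: "\<psi> 0 = 1" "s 0 = 0" "q 0 = 1"
    and \<psi>': "\<And>x. 0 \<le> x \<Longrightarrow> x \<le> l \<Longrightarrow> (\<psi> has_real_derivative p x) (at x)"
    and p': "\<And>x. 0 \<le> x \<Longrightarrow> x \<le> l \<Longrightarrow> (p has_real_derivative force k \<alpha> \<delta> (\<psi> x) (s x)) (at x)"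
    and s': "\<And>x. 0 \<le> x \<Longrightarrow> x \<le> l \<Longrightarrow> (s has_real_derivative q x) (at x)"
    and q': "\<And>x. 0 \<le> x \<Longrightarrow> x \<le> l \<Longrightarrow> (q has_real_derivative cutoff \<alpha> (\<psi> x) * s x) (at x)"
begin

text \<open>Where \<psi> is positive the equation is \<open>\<psi>'' = k w \<psi>\<close>, so
  \<open>p / \<psi>\<close> solves the Riccati equation \<open>y' = k w - y\<^sup>2\<close>; the
  barriers below are barriers for the latter.\<close>

definition w :: "real \<Rightarrow> real" where "w x = cutoff \<alpha> (\<psi> x) + (\<delta> * s x)\<^sup>2 - 1"

lemma force_pos: "0 < \<psi> x \<Longrightarrow> force k \<alpha> \<delta> (\<psi> x) (s x) = k * \<psi> x * w x"
  by (simp add: force_def w_def)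

lemma w_ge: "- 1 \<le> w x"
  using cutoff_bounds[of \<alpha> "\<psi> x"] zero_le_power2[of "\<delta> * s x"] unfolding w_def by linarith

lemma w_le: "w x \<le> (\<delta> * s x)\<^sup>2"
  using cutoff_bounds[of \<alpha> "\<psi> x"] by (simp add: w_def)

lemma w_ge_square: "(\<delta> * s x)\<^sup>2 - 1 \<le> w x"
  using cutoff_bounds[of \<alpha> "\<psi> x"] by (simp add: w_def)

lemma continuous:
  assumes "0 \<le> a" "b \<le> l"
  shows "continuous_on {a..b} \<psi>" "continuous_on {a..b} p" "continuous_on {a..b} s" "continuous_on {a..b} q"
  by (rule derivative_continuous_on, (rule \<psi>' p' s' q'; use assms in auto))+

lemma q_pos:
  assumes x: "0 \<le> x" "x \<le> l"
  shows "0 < q x"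
proof (rule ccontr)
  assume "\<not> 0 < q x"
  then obtain y where y: "0 < y" "y \<le> x" "q y = 0" "\<And>t. 0 \<le> t \<Longrightarrow> t < y \<Longrightarrow> 0 < q t"
    using first_zero[of 0 x q x] continuous(4)[of 0 x] x init by auto
  have q0: "0 \<le> q t" if "0 \<le> t" "t \<le> y" for t
    using y(3) y(4)[of t] that by (cases "t = y") auto
  have s0: "0 \<le> s t" if "0 \<le> t" "t \<le> y" for t
    using derivative_nonneg_le[of 0 t s q] s' q0 that y x init by auto
  have "q 0 \<le> q y"
    by (rule derivative_nonneg_le[of 0 y q "\<lambda>x. cutoff \<alpha> (\<psi> x) * s x"])
      (use q' s0 y x cutoff_bounds in auto)
  then show False using y init by simp
qed

lemma s_mono: "0 \<le> x \<Longrightarrow> x \<le> y \<Longrightarrow> y \<le> l \<Longrightarrow> s x \<le> s y"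
  by (rule derivative_nonneg_le[of x y s q]) (auto intro!: s' less_imp_le[OF q_pos])

lemma s_nonneg: "0 \<le> x \<Longrightarrow> x \<le> l \<Longrightarrow> 0 \<le> s x"
  using s_mono[of 0 x] init by simp

lemma q_mono: "0 \<le> x \<Longrightarrow> x \<le> y \<Longrightarrow> y \<le> l \<Longrightarrow> q x \<le> q y"
  by (rule derivative_nonneg_le[of x y q "\<lambda>x. cutoff \<alpha> (\<psi> x) * s x"])
    (use q' s_nonneg cutoff_bounds in auto)

lemma q_ge_1: "0 \<le> x \<Longrightarrow> x \<le> l \<Longrightarrow> 1 \<le> q x"
  using q_mono[of 0 x] init by simp

lemma s_ge:
  assumes "0 \<le> x" "x \<le> l"
  shows "x \<le> s x"
proof -
  have "s 0 - 0 \<le> s x - x"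
    by (rule derivative_nonneg_le[of 0 x "\<lambda>x. s x - x" "\<lambda>x. q x - 1"])
      (use s' q_ge_1 assms in \<open>auto intro!: derivative_eq_intros\<close>)
  then show ?thesis using init by simp
qed

lemma s_q_le_exp:
  assumes x: "0 \<le> x" "x \<le> l"
  shows "s x + q x \<le> exp x"
proof -
  have "(s x + q x) * exp (- x) \<le> (s 0 + q 0) * exp (- 0)"
  proof (rule derivative_nonpos_ge[where f = "\<lambda>x. (s x + q x) * exp (- x)" and
        f' = "\<lambda>t. (q t + cutoff \<alpha> (\<psi> t) * s t) * exp (- t) + (s t + q t) * - exp (- t)"])
    fix t assume t: "0 \<le> t" "t \<le> x"
    show "((\<lambda>x. (s x + q x) * exp (- x)) has_real_derivative
        (q t + cutoff \<alpha> (\<psi> t) * s t) * exp (- t) + (s t + q t) * - exp (- t)) (at t)"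
      using t x by (auto intro!: derivative_eq_intros s' q')
    have "cutoff \<alpha> (\<psi> t) * s t \<le> 1 * s t"
      using t x cutoff_bounds s_nonneg by (intro mult_right_mono) auto
    then have "(q t + cutoff \<alpha> (\<psi> t) * s t) * exp (- t) \<le> (s t + q t) * exp (- t)"
      by (intro mult_right_mono) auto
    then show "(q t + cutoff \<alpha> (\<psi> t) * s t) * exp (- t) + (s t + q t) * - exp (- t) \<le> 0"
      by simp
  qed (use x in auto)
  then show ?thesis using init by (simp add: exp_minus divide_simps)
qed

text \<open>\<open>-\<beta>\<close> is a subsolution of the Riccati equation and \<open>B\<close> a
  primitive of \<beta>. The factor \<open>exp (- B)\<close> cancels the terms with \<open>p\<close>
  in the derivative of \<open>p + \<beta> \<psi>\<close> and leaves
  \<open>(k w + \<beta>' - \<beta>\<^sup>2) \<psi>\<close> times this factor. Positivity of \<psi>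
  is part of the result: the lower bound holds up to a first zero and excludes it.\<close>

lemma barrier:
  assumes B: "\<And>x. 0 \<le> x \<Longrightarrow> x \<le> y \<Longrightarrow> (B has_real_derivative \<beta> x) (at x)"
    and \<beta>: "\<And>x. 0 \<le> x \<Longrightarrow> x \<le> y \<Longrightarrow> (\<beta> has_real_derivative \<beta>' x) (at x)"
    and sub: "\<And>x. 0 \<le> x \<Longrightarrow> x \<le> y \<Longrightarrow> 0 \<le> k * w x + \<beta>' x - (\<beta> x)\<^sup>2"
    and init0: "0 \<le> p 0 + \<beta> 0" "B 0 = 0" and x: "0 \<le> x" "x \<le> y" and y: "y \<le> l"
  shows "0 \<le> p x + \<beta> x * \<psi> x" "exp (- B x) \<le> \<psi> x"
proof -
  have Z: "0 \<le> p z + \<beta> z * \<psi> z"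
    if z: "0 \<le> z" "z \<le> y" and pos: "\<And>t. 0 \<le> t \<Longrightarrow> t < z \<Longrightarrow> 0 < \<psi> t" for z
  proof -
    have "(p 0 + \<beta> 0 * \<psi> 0) * exp (- B 0) \<le> (p z + \<beta> z * \<psi> z) * exp (- B z)"
    proof (rule DERIV_nonneg_imp_increasing_open[OF z(1),
          where f = "\<lambda>x. (p x + \<beta> x * \<psi> x) * exp (- B x)"])
      have der: "((\<lambda>x. (p x + \<beta> x * \<psi> x) * exp (- B x)) has_real_derivative
          (force k \<alpha> \<delta> (\<psi> t) (s t) + (\<beta>' t * \<psi> t + p t * \<beta> t)) * exp (- B t)
            + (p t + \<beta> t * \<psi> t) * (exp (- B t) * - \<beta> t)) (at t)" if "0 \<le> t" "t \<le> z" for t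
        using that z y by (auto intro!: derivative_eq_intros \<psi>' p' B \<beta>)
      show "continuous_on {0..z} (\<lambda>x. (p x + \<beta> x * \<psi> x) * exp (- B x))"
        by (rule derivative_continuous_on[OF der])
      fix t assume t: "0 < t" "t < z"
      have "force k \<alpha> \<delta> (\<psi> t) (s t) = k * \<psi> t * w t" using pos t by (intro force_pos) auto
      then have "(force k \<alpha> \<delta> (\<psi> t) (s t) + (\<beta>' t * \<psi> t + p t * \<beta> t)) * exp (- B t)
            + (p t + \<beta> t * \<psi> t) * (exp (- B t) * - \<beta> t)
          = (k * w t + \<beta>' t - (\<beta> t)\<^sup>2) * \<psi> t * exp (- B t)"
        by (simp add: algebra_simps power2_eq_square)
      also have "\<dots> \<ge> 0" using sub[of t] pos[of t] t z by simp
      finally show "\<exists>D. ((\<lambda>x. (p x + \<beta> x * \<psi> x) * exp (- B x)) has_real_derivative D) (at t) \<and> 0 \<le> D"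
        using der[of t] t by auto
    qed
    moreover have "0 \<le> (p 0 + \<beta> 0 * \<psi> 0) * exp (- B 0)" using init0 init by simp
    ultimately have "0 \<le> (p z + \<beta> z * \<psi> z) * exp (- B z)" by linarith
    then show ?thesis by (simp add: zero_le_mult_iff)
  qed
  have low: "exp (- B z) \<le> \<psi> z"
    if z: "0 \<le> z" "z \<le> y" and pos: "\<And>t. 0 \<le> t \<Longrightarrow> t < z \<Longrightarrow> 0 < \<psi> t" for z
  proof -
    have "\<psi> 0 * exp (B 0) \<le> \<psi> z * exp (B z)"
    proof (rule derivative_nonneg_le[where f = "\<lambda>x. \<psi> x * exp (B x)" and
          f' = "\<lambda>t. p t * exp (B t) + exp (B t) * \<beta> t * \<psi> t"])
      fix t assume t: "0 \<le> t" "t \<le> z"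
      show "((\<lambda>x. \<psi> x * exp (B x)) has_real_derivative p t * exp (B t) + exp (B t) * \<beta> t * \<psi> t) (at t)"
        using t z y by (auto intro!: derivative_eq_intros \<psi>' B)
      have "0 \<le> p t + \<beta> t * \<psi> t" by (rule Z) (use t z pos in auto)
      then have "0 \<le> (p t + \<beta> t * \<psi> t) * exp (B t)" by simp
      then show "0 \<le> p t * exp (B t) + exp (B t) * \<beta> t * \<psi> t" by (simp add: algebra_simps)
    qed (use z in auto)
    then show ?thesis using init0 init by (simp add: exp_minus divide_simps)
  qed
  have pos: "0 < \<psi> z" if z: "0 \<le> z" "z \<le> y" for z
  proof (rule ccontr)
    assume "\<not> 0 < \<psi> z"
    then obtain v where v: "0 < v" "v \<le> z" "\<psi> v = 0" "\<And>t. 0 \<le> t \<Longrightarrow> t < v \<Longrightarrow> 0 < \<psi> t"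
      using first_zero[of 0 z \<psi> z] continuous(1)[of 0 z] z y init by auto
    have "exp (- B v) \<le> \<psi> v" by (rule low) (use v z in auto)
    then show False using v by (simp add: not_le[symmetric])
  qed
  show "0 \<le> p x + \<beta> x * \<psi> x" "exp (- B x) \<le> \<psi> x"
    using Z[of x] low[of x] pos x by auto
qed

text \<open>With the reverse inequality the same product is nonincreasing, so a sign at the right
  end can be carried back to the left. No lower bound for \<psi> results here, which is why its
  positivity is assumed.\<close>

lemma upper_barrier:
  assumes B: "\<And>x. 0 \<le> x \<Longrightarrow> x \<le> y \<Longrightarrow> (B has_real_derivative \<beta> x) (at x)"
    and \<beta>: "\<And>x. 0 \<le> x \<Longrightarrow> x \<le> y \<Longrightarrow> (\<beta> has_real_derivative \<beta>' x) (at x)"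
    and super: "\<And>x. 0 \<le> x \<Longrightarrow> x \<le> y \<Longrightarrow> k * w x + \<beta>' x - (\<beta> x)\<^sup>2 \<le> 0"
    and pos: "\<And>x. 0 \<le> x \<Longrightarrow> x < y \<Longrightarrow> 0 < \<psi> x"
    and x: "0 \<le> x" "x \<le> y" and y: "y \<le> l"
  shows "(p y + \<beta> y * \<psi> y) * exp (- B y) \<le> (p x + \<beta> x * \<psi> x) * exp (- B x)"
proof (rule DERIV_nonpos_imp_decreasing_open[OF x(2),
      where f = "\<lambda>x. (p x + \<beta> x * \<psi> x) * exp (- B x)"])
  have der: "((\<lambda>x. (p x + \<beta> x * \<psi> x) * exp (- B x)) has_real_derivative
      (force k \<alpha> \<delta> (\<psi> t) (s t) + (\<beta>' t * \<psi> t + p t * \<beta> t)) * exp (- B t)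
        + (p t + \<beta> t * \<psi> t) * (exp (- B t) * - \<beta> t)) (at t)" if "x \<le> t" "t \<le> y" for t
    using that x y by (auto intro!: derivative_eq_intros \<psi>' p' B \<beta>)
  show "continuous_on {x..y} (\<lambda>x. (p x + \<beta> x * \<psi> x) * exp (- B x))"
    by (rule derivative_continuous_on[OF der])
  fix t assume t: "x < t" "t < y"
  have "force k \<alpha> \<delta> (\<psi> t) (s t) = k * \<psi> t * w t" using pos x t by (intro force_pos) auto
  then have "(force k \<alpha> \<delta> (\<psi> t) (s t) + (\<beta>' t * \<psi> t + p t * \<beta> t)) * exp (- B t)
        + (p t + \<beta> t * \<psi> t) * (exp (- B t) * - \<beta> t)
      = (k * w t + \<beta>' t - (\<beta> t)\<^sup>2) * (\<psi> t * exp (- B t))"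
    by (simp add: algebra_simps power2_eq_square)
  also have "\<dots> \<le> 0" using super[of t] pos[of t] t x by (intro mult_nonpos_nonneg) auto
  finally show "\<exists>D. ((\<lambda>x. (p x + \<beta> x * \<psi> x) * exp (- B x)) has_real_derivative D) (at t) \<and> D \<le> 0"
    using der[of t] t by auto
qed

text \<open>Since \<open>s \<le> exp l\<close>, the number \<open>m\<^sup>2\<close> bounds
  \<open>k w\<close>, and the constant \<open>m\<close> is admissible in
  \<open>upper_barrier\<close>. The condition involves neither \<alpha> nor the initial
  slope.\<close>

definition growth :: "real \<Rightarrow> bool" where
  "growth m \<longleftrightarrow> 0 < m \<and> k * (\<delta> * exp l)\<^sup>2 \<le> m\<^sup>2"

lemma growth_w:
  assumes "growth m" "0 \<le> x" "x \<le> l"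
  shows "k * w x \<le> m\<^sup>2"
proof -
  have "s x \<le> exp l" using s_q_le_exp[of x] q_pos[of x] assms by (smt (verit) exp_le_cancel_iff)
  then have "(\<delta> * s x)\<^sup>2 \<le> (\<delta> * exp l)\<^sup>2"
    using \<delta> s_nonneg[of x] assms by (intro power_mono mult_left_mono) auto
  then have "k * w x \<le> k * (\<delta> * exp l)\<^sup>2"
    using k w_le[of x] by (intro mult_left_mono) auto
  then show ?thesis using assms by (simp add: growth_def)
qed

text \<open>The constant barrier is run backwards from \<open>y\<close>, where
  \<open>p + m \<psi>\<close> is nonnegative. The resulting lower bound for \<psi> is uniform in
  \<alpha> and in the initial slope; at \<open>x = 0\<close> the first claim bounds that slope below
  by \<open>-m\<close>.\<close>

lemma growth_bound:
  assumes m: "growth m" and pos: "\<And>t. 0 \<le> t \<Longrightarrow> t < y \<Longrightarrow> 0 < \<psi> t"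
    and y: "y \<le> l" "0 \<le> p y" and x: "0 \<le> x" "x \<le> y"
  shows "0 \<le> p x + m * \<psi> x" "exp (- m * x) \<le> \<psi> x"
proof -
  have \<psi>y: "0 \<le> \<psi> y"
  proof (rule ccontr)
    assume "\<not> 0 \<le> \<psi> y"
    then obtain t where t: "0 < t" "t \<le> y" "\<psi> t = 0"
      using first_zero[of 0 y \<psi> y] continuous(1)[of 0 y] x y init by (metis less_eq_real_def linear order_trans zero_less_one)
    then show False using pos[of t] \<open>\<not> 0 \<le> \<psi> y\<close> by (cases "t = y") auto
  qed
  have *: "0 \<le> p z + m * \<psi> z" if z: "0 \<le> z" "z \<le> y" for z
  proof -
    have "(p y + m * \<psi> y) * exp (- (m * y)) \<le> (p z + m * \<psi> z) * exp (- (m * z))"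
      by (rule upper_barrier[where \<beta> = "\<lambda>_. m" and \<beta>' = "\<lambda>_. 0" and B = "\<lambda>x. m * x"])
        (use growth_w[OF m] pos z y in \<open>auto intro!: derivative_eq_intros\<close>)
    moreover have "0 \<le> (p y + m * \<psi> y) * exp (- (m * y))"
      using \<psi>y y m by (simp add: growth_def)
    ultimately have "0 \<le> (p z + m * \<psi> z) * exp (- (m * z))" by linarith
    then show ?thesis by (simp add: zero_le_mult_iff)
  qed
  then show "0 \<le> p x + m * \<psi> x" using x by auto
  have "\<psi> 0 * exp (m * 0) \<le> \<psi> x * exp (m * x)"
  proof (rule derivative_nonneg_le[where f = "\<lambda>x. \<psi> x * exp (m * x)" and
        f' = "\<lambda>t. p t * exp (m * t) + exp (m * t) * m * \<psi> t"])
    fix t assume t: "0 \<le> t" "t \<le> x"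
    show "((\<lambda>x. \<psi> x * exp (m * x)) has_real_derivative p t * exp (m * t) + exp (m * t) * m * \<psi> t) (at t)"
      using t x y by (auto intro!: derivative_eq_intros \<psi>')
    have "0 \<le> (p t + m * \<psi> t) * exp (m * t)" using *[of t] t x by simp
    then show "0 \<le> p t * exp (m * t) + exp (m * t) * m * \<psi> t" by (simp add: algebra_simps)
  qed (use x in auto)
  then show "exp (- m * x) \<le> \<psi> x" using init by (simp add: exp_minus divide_simps)
qed

lemma growth_exists: "\<exists>m. growth m"
proof -
  define c where "c = k * (\<delta> * exp l)\<^sup>2"
  have "0 \<le> c" using k by (simp add: c_def)
  then have "c \<le> (1 + c)\<^sup>2" by (simp add: power2_eq_square algebra_simps)
  then show ?thesis using \<open>0 \<le> c\<close> by (intro exI[of _ "1 + c"]) (simp add: growth_def c_def)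
qed

text \<open>At a first zero of \<psi> the slope must be negative, as otherwise
  \<open>growth_bound\<close> gives a positive value there. Afterwards \<psi> stays nonpositive as
  long as \<open>p\<close> does, and there the cut-off force vanishes, so \<open>p\<close> cannot
  climb back to 0.\<close>

lemma \<psi>_pos:
  assumes "0 \<le> p l" and x: "0 \<le> x" "x \<le> l"
  shows "0 < \<psi> x"
proof (rule ccontr)
  assume "\<not> 0 < \<psi> x"
  then obtain y where y: "0 < y" "y \<le> x" "\<psi> y = 0" and pos: "\<And>t. 0 \<le> t \<Longrightarrow> t < y \<Longrightarrow> 0 < \<psi> t"
    using first_zero[of 0 x \<psi> x] continuous(1)[of 0 x] x init by auto
  obtain m where m: "growth m" using growth_exists by blast
  have py: "p y < 0"
  proof (rule ccontr)
    assume "\<not> p y < 0"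
    then have "exp (- m * y) \<le> \<psi> y" by (intro growth_bound[OF m, of y]) (use pos y x in auto)
    then show False using y by (simp add: not_le[symmetric])
  qed
  have "\<not> (0 < - p y) \<or> p l < 0"
  proof (rule ccontr)
    assume *: "\<not> (\<not> (0 < - p y) \<or> p l < 0)"
    have "continuous_on {y..l} (\<lambda>x. - p x)" using continuous(2)[of y l] y by (intro continuous_intros) auto
    then obtain z where z: "y < z" "z \<le> l" "- p z = 0" "\<And>t. y \<le> t \<Longrightarrow> t < z \<Longrightarrow> 0 < - p t"
      using first_zero[of y l "\<lambda>x. - p x" l] * y x by auto
    have neg: "p t \<le> 0" if "y \<le> t" "t \<le> z" for t using z(3) z(4)[of t] that by (cases "t = z") auto
    have "\<psi> t \<le> 0" if t: "y \<le> t" "t \<le> z" for t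
      using derivative_nonpos_ge[of y t \<psi> p] \<psi>' neg t y z x by force
    then have f0: "force k \<alpha> \<delta> (\<psi> t) (s t) = 0" if "y \<le> t" "t \<le> z" for t
      using that by (simp add: force_def)
    have "p z \<le> p y"
    proof (rule derivative_nonpos_ge[of y z p "\<lambda>t. force k \<alpha> \<delta> (\<psi> t) (s t)"])
      fix t assume t: "y \<le> t" "t \<le> z"
      show "(p has_real_derivative force k \<alpha> \<delta> (\<psi> t) (s t)) (at t)"
        by (rule p') (use t y z in auto)
      show "force k \<alpha> \<delta> (\<psi> t) (s t) \<le> 0" using f0 t by simp
    qed (use z in auto)
    then show False using z py by simp
  qed
  then show False using py assms by simp
qed

text \<open>Maximum principle: where \<open>\<alpha> \<psi> \<ge> 1\<close> the cut-off equals 1 and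
  the force is nonnegative, so \<psi> is convex. It then cannot rise from
  \<open>1 / \<alpha>\<close> to a larger maximum with slope zero. A maximum at the right end is
  covered by \<open>p l = 0\<close>.\<close>

lemma cutoff_inactive:
  assumes pl: "p l = 0" and x: "0 \<le> x" "x \<le> l"
  shows "\<alpha> * \<psi> x \<le> 1"
proof (rule ccontr)
  assume "\<not> \<alpha> * \<psi> x \<le> 1"
  have pos: "0 < \<psi> t" if "0 \<le> t" "t \<le> l" for t using \<psi>_pos pl that by simp
  obtain z where z: "z \<in> {0..l}" "\<And>t. t \<in> {0..l} \<Longrightarrow> \<psi> t \<le> \<psi> z"
    using continuous_attains_sup[of "{0..l}" \<psi>] continuous(1)[of 0 l] l by auto
  have big: "1 < \<alpha> * \<psi> z"
    using z(2)[of x] x \<open>\<not> \<alpha> * \<psi> x \<le> 1\<close> \<alpha> mult_left_mono[of "\<psi> x" "\<psi> z" \<alpha>] by auto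
  then have z0: "0 < z" using z(1) init \<alpha> by (cases "z = 0") auto
  have pz: "p z = 0"
  proof (cases "z = l")
    case False
    show ?thesis
    proof (rule DERIV_local_max[OF \<psi>'])
      show "0 < min z (l - z)" using z z0 False by auto
      show "\<forall>y. \<bar>z - y\<bar> < min z (l - z) \<longrightarrow> \<psi> y \<le> \<psi> z"
        by (intro allI impI z(2)) (auto simp: abs_less_iff)
    qed (use z in auto)
  qed (use pl in simp)
  have "continuous_on {0..z} (\<lambda>t. \<alpha> * \<psi> (z - t) - 1)"
    by (intro continuous_intros continuous_on_compose2[OF continuous(1)[of 0 l]]) (use z in auto)
  then obtain v where v: "0 < v" "v \<le> z" "\<alpha> * \<psi> (z - v) - 1 = 0"
    "\<And>t. 0 \<le> t \<Longrightarrow> t < v \<Longrightarrow> 0 < \<alpha> * \<psi> (z - t) - 1"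
    using first_zero[of 0 z "\<lambda>t. \<alpha> * \<psi> (z - t) - 1" z] big z0 init \<alpha> by auto
  \<comment> \<open>\<open>v\<close> is measured leftwards from the maximum, so \<open>y\<close> is
    the last point before \<open>z\<close> with \<open>\<alpha> \<psi> = 1\<close>.\<close>
  define y where "y = z - v"
  have y: "0 \<le> y" "y < z" "\<alpha> * \<psi> y = 1" using v by (auto simp: y_def)
  have ybig: "1 \<le> \<alpha> * \<psi> t" if "y \<le> t" "t \<le> z" for t
    using v(4)[of "z - t"] y that by (cases "t = y") (auto simp: y_def)
  have "p t \<le> p z" if t: "y \<le> t" "t \<le> z" for t
  proof (rule derivative_nonneg_le[OF t(2), where f = p and f' = "\<lambda>r. force k \<alpha> \<delta> (\<psi> r) (s r)"])
    fix r assume r: "t \<le> r" "r \<le> z"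
    show "(p has_real_derivative force k \<alpha> \<delta> (\<psi> r) (s r)) (at r)" using p' r t y z by auto
    have "1 \<le> (\<alpha> * \<psi> r)\<^sup>2" using ybig[of r] r t by (simp add: one_le_power)
    then have "cutoff \<alpha> (\<psi> r) = 1" by (simp add: cutoff_def)
    then show "0 \<le> force k \<alpha> \<delta> (\<psi> r) (s r)" using k by (simp add: force_def)
  qed
  then have "\<psi> z \<le> \<psi> y"
    using derivative_nonpos_ge[of y z \<psi> p] \<psi>' pz y z by auto
  then have "\<alpha> * \<psi> z \<le> \<alpha> * \<psi> y" using \<alpha> by (intro mult_left_mono) auto
  then show False using big y by simp
qed

text \<open>As \<open>s x \<ge> x\<close>, the condition \<open>1 \<le> \<delta> * y\<close> gives
  \<open>w \<ge> 0\<close> from \<open>y\<close> on. There \<psi> is convex while it is positive,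
  and being nondecreasing it stays positive.\<close>

lemma p_nonneg_persists:
  assumes y: "0 \<le> y" "y \<le> l" "1 \<le> \<delta> * y" "0 < \<psi> y" "0 \<le> p y"
  shows "p y \<le> p l" "y < l \<Longrightarrow> 1 < \<delta> * y \<Longrightarrow> p y < p l"
proof -
  have w0: "1 \<le> \<delta> * s t" if t: "y \<le> t" "t \<le> l" for t
    using mult_left_mono[of y "s t" \<delta>] s_ge[of t] \<delta> t y by auto
  then have w0: "0 \<le> w t" if t: "y \<le> t" "t \<le> l" for t
    using one_le_power[OF w0[OF t], of 2] w_ge_square[of t] by linarith
  have up: "p y \<le> p z" if z: "y \<le> z" "z \<le> l" "\<And>t. y \<le> t \<Longrightarrow> t < z \<Longrightarrow> 0 < \<psi> t" for z
  proof (rule DERIV_nonneg_imp_increasing_open[OF z(1)])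
    show "continuous_on {y..z} p" by (rule continuous) (use y z in auto)
    fix t assume "y < t" "t < z"
    then show "\<exists>D. (p has_real_derivative D) (at t) \<and> 0 \<le> D"
      using p'[of t] force_pos[of t] z(3)[of t] w0[of t] k z(2) y by (auto intro!: exI)
  qed
  have pos: "0 < \<psi> z" if z: "y \<le> z" "z \<le> l" for z
  proof (rule ccontr)
    assume "\<not> 0 < \<psi> z"
    then obtain v where v: "y < v" "v \<le> z" "\<psi> v = 0" "\<And>t. y \<le> t \<Longrightarrow> t < v \<Longrightarrow> 0 < \<psi> t"
      using first_zero[of y z \<psi> z] continuous(1)[of y z] z y by auto
    have "\<psi> y \<le> \<psi> v"
    proof (rule derivative_nonneg_le[where f = \<psi> and f' = p])
      fix t assume "y \<le> t" "t \<le> v"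
      then show "0 \<le> p t" using up[of t] v z y by auto
    qed (use v z y \<psi>' in auto)
    then show False using v y by simp
  qed
  show "p y \<le> p l" using up[of l] pos y by auto
  assume s: "y < l" "1 < \<delta> * y"
  show "p y < p l"
  proof (rule derivative_pos_less[OF s(1), where f = p and f' = "\<lambda>r. force k \<alpha> \<delta> (\<psi> r) (s r)"])
    fix t assume t: "y < t" "t < l"
    have "1 < \<delta> * s t"
      using mult_left_mono[of y "s t" \<delta>] s_ge[of t] \<delta> t y s by auto
    then have "0 < w t"
      using one_less_power[of "\<delta> * s t" 2] w_ge_square[of t] by linarith
    then show "0 < force k \<alpha> \<delta> (\<psi> t) (s t)" using force_pos[of t] pos[of t] t k by simp
  qed (use p' y in auto)
qed

text \<open>A positive maximum of \<open>p\<close> would lie at an interior point with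
  \<open>w = 0\<close>. As long as \<open>p\<close> is positive afterwards, \<psi> and
  \<open>s\<close> grow, so \<open>w\<close> stays nonnegative and \<open>p\<close> cannot decrease
  to its end value 0.\<close>

lemma p_nonpos:
  assumes p0: "p 0 \<le> 0" and pl: "p l = 0" and x: "0 \<le> x" "x \<le> l"
  shows "p x \<le> 0"
proof (rule ccontr)
  assume "\<not> p x \<le> 0"
  have pos: "0 < \<psi> t" if "0 \<le> t" "t \<le> l" for t using \<psi>_pos pl that by simp
  obtain z where z: "z \<in> {0..l}" "\<And>t. t \<in> {0..l} \<Longrightarrow> p t \<le> p z"
    using continuous_attains_sup[of "{0..l}" p] continuous(2)[of 0 l] l by auto
  have big: "0 < p z" using z(2)[of x] x \<open>\<not> p x \<le> 0\<close> by auto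
  then have zi: "0 < z" "z < l" using z(1) p0 pl by (cases "z = 0"; cases "z = l"; auto)+
  have "force k \<alpha> \<delta> (\<psi> z) (s z) = 0"
  proof (rule DERIV_local_max[OF p'])
    show "0 < min z (l - z)" using zi by auto
    show "\<forall>y. \<bar>z - y\<bar> < min z (l - z) \<longrightarrow> p y \<le> p z"
      by (intro allI impI z(2)) (auto simp: abs_less_iff)
  qed (use z in auto)
  then have wz: "w z = 0" using force_pos[of z] pos[of z] z k by auto
  obtain y where y: "z < y" "y \<le> l" "p y = 0" "\<And>t. z \<le> t \<Longrightarrow> t < y \<Longrightarrow> 0 < p t"
    using first_zero[of z l p l] continuous(2)[of z l] big pl zi by auto
  have p0: "0 \<le> p t" if "z \<le> t" "t \<le> y" for t using y(3) y(4)[of t] that by (cases "t = y") auto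
  have "p z \<le> p y"
  proof (rule derivative_nonneg_le[where f = p and f' = "\<lambda>r. force k \<alpha> \<delta> (\<psi> r) (s r)"])
    fix t assume t: "z \<le> t" "t \<le> y"
    show "(p has_real_derivative force k \<alpha> \<delta> (\<psi> t) (s t)) (at t)" using p' t y zi by auto
    have "\<psi> z \<le> \<psi> t"
      by (rule derivative_nonneg_le[of z t \<psi> p]) (use \<psi>' p0 t y zi in auto)
    then have "(\<alpha> * \<psi> z)\<^sup>2 \<le> (\<alpha> * \<psi> t)\<^sup>2"
      using \<alpha> pos[of z] zi by (intro power_mono mult_left_mono) auto
    moreover have "(\<delta> * s z)\<^sup>2 \<le> (\<delta> * s t)\<^sup>2"
      using \<delta> s_nonneg[of z] s_mono[of z t] zi t y by (intro power_mono mult_left_mono) auto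
    ultimately have "0 \<le> w t" using wz by (auto simp: w_def cutoff_def)
    then show "0 \<le> force k \<alpha> \<delta> (\<psi> t) (s t)" using force_pos[of t] pos[of t] t y zi k by simp
  qed (use y in auto)
  then show False using big y by simp
qed

end

section \<open>The sign of the end slope: explicit barriers and limiting cases\<close>

context half_solution
begin

text \<open>The barrier has derivative \<open>2 * k\<close>, which pays for
  \<open>k w \<ge> - k\<close> and \<open>\<beta>\<^sup>2 \<le> k\<close>. As
  \<open>2 * \<kappa> < \<delta>\<close>, it is still negative at \<open>1 / \<delta>\<close>, so
  \<open>p\<close> is positive when \<open>w\<close> becomes nonnegative for good.\<close>

lemma p_pos_if_steep:
  assumes \<kappa>: "0 < \<kappa>" "k = \<kappa>\<^sup>2" and \<delta>\<kappa>: "2 * \<kappa> < \<delta>" and p0: "\<kappa> \<le> p 0"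
  shows "0 < p l"
proof -
  define y where "y = min l (1 / \<delta>)"
  have \<delta>0: "0 < \<delta>" using \<kappa> \<delta>\<kappa> by simp
  have y: "0 \<le> y" "y \<le> l" "\<delta> * y \<le> 1" using l \<delta>0 by (auto simp: y_def field_simps min_def)
  have \<kappa>x: "2 * \<kappa> * x < 1" if "0 \<le> x" "x \<le> y" for x
  proof (cases "x = 0")
    case False
    then have "2 * \<kappa> * x < \<delta> * x" using that \<delta>\<kappa> by (intro mult_strict_right_mono) auto
    also have "\<delta> * x \<le> \<delta> * y" using that \<delta>0 by simp
    finally show ?thesis using y by simp
  qed simp
  have sub: "0 \<le> k * w x + 2 * k - (- \<kappa> + 2 * k * x)\<^sup>2" if "0 \<le> x" "x \<le> y" for x
  proof -
    have "\<kappa> * (2 * \<kappa> * x) \<le> \<kappa> * 1"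
      using \<kappa>x[OF that] \<kappa> by (intro mult_left_mono) auto
    then have "2 * k * x \<le> \<kappa>" by (simp add: \<kappa> power2_eq_square algebra_simps)
    then have "\<bar>- \<kappa> + 2 * k * x\<bar> \<le> \<kappa>" using k that(1) by (simp add: abs_le_iff)
    then have "(- \<kappa> + 2 * k * x)\<^sup>2 \<le> \<kappa>\<^sup>2" using \<kappa> by (simp add: abs_le_square_iff[symmetric])
    moreover have "k * (-1) \<le> k * w x" using k w_ge by (intro mult_left_mono) auto
    ultimately show ?thesis using \<kappa> by simp
  qed
  have "0 \<le> p y + (- \<kappa> + 2 * k * y) * \<psi> y" "exp (- (- \<kappa> * y + k * y\<^sup>2)) \<le> \<psi> y"
    by (rule barrier[where \<beta> = "\<lambda>x. - \<kappa> + 2 * k * x" and B = "\<lambda>x. - \<kappa> * x + k * x\<^sup>2" and \<beta>' = "\<lambda>_. 2 * k"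
        and y = y]; use sub p0 y in \<open>auto intro!: derivative_eq_intros\<close>)+
  moreover have "- \<kappa> + 2 * k * y < 0"
    using mult_strict_left_mono[OF \<kappa>x[of y] \<kappa>(1)] y \<kappa> by (simp add: power2_eq_square algebra_simps)
  ultimately have py: "0 < p y" "0 < \<psi> y"
    using exp_gt_zero[of "- (- \<kappa> * y + k * y\<^sup>2)"] mult_neg_pos[of "- \<kappa> + 2 * k * y" "\<psi> y"] by linarith+
  show ?thesis
  proof (cases "y = l")
    case False
    then have "\<delta> * y = 1" using \<delta>0 by (auto simp: y_def min_def split: if_splits)
    then show ?thesis using p_nonneg_persists(1)[of y] y py by auto
  qed (use py in simp)
qed

text \<open>The barrier starts at \<kappa>, to admit the slope \<open>-\<kappa>\<close>, and has to
  be nonpositive at \<tau>. Allowing \<open>\<bar>\<beta>\<bar> \<le> 2 \<kappa>\<close> costs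
  \<open>4 k\<close>, and \<open>k w \<ge> - k\<close> costs another \<open>k\<close>: hence the
  term \<open>5 k x\<close>. A cubic term brings the barrier down; its derivative is paid for by the
  part \<open>k (\<delta> x)\<^sup>2\<close> of \<open>k w\<close>, which is what
  \<open>6 \<le> \<kappa> * \<delta>\<^sup>2 * \<tau> ^ 3\<close> provides.\<close>

lemma p_pos_if_long:
  assumes \<kappa>: "0 < \<kappa>" "k = \<kappa>\<^sup>2" and p0: "- \<kappa> \<le> p 0"
    and \<tau>: "0 < \<tau>" "5 * \<kappa> * \<tau> \<le> 1" "\<tau> < l" "6 \<le> \<kappa> * \<delta>\<^sup>2 * \<tau> ^ 3"
  shows "0 < p l"
proof -
  \<comment> \<open>Chosen so that the cubic term is \<open>2 * \<kappa>\<close> at \<tau>, where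
    the other two terms are at most \<kappa> each.\<close>
  define \<Gamma> where "\<Gamma> = 2 * \<kappa> / \<tau> ^ 3"
  define \<beta> where "\<beta> x = \<kappa> + 5 * k * x - \<Gamma> * x ^ 3" for x
  have \<Gamma>: "0 < \<Gamma>" "\<Gamma> * \<tau> ^ 3 = 2 * \<kappa>" using \<kappa> \<tau> by (auto simp: \<Gamma>_def)
  have 3: "3 * \<Gamma> \<le> k * \<delta>\<^sup>2"
  proof -
    have "3 * \<Gamma> * \<tau> ^ 3 = \<kappa> * 6" using \<Gamma>(2) by simp
    also have "\<dots> \<le> \<kappa> * (\<kappa> * \<delta>\<^sup>2 * \<tau> ^ 3)" using \<kappa> \<tau>(4) by (intro mult_left_mono) auto
    also have "\<dots> = k * \<delta>\<^sup>2 * \<tau> ^ 3" by (simp add: \<kappa> power2_eq_square algebra_simps)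
    finally show ?thesis using \<tau>(1) by simp
  qed
  have 5: "5 * k * x \<le> \<kappa>" if "x \<le> \<tau>" for x
  proof -
    have "\<kappa> * (5 * \<kappa> * x) \<le> \<kappa> * (5 * \<kappa> * \<tau>)" using \<kappa> that by (intro mult_left_mono) auto
    also have "\<dots> \<le> \<kappa> * 1" using \<kappa> \<tau> by (intro mult_left_mono) auto
    finally show ?thesis by (simp add: \<kappa> power2_eq_square algebra_simps)
  qed
  have \<beta>2: "(\<beta> x)\<^sup>2 \<le> 4 * k" if x: "0 \<le> x" "x \<le> \<tau>" for x
  proof -
    have "\<Gamma> * x ^ 3 \<le> \<Gamma> * \<tau> ^ 3" using \<Gamma> x by (intro mult_left_mono power_mono) auto
    moreover have "0 \<le> \<Gamma> * x ^ 3" "0 \<le> 5 * k * x" using \<Gamma> k x by auto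
    ultimately have "\<bar>\<beta> x\<bar> \<le> 2 * \<kappa>" using 5[OF x(2)] \<kappa>(1) unfolding \<Gamma>(2) \<beta>_def by linarith
    then have "(\<beta> x)\<^sup>2 \<le> (2 * \<kappa>)\<^sup>2" using abs_le_square_iff[of "\<beta> x" "2 * \<kappa>"] \<kappa> by simp
    then show ?thesis by (simp add: \<kappa>)
  qed
  have sub: "0 \<le> k * w x + (5 * k - 3 * \<Gamma> * x\<^sup>2) - (\<beta> x)\<^sup>2" if x: "0 \<le> x" "x \<le> \<tau>" for x
  proof -
    have "(\<delta> * x)\<^sup>2 \<le> (\<delta> * s x)\<^sup>2"
      using s_ge[of x] x \<tau> \<delta> by (intro power_mono mult_left_mono) auto
    then have "k * ((\<delta> * x)\<^sup>2 - 1) \<le> k * w x"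
      using w_ge_square[of x] k by (intro mult_left_mono) auto
    moreover have "3 * \<Gamma> * x\<^sup>2 \<le> k * \<delta>\<^sup>2 * x\<^sup>2" using 3 by (intro mult_right_mono) auto
    ultimately show ?thesis using \<beta>2[OF x] by (simp add: power_mult_distrib algebra_simps)
  qed
  have bar: "0 \<le> p \<tau> + \<beta> \<tau> * \<psi> \<tau>"
    "exp (- (\<kappa> * \<tau> + 5 * k * \<tau>\<^sup>2 / 2 - \<Gamma> * \<tau> ^ 4 / 4)) \<le> \<psi> \<tau>"
    by (rule barrier[where \<beta> = \<beta> and B = "\<lambda>x. \<kappa> * x + 5 * k * x\<^sup>2 / 2 - \<Gamma> * x ^ 4 / 4"
        and \<beta>' = "\<lambda>x. 5 * k - 3 * \<Gamma> * x\<^sup>2" and y = \<tau>];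
        use sub p0 \<tau> in \<open>auto simp: \<beta>_def[abs_def] intro!: derivative_eq_intros\<close>)+
  have \<psi>\<tau>: "0 < \<psi> \<tau>" using bar(2) exp_gt_zero less_le_trans by blast
  have "\<beta> \<tau> \<le> 0" using 5[of \<tau>] \<Gamma>(2) by (simp add: \<beta>_def)
  then have p\<tau>: "0 \<le> p \<tau>" using bar(1) \<psi>\<tau> mult_nonpos_nonneg[of "\<beta> \<tau>" "\<psi> \<tau>"] by linarith
  have "1 < \<delta> * \<tau>"
  proof (rule ccontr)
    assume "\<not> 1 < \<delta> * \<tau>"
    then have "(\<delta> * \<tau>)\<^sup>2 \<le> 1" using \<delta> \<tau> by (simp add: power_le_one)
    then have "(\<kappa> * \<tau>) * (\<delta> * \<tau>)\<^sup>2 \<le> (\<kappa> * \<tau>) * 1" using \<kappa> \<tau> by (intro mult_left_mono) auto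
    moreover have "(\<kappa> * \<tau>) * (\<delta> * \<tau>)\<^sup>2 = \<kappa> * \<delta>\<^sup>2 * \<tau> ^ 3"
      by (simp add: power2_eq_square power3_eq_cube)
    ultimately show False using \<tau> by simp
  qed
  then show ?thesis using p_nonneg_persists(2)[of \<tau>] \<tau> p\<tau> \<psi>\<tau> by simp
qed

text \<open>The barrier of \<open>p_pos_if_long\<close> without its cubic term; its primitive is at
  most \<open>3 / 10\<close> while \<open>5 * \<kappa> * x \<le> 1\<close>.\<close>

lemma \<psi>_ge_half:
  assumes \<kappa>: "0 < \<kappa>" "k = \<kappa>\<^sup>2" and p0: "- \<kappa> \<le> p 0" and x: "0 \<le> x" "x \<le> l" "5 * \<kappa> * x \<le> 1"
  shows "1 / 2 \<le> \<psi> x"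
proof -
  have 5: "5 * k * t \<le> \<kappa>" if "t \<le> x" for t
  proof -
    have "\<kappa> * (5 * \<kappa> * t) \<le> \<kappa> * (5 * \<kappa> * x)" using \<kappa> that by (intro mult_left_mono) auto
    also have "\<dots> \<le> \<kappa> * 1" using \<kappa> x by (intro mult_left_mono) auto
    finally show ?thesis by (simp add: \<kappa> power2_eq_square algebra_simps)
  qed
  have "exp (- (\<kappa> * x + 5 * k * x\<^sup>2 / 2)) \<le> \<psi> x"
  proof (rule barrier(2)[where \<beta> = "\<lambda>x. \<kappa> + 5 * k * x" and \<beta>' = "\<lambda>x. 5 * k" and y = x])
    fix t assume t: "0 \<le> t" "t \<le> x"
    have "(\<kappa> + 5 * k * t)\<^sup>2 \<le> (2 * \<kappa>)\<^sup>2" using 5[OF t(2)] t \<kappa> k by (intro power_mono) auto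
    moreover have "k * (-1) \<le> k * w t" using k w_ge by (intro mult_left_mono) auto
    ultimately show "0 \<le> k * w t + 5 * k - (\<kappa> + 5 * k * t)\<^sup>2" by (simp add: \<kappa>)
  qed (use p0 x in \<open>auto intro!: derivative_eq_intros\<close>)
  moreover have "5 * k * x * x \<le> \<kappa> * x" using 5[of x] x by (intro mult_right_mono) auto
  then have "\<kappa> * x + 5 * k * x\<^sup>2 / 2 \<le> 3 / 10" using x by (simp add: power2_eq_square)
  then have "1 - 3 / 10 \<le> exp (- (\<kappa> * x + 5 * k * x\<^sup>2 / 2))"
    using exp_ge_add_one_self[of "- (\<kappa> * x + 5 * k * x\<^sup>2 / 2)"] by linarith
  ultimately show ?thesis by linarith
qed

lemma linear_case:
  assumes "\<alpha> = 0" and x: "0 \<le> x" "x \<le> l"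
  shows "q x = 1" "s x = x"
proof -
  have q1: "q x = 1" if x: "0 \<le> x" "x \<le> l" for x
    using derivative_nonpos_ge[of 0 x q "\<lambda>_. 0"] q' q_ge_1[of x] x init assms(1)
    by (force simp: cutoff_def)
  then show "q x = 1" using x by simp
  have "s x - x \<le> s 0 - 0"
    by (rule derivative_nonpos_ge[where f = "\<lambda>x. s x - x" and f' = "\<lambda>x. q x - 1"])
      (use s' q1 x in \<open>auto intro!: derivative_eq_intros\<close>)
  then show "s x = x" using s_ge[of x] x init by simp
qed

text \<open>For \<open>\<alpha> = 0\<close> this is a harmonic oscillator with Neumann conditions,
  \<open>\<psi>'' = k ((\<delta> x)\<^sup>2 - 1) \<psi>\<close>. The Gaussian
  \<open>exp (- k x\<^sup>2 / 2)\<close> solves it for \<open>\<delta> = \<kappa>\<close>, with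
  negative slope at \<open>l\<close>; for \<open>\<delta> \<le> \<kappa>\<close> its logarithmic
  derivative is a barrier that keeps the end slope negative.\<close>

lemma linear_case_\<delta>:
  assumes \<alpha>0: "\<alpha> = 0" and \<kappa>: "0 < \<kappa>" "k = \<kappa>\<^sup>2" and p: "p 0 = 0" "p l = 0" and l0: "0 < l"
  shows "\<kappa> < \<delta>"
proof (rule ccontr)
  assume "\<not> \<kappa> < \<delta>"
  then have \<delta>k: "\<delta>\<^sup>2 \<le> k" using \<delta> \<kappa> by (simp add: power_mono)
  have "(p l + (k * l) * \<psi> l) * exp (- (k * l\<^sup>2 / 2)) \<le> (p 0 + (k * 0) * \<psi> 0) * exp (- (k * 0\<^sup>2 / 2))"
  proof (rule upper_barrier[where \<beta> = "\<lambda>x. k * x" and B = "\<lambda>x. k * x\<^sup>2 / 2" and \<beta>' = "\<lambda>_. k"])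
    fix x assume x: "0 \<le> x" "x \<le> l"
    have "w x = (\<delta> * x)\<^sup>2 - 1"
      unfolding w_def using linear_case[OF \<alpha>0 x] \<alpha>0 by (simp add: cutoff_def)
    then have "k * w x + k - (k * x)\<^sup>2 = k * x\<^sup>2 * (\<delta>\<^sup>2 - k)"
      by (simp only:) (simp add: power2_eq_square algebra_simps)
    also have "\<dots> \<le> 0" using \<delta>k k by (intro mult_nonneg_nonpos) auto
    finally show "k * w x + k - (k * x)\<^sup>2 \<le> 0" .
  qed (use l \<psi>_pos p in \<open>auto intro!: derivative_eq_intros\<close>)
  then have "k * l * \<psi> l \<le> 0" using p by (simp add: mult_le_0_iff)
  moreover have "0 < k * l * \<psi> l" using k l0 \<psi>_pos[of l] p by simp
  ultimately show False by simp
qed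

text \<open>Without field \<open>w \<le> 0\<close>, so \<psi> is concave and stays at most 1; then
  \<open>\<alpha> < 1\<close> makes \<open>w\<close> strictly negative.\<close>

lemma zero_field_p_neg:
  assumes "\<delta> = 0" "\<alpha> < 1" "p 0 \<le> 0" "0 < l"
  shows "p l < 0"
proof (rule ccontr)
  assume "\<not> p l < 0"
  then have pos: "0 < \<psi> x" if "0 \<le> x" "x \<le> l" for x using \<psi>_pos that by simp
  have f: "force k \<alpha> \<delta> (\<psi> x) (s x) \<le> 0" if "0 \<le> x" "x \<le> l" for x
  proof -
    have "w x \<le> 0" unfolding w_def using assms(1) cutoff_bounds[of \<alpha> "\<psi> x"] by simp
    then show ?thesis
      unfolding force_pos[OF pos[OF that]] using pos[OF that] k by (intro mult_nonneg_nonpos) auto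
  qed
  have p0: "p x \<le> 0" if "0 \<le> x" "x \<le> l" for x
  proof -
    have "p x \<le> p 0" by (rule derivative_nonpos_ge[OF that(1) p']) (use that f in auto)
    then show ?thesis using assms by simp
  qed
  have \<psi>1: "\<psi> x \<le> 1" if "0 \<le> x" "x \<le> l" for x
    using derivative_nonpos_ge[OF that(1) \<psi>'] that p0 init by fastforce
  have "- p 0 < - p l"
  proof (rule derivative_pos_less[where f = "\<lambda>x. - p x" and f' = "\<lambda>x. - force k \<alpha> \<delta> (\<psi> x) (s x)"])
    fix x assume "0 < x" "x < l"
    then have x: "0 \<le> x" "x \<le> l" by auto
    have "\<alpha> * \<psi> x \<le> \<alpha> * 1" using \<alpha> \<psi>1[OF x] by (intro mult_left_mono) auto
    then have "(\<alpha> * \<psi> x)\<^sup>2 < 1"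
      using assms(2) \<alpha> pos[OF x] by (simp add: power_less_one_iff)
    then have "w x < 0" unfolding w_def using assms(1) by (auto simp: cutoff_def min_def)
    then show "0 < - force k \<alpha> \<delta> (\<psi> x) (s x)"
      unfolding force_pos[OF pos[OF x]] using k pos[OF x] by (simp add: mult_pos_neg)
  qed (use assms p' in \<open>auto intro!: derivative_eq_intros\<close>)
  then show False using assms \<open>\<not> p l < 0\<close> by simp
qed

end

section \<open>Monotone dependence on the initial slope and on \<open>\<delta>\<close>\<close>

locale comparison =
  h1: half_solution k \<alpha> \<delta>1 l \<psi>1 p1 s1 q1 + h2: half_solution k \<alpha> \<delta>2 l \<psi>2 p2 s2 q2
  for k \<alpha> \<delta>1 \<delta>2 l \<psi>1 p1 s1 q1 \<psi>2 p2 s2 q2 +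
  assumes \<delta>12: "\<delta>1 \<le> \<delta>2" and pos1: "\<And>x. 0 \<le> x \<Longrightarrow> x \<le> l \<Longrightarrow> 0 < \<psi>1 x"
begin

text \<open>The Wronskian; \<open>W / \<psi>1\<^sup>2\<close> is the derivative of
  \<open>\<psi>2 / \<psi>1\<close>. The coupled system is cooperative: while
  \<open>W \<ge> 0\<close>, the functions \<psi>, the cut-offs, \<open>s\<close> and
  \<open>w\<close> are all ordered, and this order makes \<open>W\<close> nondecreasing.\<close>

definition W :: "real \<Rightarrow> real" where "W x = p2 x * \<psi>1 x - p1 x * \<psi>2 x"

lemma W_0: "W 0 = p2 0 - p1 0" by (simp add: W_def h1.init h2.init)

lemma W':
  "0 \<le> x \<Longrightarrow> x \<le> l \<Longrightarrow> (W has_real_derivative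
     force k \<alpha> \<delta>2 (\<psi>2 x) (s2 x) * \<psi>1 x - force k \<alpha> \<delta>1 (\<psi>1 x) (s1 x) * \<psi>2 x) (at x)"
  unfolding W_def by (auto intro!: derivative_eq_intros h1.\<psi>' h1.p' h2.\<psi>' h2.p' simp: algebra_simps)

lemma ratio':
  "0 \<le> x \<Longrightarrow> x \<le> l \<Longrightarrow> ((\<lambda>x. \<psi>2 x / \<psi>1 x) has_real_derivative W x / (\<psi>1 x)\<^sup>2) (at x)"
  unfolding W_def using pos1[of x]
  by (auto intro!: derivative_eq_intros h1.\<psi>' h2.\<psi>' simp: field_simps power2_eq_square)

context
  fixes y assumes y: "0 \<le> y" "y \<le> l" and Wy: "\<And>t. 0 \<le> t \<Longrightarrow> t < y \<Longrightarrow> 0 \<le> W t"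
begin

lemma \<psi>_le:
  assumes x: "0 \<le> x" "x \<le> y"
  shows "\<psi>1 x \<le> \<psi>2 x"
proof -
  have "\<psi>2 0 / \<psi>1 0 \<le> \<psi>2 x / \<psi>1 x"
  proof (rule DERIV_nonneg_imp_increasing_open[OF x(1), where f = "\<lambda>x. \<psi>2 x / \<psi>1 x"])
    show "continuous_on {0..x} (\<lambda>x. \<psi>2 x / \<psi>1 x)"
      by (rule derivative_continuous_on[OF ratio']) (use x y in auto)
    show "\<exists>D. ((\<lambda>x. \<psi>2 x / \<psi>1 x) has_real_derivative D) (at t) \<and> 0 \<le> D" if "0 < t" "t < x" for t
      using ratio'[of t] Wy[of t] that x y by (intro exI[of _ "W t / (\<psi>1 t)\<^sup>2"]) auto
  qed
  then show ?thesis using pos1[of x] x y by (simp add: h1.init h2.init field_simps)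
qed

lemma cutoff_le: "0 \<le> x \<Longrightarrow> x \<le> y \<Longrightarrow> cutoff \<alpha> (\<psi>1 x) \<le> cutoff \<alpha> (\<psi>2 x)"
  using \<psi>_le[of x] pos1[of x] y h1.\<alpha> unfolding cutoff_def
  by (intro min.mono power_mono mult_left_mono) auto

lemma s_q_le:
  assumes x: "0 \<le> x" "x \<le> y"
  shows "s1 x \<le> s2 x" "q1 x \<le> q2 x"
proof -
  have D: "((\<lambda>x. s2 x - s1 x) has_real_derivative q2 t - q1 t) (at t)" if "0 \<le> t" "t \<le> y" for t
    using that y by (auto intro!: derivative_eq_intros h1.s' h2.s')
  have E: "((\<lambda>x. q2 x - q1 x) has_real_derivative
      cutoff \<alpha> (\<psi>2 t) * s2 t - cutoff \<alpha> (\<psi>1 t) * s1 t) (at t)" if "0 \<le> t" "t \<le> y" for t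
    using that y by (auto intro!: derivative_eq_intros h1.q' h2.q')
  have e: "cutoff \<alpha> (\<psi>1 t) * (s2 t - s1 t) \<le> cutoff \<alpha> (\<psi>2 t) * s2 t - cutoff \<alpha> (\<psi>1 t) * s1 t"
    if t: "0 \<le> t" "t \<le> y" for t
  proof -
    have "0 \<le> (cutoff \<alpha> (\<psi>2 t) - cutoff \<alpha> (\<psi>1 t)) * s2 t"
      using cutoff_le[OF t] h2.s_nonneg[of t] t y by (intro mult_nonneg_nonneg) auto
    then show ?thesis by (simp add: algebra_simps)
  qed
  have c: "0 \<le> cutoff \<alpha> (\<psi>1 t) \<and> cutoff \<alpha> (\<psi>1 t) \<le> 1" for t using cutoff_bounds by auto
  have "0 \<le> s2 0 - s1 0" "0 \<le> q2 0 - q1 0" by (simp_all add: h1.init h2.init)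
  from second_order_nonneg[OF D E e c order_refl this x]
  show "s1 x \<le> s2 x" "q1 x \<le> q2 x" by auto
qed

lemma W'_ge:
  assumes x: "0 \<le> x" "x \<le> y"
  shows "k * \<psi>1 x * \<psi>2 x * ((\<delta>2\<^sup>2 - \<delta>1\<^sup>2) * (s1 x)\<^sup>2)
    \<le> force k \<alpha> \<delta>2 (\<psi>2 x) (s2 x) * \<psi>1 x - force k \<alpha> \<delta>1 (\<psi>1 x) (s1 x) * \<psi>2 x"
proof -
  have p: "0 < \<psi>1 x" "0 < \<psi>2 x" using pos1[of x] \<psi>_le[OF x] x y by auto
  have "(\<delta>2\<^sup>2 - \<delta>1\<^sup>2) * (s1 x)\<^sup>2 \<le> (\<delta>2 * s2 x)\<^sup>2 - (\<delta>1 * s1 x)\<^sup>2"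
  proof -
    have "\<delta>2\<^sup>2 * (s1 x)\<^sup>2 \<le> \<delta>2\<^sup>2 * (s2 x)\<^sup>2"
      using s_q_le[OF x] h1.s_nonneg[of x] x y by (intro mult_left_mono power_mono) auto
    then show ?thesis by (simp add: power_mult_distrib algebra_simps)
  qed
  then have "(\<delta>2\<^sup>2 - \<delta>1\<^sup>2) * (s1 x)\<^sup>2 \<le> h2.w x - h1.w x"
    using cutoff_le[OF x] by (simp add: h1.w_def h2.w_def)
  then have "k * \<psi>1 x * \<psi>2 x * ((\<delta>2\<^sup>2 - \<delta>1\<^sup>2) * (s1 x)\<^sup>2) \<le> k * \<psi>1 x * \<psi>2 x * (h2.w x - h1.w x)"
    using p h1.k by (intro mult_left_mono) auto
  then show ?thesis using h1.force_pos[OF p(1)] h2.force_pos[OF p(2)] by (simp add: algebra_simps)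
qed

lemma W'_nonneg:
  assumes x: "0 \<le> x" "x \<le> y"
  shows "0 \<le> force k \<alpha> \<delta>2 (\<psi>2 x) (s2 x) * \<psi>1 x - force k \<alpha> \<delta>1 (\<psi>1 x) (s1 x) * \<psi>2 x"
proof -
  have "0 \<le> \<delta>2\<^sup>2 - \<delta>1\<^sup>2" using \<delta>12 h1.\<delta> by (simp add: power_mono)
  then have "0 \<le> k * \<psi>1 x * \<psi>2 x * ((\<delta>2\<^sup>2 - \<delta>1\<^sup>2) * (s1 x)\<^sup>2)"
    using pos1[of x] \<psi>_le[OF x] x y h1.k by (intro mult_nonneg_nonneg) auto
  then show ?thesis using W'_ge[OF x] by linarith
qed

lemma W_mono:
  assumes "0 \<le> x" "x \<le> z" "z \<le> y"
  shows "W x \<le> W z"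
  by (rule derivative_nonneg_le[OF assms(2) W' W'_nonneg]) (use assms y in auto)

end

text \<open>A first zero \<open>y\<close> is impossible because \<open>W\<close> is nondecreasing up
  to it. For this use the ordering facts ask for \<open>W \<ge> 0\<close> only before
  \<open>y\<close>.\<close>

lemma W_pos:
  assumes p0: "p1 0 < p2 0" and x: "0 \<le> x" "x \<le> l"
  shows "0 < W x"
proof (rule ccontr)
  assume "\<not> 0 < W x"
  moreover have "continuous_on {0..x} W" by (rule derivative_continuous_on[OF W']) (use x in auto)
  ultimately obtain y where y: "0 < y" "y \<le> x" "W y = 0" and pos: "\<And>t. 0 \<le> t \<Longrightarrow> t < y \<Longrightarrow> 0 < W t"
    using first_zero[of 0 x W x] x p0 W_0 by auto
  have "W 0 \<le> W y" by (rule W_mono[of y]) (use y x pos less_imp_le in auto)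
  then show False using p0 y W_0 by simp
qed

text \<open>Covers equal initial slopes, where \<open>W 0 = 0\<close>: strictness comes from the
  term \<open>(\<delta>2\<^sup>2 - \<delta>1\<^sup>2) * (s1 x)\<^sup>2\<close> in the derivative of
  \<open>W\<close>.\<close>

lemma W_pos_\<delta>:
  assumes W: "\<And>t. 0 \<le> t \<Longrightarrow> t < l \<Longrightarrow> 0 \<le> W t" and "\<delta>1 < \<delta>2" "0 < l"
  shows "0 < W l"
proof -
  have "W 0 < W l"
  proof (rule derivative_pos_less[OF \<open>0 < l\<close> W'])
    fix x assume x: "0 < x" "x < l"
    have "0 < \<delta>2\<^sup>2 - \<delta>1\<^sup>2" using assms(2) h1.\<delta> by (simp add: power_strict_mono)
    moreover have "0 < s1 x" using h1.s_ge[of x] x by simp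
    moreover have "0 < \<psi>1 x" "0 < \<psi>2 x" using pos1[of x] \<psi>_le[OF h1.l order_refl W, of x] x by auto
    ultimately have "0 < k * \<psi>1 x * \<psi>2 x * ((\<delta>2\<^sup>2 - \<delta>1\<^sup>2) * (s1 x)\<^sup>2)"
      using h1.k by simp
    also have "\<dots> \<le> force k \<alpha> \<delta>2 (\<psi>2 x) (s2 x) * \<psi>1 x - force k \<alpha> \<delta>1 (\<psi>1 x) (s1 x) * \<psi>2 x"
      by (rule W'_ge[OF h1.l order_refl W]) (use x in auto)
    finally show "0 < force k \<alpha> \<delta>2 (\<psi>2 x) (s2 x) * \<psi>1 x - force k \<alpha> \<delta>1 (\<psi>1 x) (s1 x) * \<psi>2 x" .
  qed auto
  moreover have "0 \<le> W 0" using W[of 0] assms by simp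
  ultimately show ?thesis by simp
qed

end

text \<open>Measured in units of \<open>\<alpha>\<^sup>2 * W l\<close>, \<open>A2\<close> bounds the
  difference of the cut-offs, \<open>A3\<close> that of \<open>s\<close> and of \<open>q\<close>,
  and the factor after \<open>L\<close> the derivative of \<open>W\<close>. Here \<open>c\<close> is
  a lower bound for \<psi>, \<open>C\<close> an upper bound for \<psi> and \<open>s\<close>, and
  \<open>L\<close> one for the length.\<close>

definition spread_const :: "real \<Rightarrow> real \<Rightarrow> real \<Rightarrow> real \<Rightarrow> real \<Rightarrow> real" where
  "spread_const k L c C \<Delta> =
     (let A2 = 2 * C * (C * L / c\<^sup>2); A3 = 2 * (A2 * C) * exp (2 * L)
      in A3 + L * (k * C\<^sup>2 * (A2 + 2 * \<Delta>\<^sup>2 * C * A3)))"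

context comparison
begin

lemma strictly_steeper:
  assumes p0: "p1 0 < p2 0" and x: "0 \<le> x" "x \<le> l"
  shows "0 \<le> W x" "\<psi>1 x \<le> \<psi>2 x" "cutoff \<alpha> (\<psi>1 x) \<le> cutoff \<alpha> (\<psi>2 x)" "s1 x \<le> s2 x" "q1 x \<le> q2 x"
    and "\<And>z. x \<le> z \<Longrightarrow> z \<le> l \<Longrightarrow> W x \<le> W z"
proof -
  have W: "0 \<le> W t" if "0 \<le> t" "t \<le> l" for t using W_pos[OF p0 that] by simp
  then show "0 \<le> W x" using x by simp
  note r = h1.l order_refl
  show "\<psi>1 x \<le> \<psi>2 x" by (rule \<psi>_le[OF r]) (use W x in auto)
  show "cutoff \<alpha> (\<psi>1 x) \<le> cutoff \<alpha> (\<psi>2 x)" by (rule cutoff_le[OF r]) (use W x in auto)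
  show "s1 x \<le> s2 x" "q1 x \<le> q2 x" by (rule s_q_le[OF r]; use W x in auto)+
  show "W x \<le> W z" if "x \<le> z" "z \<le> l" for z by (rule W_mono[OF r]) (use W x that in auto)
qed

text \<open>With equal \<delta> the equations differ only through the cut-off, whose difference
  carries \<open>\<alpha>\<^sup>2\<close>. As \<open>W\<close> is nondecreasing, all differences are
  measured by the single number \<open>W l\<close>. To leading order in \<alpha> the Wronskian is
  conserved and the two \<open>q\<close> agree.\<close>

lemma spread_bounds:
  assumes \<delta>eq: "\<delta>1 = \<delta>2" and p0: "p1 0 < p2 0" and c: "0 < c" "\<And>x. 0 \<le> x \<Longrightarrow> x \<le> l \<Longrightarrow> c \<le> \<psi>1 x"
    and C: "1 \<le> C" "\<And>x. 0 \<le> x \<Longrightarrow> x \<le> l \<Longrightarrow> \<psi>2 x \<le> C" "\<And>x. 0 \<le> x \<Longrightarrow> x \<le> l \<Longrightarrow> s2 x \<le> C"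
    and L: "l \<le> L" and \<Delta>: "\<delta>2 \<le> \<Delta>"
  shows "q2 l - q1 l \<le> \<alpha>\<^sup>2 * spread_const k L c C \<Delta> * W l"
    and "W l - W 0 \<le> \<alpha>\<^sup>2 * spread_const k L c C \<Delta> * W l"
proof -
  define A2 where "A2 = 2 * C * (C * L / c\<^sup>2)"
  define A3 where "A3 = 2 * (A2 * C) * exp (2 * L)"
  define A4 where "A4 = k * C\<^sup>2 * (A2 + 2 * \<Delta>\<^sup>2 * C * A3)"
  have L0: "0 \<le> L" using h1.l L by simp
  have A: "0 \<le> A2" "0 \<le> A3" "0 \<le> A4"
    using L0 C(1) c h1.k by (auto simp: A2_def A3_def A4_def)
  have "spread_const k L c C \<Delta> = A3 + L * A4"
    by (simp only: spread_const_def Let_def A2_def A3_def A4_def)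
  then have A_le: "A3 \<le> spread_const k L c C \<Delta>" "L * A4 \<le> spread_const k L c C \<Delta>"
    using A L0 by auto
  have Wl: "0 < W l" using W_pos[OF p0 h1.l order_refl] .
  note W_nonneg = strictly_steeper(1)[OF p0] and \<psi>le = strictly_steeper(2)[OF p0]
    and cut = strictly_steeper(3)[OF p0] and sq = strictly_steeper(4,5)[OF p0]
    and mono = strictly_steeper(6)[OF p0]
  have ratio: "\<psi>2 x / \<psi>1 x \<le> 1 + L / c\<^sup>2 * W l" if x: "0 \<le> x" "x \<le> l" for x
  proof -
    have "\<psi>2 x / \<psi>1 x - W l / c\<^sup>2 * x \<le> \<psi>2 0 / \<psi>1 0 - W l / c\<^sup>2 * 0"
    proof (rule derivative_nonpos_ge[OF x(1), where f = "\<lambda>x. \<psi>2 x / \<psi>1 x - W l / c\<^sup>2 * x" and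
          f' = "\<lambda>t. W t / (\<psi>1 t)\<^sup>2 - W l / c\<^sup>2"])
      fix t assume t: "0 \<le> t" "t \<le> x"
      show "((\<lambda>x. \<psi>2 x / \<psi>1 x - W l / c\<^sup>2 * x) has_real_derivative W t / (\<psi>1 t)\<^sup>2 - W l / c\<^sup>2) (at t)"
        using t x by (intro DERIV_diff ratio' DERIV_cmult_Id) auto
      have "W t / (\<psi>1 t)\<^sup>2 \<le> W l / c\<^sup>2"
        using mono[of t l] W_nonneg[of t] c t x
        by (intro frac_le power_mono) auto
      then show "W t / (\<psi>1 t)\<^sup>2 - W l / c\<^sup>2 \<le> 0" by simp
    qed
    moreover have "W l / c\<^sup>2 * x \<le> W l / c\<^sup>2 * L" using Wl x L by (intro mult_left_mono) auto
    ultimately show ?thesis by (simp add: h1.init h2.init field_simps)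
  qed
  have d\<psi>: "\<psi>2 x - \<psi>1 x \<le> C * L / c\<^sup>2 * W l" if x: "0 \<le> x" "x \<le> l" for x
  proof -
    have "\<psi>2 x \<le> (1 + L / c\<^sup>2 * W l) * \<psi>1 x"
      using ratio[OF x] pos1[OF x] by (simp add: pos_divide_le_eq)
    moreover have "L / c\<^sup>2 * W l * \<psi>1 x \<le> L / c\<^sup>2 * W l * C"
      using \<psi>le[OF x] C(2)[OF x] L0 Wl by (intro mult_left_mono) auto
    ultimately show ?thesis by (simp add: algebra_simps)
  qed
  have dT: "cutoff \<alpha> (\<psi>2 x) - cutoff \<alpha> (\<psi>1 x) \<le> \<alpha>\<^sup>2 * A2 * W l" if x: "0 \<le> x" "x \<le> l" for x
  proof -
    have p: "0 < \<psi>1 x" "\<psi>1 x \<le> \<psi>2 x" using pos1[OF x] \<psi>le[OF x] by auto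
    have "(\<alpha> * \<psi>1 x)\<^sup>2 \<le> (\<alpha> * \<psi>2 x)\<^sup>2"
      using p h1.\<alpha> by (intro power_mono mult_left_mono) auto
    then have "cutoff \<alpha> (\<psi>2 x) - cutoff \<alpha> (\<psi>1 x) \<le> (\<alpha> * \<psi>2 x)\<^sup>2 - (\<alpha> * \<psi>1 x)\<^sup>2"
      by (auto simp: cutoff_def min_def)
    also have "\<dots> = \<alpha>\<^sup>2 * ((\<psi>2 x + \<psi>1 x) * (\<psi>2 x - \<psi>1 x))" by (simp add: power2_eq_square algebra_simps)
    also have "\<dots> \<le> \<alpha>\<^sup>2 * ((2 * C) * (C * L / c\<^sup>2 * W l))"
      using p C(2)[OF x] C(1) d\<psi>[OF x] by (intro mult_left_mono mult_mono) auto
    finally show ?thesis by (simp add: A2_def algebra_simps)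
  qed
  define F where "F = \<alpha>\<^sup>2 * (A2 * C) * W l"
  have F: "0 \<le> F" using A Wl C by (simp add: F_def)
  \<comment> \<open>\<open>F * exp (2 * x)\<close> is a supersolution for \<open>s2 - s1\<close>:
    its second derivative \<open>4 * F * exp (2 * x)\<close> dominates the linear term, at most
    \<open>F * exp (2 * x)\<close>, plus the source, at most \<open>F\<close>.\<close>
  have gap: "0 \<le> F * exp (2 * x) - (s2 x - s1 x) \<and> 0 \<le> 2 * F * exp (2 * x) - (q2 x - q1 x)"
    if x: "0 \<le> x" "x \<le> l" for x
  proof -
    have D: "((\<lambda>x. F * exp (2 * x) - (s2 x - s1 x)) has_real_derivative 2 * F * exp (2 * t) - (q2 t - q1 t)) (at t)"
      if "0 \<le> t" "t \<le> l" for t using that by (auto intro!: derivative_eq_intros h1.s' h2.s')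
    have E: "((\<lambda>x. 2 * F * exp (2 * x) - (q2 x - q1 x)) has_real_derivative
        4 * F * exp (2 * t) - (cutoff \<alpha> (\<psi>2 t) * s2 t - cutoff \<alpha> (\<psi>1 t) * s1 t)) (at t)"
      if "0 \<le> t" "t \<le> l" for t using that by (auto intro!: derivative_eq_intros h1.q' h2.q')
    have e: "cutoff \<alpha> (\<psi>1 t) * (F * exp (2 * t) - (s2 t - s1 t)) \<le>
        4 * F * exp (2 * t) - (cutoff \<alpha> (\<psi>2 t) * s2 t - cutoff \<alpha> (\<psi>1 t) * s1 t)"
      if t: "0 \<le> t" "t \<le> l" for t
    proof -
      have "(cutoff \<alpha> (\<psi>2 t) - cutoff \<alpha> (\<psi>1 t)) * s2 t \<le> (\<alpha>\<^sup>2 * A2 * W l) * C"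
        using dT[OF t] C(3)[OF t] h2.s_nonneg[OF t] A Wl by (intro mult_mono) auto
      then have "(cutoff \<alpha> (\<psi>2 t) - cutoff \<alpha> (\<psi>1 t)) * s2 t \<le> F" by (simp add: F_def mult_ac)
      moreover have "F * 1 \<le> F * exp (2 * t)" using F t by (intro mult_left_mono) auto
      moreover have "cutoff \<alpha> (\<psi>1 t) * (F * exp (2 * t)) \<le> 1 * (F * exp (2 * t))"
        using F cutoff_bounds by (intro mult_right_mono) auto
      ultimately show ?thesis using F by (simp add: algebra_simps)
    qed
    have c: "0 \<le> cutoff \<alpha> (\<psi>1 t) \<and> cutoff \<alpha> (\<psi>1 t) \<le> 1" for t using cutoff_bounds by auto
    have i: "0 \<le> F * exp (2 * 0) - (s2 0 - s1 0)" "0 \<le> 2 * F * exp (2 * 0) - (q2 0 - q1 0)"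
      using F by (simp_all add: h1.init h2.init)
    show ?thesis using second_order_nonneg[OF D E e c order_refl i x] by simp
  qed
  have ds: "s2 x - s1 x \<le> \<alpha>\<^sup>2 * A3 * W l" and dq: "q2 x - q1 x \<le> \<alpha>\<^sup>2 * A3 * W l"
    if x: "0 \<le> x" "x \<le> l" for x
  proof -
    have "exp (2 * x) \<le> exp (2 * L)" using x L by simp
    then have "F * exp (2 * x) \<le> F * exp (2 * L)" using F by (intro mult_left_mono)
    moreover have "2 * F * exp (2 * L) = \<alpha>\<^sup>2 * A3 * W l" by (simp add: F_def A3_def)
    moreover have "0 \<le> F * exp (2 * L)" using F by simp
    ultimately show "s2 x - s1 x \<le> \<alpha>\<^sup>2 * A3 * W l" "q2 x - q1 x \<le> \<alpha>\<^sup>2 * A3 * W l"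
      using gap[OF x] by linarith+
  qed
  have "\<alpha>\<^sup>2 * A3 * W l \<le> \<alpha>\<^sup>2 * spread_const k L c C \<Delta> * W l"
    using A_le Wl by (intro mult_right_mono mult_left_mono) auto
  then show "q2 l - q1 l \<le> \<alpha>\<^sup>2 * spread_const k L c C \<Delta> * W l"
    using dq[OF h1.l order_refl] by linarith
  have "W l - \<alpha>\<^sup>2 * A4 * W l * l \<le> W 0 - \<alpha>\<^sup>2 * A4 * W l * 0"
  proof (rule derivative_nonpos_ge[OF h1.l, where f = "\<lambda>x. W x - \<alpha>\<^sup>2 * A4 * W l * x" and
        f' = "\<lambda>x. (force k \<alpha> \<delta>2 (\<psi>2 x) (s2 x) * \<psi>1 x - force k \<alpha> \<delta>1 (\<psi>1 x) (s1 x) * \<psi>2 x) - \<alpha>\<^sup>2 * A4 * W l"])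
    fix x assume x: "0 \<le> x" "x \<le> l"
    show "((\<lambda>x. W x - \<alpha>\<^sup>2 * A4 * W l * x) has_real_derivative
       (force k \<alpha> \<delta>2 (\<psi>2 x) (s2 x) * \<psi>1 x - force k \<alpha> \<delta>1 (\<psi>1 x) (s1 x) * \<psi>2 x) - \<alpha>\<^sup>2 * A4 * W l) (at x)"
      by (intro DERIV_diff W' x DERIV_cmult_Id)
    have p: "0 < \<psi>1 x" "0 < \<psi>2 x" using pos1[OF x] \<psi>le[OF x] by auto
    have "(\<delta>2 * s2 x)\<^sup>2 - (\<delta>2 * s1 x)\<^sup>2 = \<delta>2\<^sup>2 * ((s2 x + s1 x) * (s2 x - s1 x))"
      by (simp add: power2_eq_square algebra_simps)
    also have "\<dots> \<le> \<Delta>\<^sup>2 * ((2 * C) * (\<alpha>\<^sup>2 * A3 * W l))"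
      using sq(1)[OF x] h1.s_nonneg[OF x] h2.s_nonneg[OF x] C(3)[OF x] C(1) ds[OF x] \<Delta> h2.\<delta>
      by (intro mult_mono power_mono) auto
    finally have "(\<delta>2 * s2 x)\<^sup>2 - (\<delta>2 * s1 x)\<^sup>2 \<le> \<alpha>\<^sup>2 * (2 * \<Delta>\<^sup>2 * C * A3) * W l" by (simp add: algebra_simps)
    moreover have hw: "h2.w x - h1.w x
        = (cutoff \<alpha> (\<psi>2 x) - cutoff \<alpha> (\<psi>1 x)) + ((\<delta>2 * s2 x)\<^sup>2 - (\<delta>2 * s1 x)\<^sup>2)"
      unfolding h1.w_def h2.w_def using \<delta>eq by simp
    ultimately have dw: "h2.w x - h1.w x \<le> \<alpha>\<^sup>2 * (A2 + 2 * \<Delta>\<^sup>2 * C * A3) * W l"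
      using dT[OF x] by (simp add: algebra_simps)
    have dw0: "0 \<le> h2.w x - h1.w x"
      using cut[OF x] sq(1)[OF x] h1.s_nonneg[OF x] h2.\<delta>
        power_mono[of "\<delta>2 * s1 x" "\<delta>2 * s2 x" 2] unfolding hw by (simp add: mult_left_mono)
    have "force k \<alpha> \<delta>2 (\<psi>2 x) (s2 x) * \<psi>1 x - force k \<alpha> \<delta>1 (\<psi>1 x) (s1 x) * \<psi>2 x
        = (k * (\<psi>1 x * \<psi>2 x)) * (h2.w x - h1.w x)"
      unfolding h1.force_pos[OF p(1)] h2.force_pos[OF p(2)] by (simp add: algebra_simps)
    also have "\<dots> \<le> (k * (C * C)) * (\<alpha>\<^sup>2 * (A2 + 2 * \<Delta>\<^sup>2 * C * A3) * W l)"
      using p \<psi>le[OF x] C(2)[OF x] C(1) h1.k dw dw0 by (intro mult_mono) auto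
    also have "\<dots> = \<alpha>\<^sup>2 * A4 * W l" by (simp add: A4_def power2_eq_square algebra_simps)
    finally show "(force k \<alpha> \<delta>2 (\<psi>2 x) (s2 x) * \<psi>1 x - force k \<alpha> \<delta>1 (\<psi>1 x) (s1 x) * \<psi>2 x) - \<alpha>\<^sup>2 * A4 * W l \<le> 0"
      by simp
  qed
  moreover have "\<alpha>\<^sup>2 * A4 * W l * l \<le> \<alpha>\<^sup>2 * A4 * W l * L"
    using A Wl L by (intro mult_left_mono) auto
  moreover have "\<alpha>\<^sup>2 * (L * A4) * W l \<le> \<alpha>\<^sup>2 * spread_const k L c C \<Delta> * W l"
    using A_le Wl by (intro mult_right_mono mult_left_mono) auto
  ultimately show "W l - W 0 \<le> \<alpha>\<^sup>2 * spread_const k L c C \<Delta> * W l"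
    by (simp add: mult_ac)
qed

text \<open>A larger initial slope yields a definite lead in \<open>q\<close>. On a first stretch of
  length \<open>1 / (5 * \<kappa>)\<close> the ratio \<open>\<psi>2 / \<psi>1\<close> grows at rate
  at least \<open>W 0\<close>, because \<open>\<psi>1 \<le> 1\<close>, and
  \<open>\<psi>1 \<ge> 1/2\<close>; so the derivative of the lead is at least
  \<open>\<alpha>\<^sup>2 * W 0 * x\<^sup>2 / 2\<close>. Later the lead does not shrink.\<close>

lemma q_gap:
  assumes \<kappa>: "0 < \<kappa>" "k = \<kappa>\<^sup>2" and p1: "- \<kappa> \<le> p1 0" "\<And>x. 0 \<le> x \<Longrightarrow> x \<le> l \<Longrightarrow> p1 x \<le> 0"
    and p0: "p1 0 < p2 0" and cut1: "\<And>x. 0 \<le> x \<Longrightarrow> x \<le> l \<Longrightarrow> \<alpha> * \<psi>2 x \<le> 1"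
    and l5: "1 \<le> 5 * \<kappa> * l"
  shows "\<alpha>\<^sup>2 * W 0 \<le> 750 * \<kappa> ^ 3 * (q2 l - q1 l)"
proof -
  \<comment> \<open>Integrating \<open>x\<^sup>2 / 2\<close> up to this point gives
    \<open>z ^ 3 / 6 = 1 / (750 * \<kappa> ^ 3)\<close>, the constant of the claim.\<close>
  define z where "z = 1 / (5 * \<kappa>)"
  have z: "0 < z" "z \<le> l" "5 * \<kappa> * z = 1" using \<kappa> l5 by (auto simp: z_def field_simps)
  have W0: "0 < W 0" using p0 W_0 by simp
  note W_nonneg = strictly_steeper(1)[OF p0] and \<psi>le = strictly_steeper(2)[OF p0]
    and cut = strictly_steeper(3)[OF p0] and sq = strictly_steeper(4,5)[OF p0]
    and mono = strictly_steeper(6)[OF p0]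
  have \<psi>1: "\<psi>1 x \<le> 1" if x: "0 \<le> x" "x \<le> l" for x
    using derivative_nonpos_ge[of 0 x \<psi>1 p1] h1.\<psi>' p1(2) x h1.init by simp
  have ratio: "1 + W 0 * x \<le> \<psi>2 x / \<psi>1 x" if x: "0 \<le> x" "x \<le> l" for x
  proof -
    have "\<psi>2 0 / \<psi>1 0 - W 0 * 0 \<le> \<psi>2 x / \<psi>1 x - W 0 * x"
    proof (rule derivative_nonneg_le[OF x(1), where f = "\<lambda>x. \<psi>2 x / \<psi>1 x - W 0 * x" and
          f' = "\<lambda>t. W t / (\<psi>1 t)\<^sup>2 - W 0"])
      fix t assume t: "0 \<le> t" "t \<le> x"
      show "((\<lambda>x. \<psi>2 x / \<psi>1 x - W 0 * x) has_real_derivative W t / (\<psi>1 t)\<^sup>2 - W 0) (at t)"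
        using t x by (intro DERIV_diff ratio' DERIV_cmult_Id) auto
      have "W 0 / 1 \<le> W t / (\<psi>1 t)\<^sup>2"
        using mono[of 0 t] W0 t x pos1[of t] \<psi>1[of t] by (intro frac_le power_le_one) auto
      then show "0 \<le> W t / (\<psi>1 t)\<^sup>2 - W 0" by simp
    qed
    then show ?thesis by (simp add: h1.init h2.init)
  qed
  have T: "cutoff \<alpha> (\<psi>2 x) = (\<alpha> * \<psi>2 x)\<^sup>2" "cutoff \<alpha> (\<psi>1 x) = (\<alpha> * \<psi>1 x)\<^sup>2" if x: "0 \<le> x" "x \<le> l" for x
  proof -
    have "0 \<le> \<alpha> * \<psi>1 x" "\<alpha> * \<psi>1 x \<le> \<alpha> * \<psi>2 x"
      using pos1[OF x] \<psi>le[OF x] h1.\<alpha> by (auto intro!: mult_left_mono)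
    then have "(\<alpha> * \<psi>2 x)\<^sup>2 \<le> 1" "(\<alpha> * \<psi>1 x)\<^sup>2 \<le> 1"
      using cut1[OF x] by (auto simp: power_le_one)
    then show "cutoff \<alpha> (\<psi>2 x) = (\<alpha> * \<psi>2 x)\<^sup>2" "cutoff \<alpha> (\<psi>1 x) = (\<alpha> * \<psi>1 x)\<^sup>2"
      by (auto simp: cutoff_def)
  qed
  have E': "((\<lambda>x. q2 x - q1 x) has_real_derivative
      cutoff \<alpha> (\<psi>2 t) * s2 t - cutoff \<alpha> (\<psi>1 t) * s1 t) (at t)" if "0 \<le> t" "t \<le> l" for t
    using that by (auto intro!: derivative_eq_intros h1.q' h2.q')
  have grow: "\<alpha>\<^sup>2 * W 0 * x\<^sup>2 / 2 \<le> cutoff \<alpha> (\<psi>2 x) * s2 x - cutoff \<alpha> (\<psi>1 x) * s1 x"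
    if x: "0 \<le> x" "x \<le> z" for x
  proof -
    have xl: "x \<le> l" using x z by simp
    note p = pos1[OF x(1) xl] and \<psi>x = \<psi>le[OF x(1) xl]
    have "5 * \<kappa> * x \<le> 5 * \<kappa> * z" using x \<kappa> by (intro mult_left_mono) auto
    then have half: "1 / 2 \<le> \<psi>1 x" using h1.\<psi>_ge_half[OF \<kappa> p1(1) x(1) xl] z by simp
    have "(1 + W 0 * x) * \<psi>1 x \<le> \<psi>2 x" using ratio[OF x(1) xl] p by (simp add: pos_le_divide_eq)
    then have "W 0 * x * (1 / 2) \<le> \<psi>2 x - \<psi>1 x"
      using mult_left_mono[OF half, of "W 0 * x"] W0 x by (simp add: algebra_simps)
    moreover have "1 \<le> \<psi>2 x + \<psi>1 x" using half \<psi>x by simp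
    ultimately have "1 * (W 0 * x * (1 / 2)) \<le> (\<psi>2 x + \<psi>1 x) * (\<psi>2 x - \<psi>1 x)"
      using W0 x by (intro mult_mono) auto
    then have "\<alpha>\<^sup>2 * (W 0 * x / 2) \<le> \<alpha>\<^sup>2 * ((\<psi>2 x + \<psi>1 x) * (\<psi>2 x - \<psi>1 x))"
      by (intro mult_left_mono) auto
    also have "\<dots> = cutoff \<alpha> (\<psi>2 x) - cutoff \<alpha> (\<psi>1 x)"
      unfolding T[OF x(1) xl] by (simp add: power2_eq_square algebra_simps)
    finally have "\<alpha>\<^sup>2 * (W 0 * x / 2) * x \<le> (cutoff \<alpha> (\<psi>2 x) - cutoff \<alpha> (\<psi>1 x)) * s1 x"
      using h1.s_ge[OF x(1) xl] cut[OF x(1) xl] x by (intro mult_mono) auto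
    also have "\<dots> \<le> cutoff \<alpha> (\<psi>2 x) * s2 x - cutoff \<alpha> (\<psi>1 x) * s1 x"
      using mult_left_mono[OF sq(1)[OF x(1) xl] cutoff_bounds(1)[of \<alpha> "\<psi>2 x"]] by (simp add: algebra_simps)
    finally show ?thesis by (simp add: power2_eq_square mult_ac)
  qed
  have "(q2 0 - q1 0) - \<alpha>\<^sup>2 * W 0 * 0 ^ 3 / 6 \<le> (q2 z - q1 z) - \<alpha>\<^sup>2 * W 0 * z ^ 3 / 6"
  proof (rule derivative_nonneg_le[where f = "\<lambda>x. (q2 x - q1 x) - \<alpha>\<^sup>2 * W 0 * x ^ 3 / 6" and
        f' = "\<lambda>x. cutoff \<alpha> (\<psi>2 x) * s2 x - cutoff \<alpha> (\<psi>1 x) * s1 x - \<alpha>\<^sup>2 * W 0 * x\<^sup>2 / 2"])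
    fix t assume t: "0 \<le> t" "t \<le> z"
    show "((\<lambda>x. (q2 x - q1 x) - \<alpha>\<^sup>2 * W 0 * x ^ 3 / 6) has_real_derivative
        cutoff \<alpha> (\<psi>2 t) * s2 t - cutoff \<alpha> (\<psi>1 t) * s1 t - \<alpha>\<^sup>2 * W 0 * t\<^sup>2 / 2) (at t)"
    proof (rule DERIV_diff[OF E'])
      show "((\<lambda>x. \<alpha>\<^sup>2 * W 0 * x ^ 3 / 6) has_real_derivative \<alpha>\<^sup>2 * W 0 * t\<^sup>2 / 2) (at t)"
        by (auto intro!: derivative_eq_intros)
    qed (use t z in auto)
    show "0 \<le> cutoff \<alpha> (\<psi>2 t) * s2 t - cutoff \<alpha> (\<psi>1 t) * s1 t - \<alpha>\<^sup>2 * W 0 * t\<^sup>2 / 2"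
      using grow[OF t] by simp
  qed (use z in auto)
  then have "\<alpha>\<^sup>2 * W 0 * z ^ 3 / 6 \<le> q2 z - q1 z" by (simp add: h1.init h2.init)
  also have "\<dots> \<le> q2 l - q1 l"
  proof (rule derivative_nonneg_le[OF z(2) E'])
    fix t assume "z \<le> t" "t \<le> l"
    then have t: "0 \<le> t" "t \<le> l" using z by auto
    show "0 \<le> cutoff \<alpha> (\<psi>2 t) * s2 t - cutoff \<alpha> (\<psi>1 t) * s1 t"
      using mult_mono[OF cut[OF t] sq(1)[OF t] cutoff_bounds(1) h1.s_nonneg[OF t]] by simp
  qed (use z in auto)
  finally have "(750 * \<kappa> ^ 3) * (\<alpha>\<^sup>2 * W 0 * z ^ 3 / 6) \<le> (750 * \<kappa> ^ 3) * (q2 l - q1 l)"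
    using \<kappa> by (intro mult_left_mono) auto
  moreover have "(750 * \<kappa> ^ 3) * (\<alpha>\<^sup>2 * W 0 * z ^ 3 / 6) = \<alpha>\<^sup>2 * W 0 * (5 * \<kappa> * z) ^ 3"
    by (simp add: power_mult_distrib)
  then have "(750 * \<kappa> ^ 3) * (\<alpha>\<^sup>2 * W 0 * z ^ 3 / 6) = \<alpha>\<^sup>2 * W 0"
    by (simp only: z(3) power_one mult_1_right)
  ultimately show ?thesis by (simp only:)
qed

end

section \<open>Matching the two halves\<close>

context half_solution
begin

text \<open>For \<open>\<alpha> = 1\<close>, \<open>cutoff_inactive\<close> says that \<psi> never
  exceeds its initial value.\<close>

lemma full_height_p0:
  assumes "\<alpha> = 1" "p l = 0"
  shows "p 0 \<le> 0"
proof (rule ccontr)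
  assume "\<not> p 0 \<le> 0"
  then have l0: "0 < l" using assms(2) l by (cases "l = 0") auto
  obtain e where e: "0 < e" "\<And>h. 0 < h \<Longrightarrow> h < e \<Longrightarrow> \<psi> 0 < \<psi> (0 + h)"
    using DERIV_pos_inc_right[OF \<psi>'[OF order_refl l]] \<open>\<not> p 0 \<le> 0\<close> by auto
  define h where "h = min (e / 2) l"
  have "0 < h" "h < e" "h \<le> l" using e l0 by (auto simp: h_def)
  then show False using e(2)[of h] cutoff_inactive[OF assms(2), of h] assms(1) init by auto
qed

text \<open>\<open>\<psi> - 1\<close> is nonpositive by \<open>cutoff_inactive\<close> and
  nonnegative by \<open>second_order_nonneg\<close>, as the field only adds to the force. So \<psi>
  is constant, and a nonzero field would still bend it.\<close>

lemma full_height_\<delta>: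
  assumes \<alpha>1: "\<alpha> = 1" and p: "p 0 = 0" "p l = 0" and l0: "0 < l"
  shows "\<delta> = 0"
proof (rule ccontr)
  assume "\<delta> \<noteq> 0"
  have pos: "0 < \<psi> x" if "0 \<le> x" "x \<le> l" for x using \<psi>_pos p that by simp
  have le: "\<psi> x \<le> 1" if "0 \<le> x" "x \<le> l" for x using cutoff_inactive[OF p(2) that] \<alpha>1 by simp
  have w: "w x = (\<psi> x)\<^sup>2 - 1 + (\<delta> * s x)\<^sup>2" if "0 \<le> x" "x \<le> l" for x
    unfolding w_def using pos[OF that] le[OF that] \<alpha>1 power_le_one[of "\<psi> x" 2] by (simp add: cutoff_def)
  have D: "((\<lambda>x. \<psi> x - 1) has_real_derivative p x) (at x)" if "0 \<le> x" "x \<le> l" for x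
    using \<psi>'[OF that] by (auto intro!: derivative_eq_intros)
  have e: "k * \<psi> x * (\<psi> x + 1) * (\<psi> x - 1) \<le> force k \<alpha> \<delta> (\<psi> x) (s x)" if "0 \<le> x" "x \<le> l" for x
  proof -
    have "k * \<psi> x * ((\<psi> x)\<^sup>2 - 1) \<le> k * \<psi> x * w x"
      using k pos[OF that] w[OF that] by (intro mult_left_mono) auto
    then show ?thesis unfolding force_pos[OF pos[OF that]] by (simp add: power2_eq_square algebra_simps)
  qed
  have c: "0 \<le> k * \<psi> x * (\<psi> x + 1) \<and> k * \<psi> x * (\<psi> x + 1) \<le> 1 + 2 * k" if "0 \<le> x" "x \<le> l" for x
  proof -
    have "k * (\<psi> x * (\<psi> x + 1)) \<le> k * (1 * 2)"
      using k pos[OF that] le[OF that] by (intro mult_left_mono mult_mono) auto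
    then have "k * (\<psi> x * (\<psi> x + 1)) \<le> 1 + 2 * k" by simp
    moreover have "0 \<le> k * (\<psi> x * (\<psi> x + 1))" using k pos[OF that] by simp
    ultimately show ?thesis by (simp only: mult.assoc simp_thms)
  qed
  have "0 \<le> \<psi> x - 1" if "0 \<le> x" "x \<le> l" for x
    using second_order_nonneg(1)[OF D p' e c _ _ _ that] k init p by simp
  then have \<psi>1: "\<psi> x = 1" if "0 \<le> x" "x \<le> l" for x using le[OF that] that by force
  have "p 0 < p l"
  proof (rule derivative_pos_less[OF l0 p'])
    fix x assume x: "0 < x" "x < l"
    then have "force k \<alpha> \<delta> (\<psi> x) (s x) = k * (\<delta> * s x)\<^sup>2"
      using force_pos[OF pos[of x]] w[of x] \<psi>1[of x] by simp
    moreover have "0 < s x" using s_ge[of x] x by simp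
    ultimately show "0 < force k \<alpha> \<delta> (\<psi> x) (s x)" using k \<open>\<delta> \<noteq> 0\<close> by simp
  qed auto
  then show False using p by simp
qed

lemma zero_field_p_nonpos:
  assumes "\<delta> = 0" "p 0 = 0"
  shows "p l \<le> 0"
proof -
  have "p l \<le> p 0"
  proof (rule derivative_nonpos_ge[OF l p'])
    fix x
    have "k * max 0 (\<psi> x) * (cutoff \<alpha> (\<psi> x) - 1) \<le> 0"
      using k cutoff_bounds[of \<alpha> "\<psi> x"] by (intro mult_nonneg_nonpos) auto
    then show "force k \<alpha> \<delta> (\<psi> x) (s x) \<le> 0" by (simp add: force_def assms(1))
  qed auto
  then show ?thesis using assms by simp
qed

end

locale gl_flow =
  fixes \<kappa> d \<Delta> R :: real and \<psi> p s q :: "real \<Rightarrow> real \<Rightarrow> real \<Rightarrow> real \<Rightarrow> real"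
  assumes \<kappa>: "0 < \<kappa>" and d: "0 < d"
    and \<Delta>: "2 * \<kappa> < \<Delta>" "6 \<le> \<kappa> * \<Delta>\<^sup>2 * (min (d / 2) (1 / (5 * \<kappa>))) ^ 3"
    and R: "R = \<kappa> * (\<Delta> * exp (2 * d)) + \<Delta>"
    and flow_0: "\<And>\<alpha> \<rho> \<delta>. \<psi> \<alpha> \<rho> \<delta> 0 = 1" "\<And>\<alpha> \<rho> \<delta>. p \<alpha> \<rho> \<delta> 0 = \<rho>"
      "\<And>\<alpha> \<rho> \<delta>. s \<alpha> \<rho> \<delta> 0 = 0" "\<And>\<alpha> \<rho> \<delta>. q \<alpha> \<rho> \<delta> 0 = 1"
    and flow': "\<And>\<alpha> \<rho> \<delta> t. \<alpha> \<in> {0..1} \<Longrightarrow> \<rho> \<in> {-R..R} \<Longrightarrow> \<delta> \<in> {0..R} \<Longrightarrow> \<bar>t\<bar> \<le> 2 * d \<Longrightarrow>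
       (\<psi> \<alpha> \<rho> \<delta> has_real_derivative p \<alpha> \<rho> \<delta> t) (at t) \<and>
       (p \<alpha> \<rho> \<delta> has_real_derivative force (\<kappa>\<^sup>2) \<alpha> \<delta> (\<psi> \<alpha> \<rho> \<delta> t) (s \<alpha> \<rho> \<delta> t)) (at t) \<and>
       (s \<alpha> \<rho> \<delta> has_real_derivative q \<alpha> \<rho> \<delta> t) (at t) \<and>
       (q \<alpha> \<rho> \<delta> has_real_derivative cutoff \<alpha> (\<psi> \<alpha> \<rho> \<delta> t) * s \<alpha> \<rho> \<delta> t) (at t)"
    and flow_cont: "continuous_on UNIV
       (\<lambda>(\<alpha>, \<rho>, \<delta>, t). (\<psi> \<alpha> \<rho> \<delta> t, p \<alpha> \<rho> \<delta> t, s \<alpha> \<rho> \<delta> t, q \<alpha> \<rho> \<delta> t))"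
    and flow_refl: "\<And>\<alpha> \<rho> \<delta> t. \<psi> \<alpha> (-\<rho>) \<delta> t = \<psi> \<alpha> \<rho> \<delta> (-t) \<and> p \<alpha> (-\<rho>) \<delta> t = - p \<alpha> \<rho> \<delta> (-t) \<and>
       s \<alpha> (-\<rho>) \<delta> t = - s \<alpha> \<rho> \<delta> (-t) \<and> q \<alpha> (-\<rho>) \<delta> t = q \<alpha> \<rho> \<delta> (-t)"
begin

definition m :: real where "m = \<kappa> * (\<Delta> * exp (2 * d))"

lemma params: "0 < \<Delta>" "0 < m" "m < R" "\<Delta> \<le> R" "0 < R"
  using \<kappa> \<Delta> by (auto simp: R m_def add_pos_pos)

lemma flow_continuous [continuous_intros]:
  fixes a r e t :: "'a::topological_space \<Rightarrow> real"
  assumes "continuous_on S a" "continuous_on S r" "continuous_on S e" "continuous_on S t"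
  shows "continuous_on S (\<lambda>x. \<psi> (a x) (r x) (e x) (t x))" "continuous_on S (\<lambda>x. p (a x) (r x) (e x) (t x))"
    "continuous_on S (\<lambda>x. s (a x) (r x) (e x) (t x))" "continuous_on S (\<lambda>x. q (a x) (r x) (e x) (t x))"
proof -
  have "continuous_on S (\<lambda>x. (a x, r x, e x, t x))" using assms by (intro continuous_intros)
  from continuous_on_compose2[OF flow_cont this]
  have *: "continuous_on S (\<lambda>x. (\<psi> (a x) (r x) (e x) (t x), p (a x) (r x) (e x) (t x),
      s (a x) (r x) (e x) (t x), q (a x) (r x) (e x) (t x)))" by simp
  show "continuous_on S (\<lambda>x. \<psi> (a x) (r x) (e x) (t x))" "continuous_on S (\<lambda>x. p (a x) (r x) (e x) (t x))"
    "continuous_on S (\<lambda>x. s (a x) (r x) (e x) (t x))" "continuous_on S (\<lambda>x. q (a x) (r x) (e x) (t x))"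
    using continuous_on_fst[OF *] continuous_on_fst[OF continuous_on_snd[OF *]]
      continuous_on_fst[OF continuous_on_snd[OF continuous_on_snd[OF *]]]
      continuous_on_snd[OF continuous_on_snd[OF continuous_on_snd[OF *]]] by simp_all
qed

lemma half:
  assumes "\<alpha> \<in> {0..1}" "\<rho> \<in> {-R..R}" "\<delta> \<in> {0..\<Delta>}" "0 \<le> l" "l \<le> 2 * d"
  shows "half_solution (\<kappa>\<^sup>2) \<alpha> \<delta> l (\<psi> \<alpha> \<rho> \<delta>) (p \<alpha> \<rho> \<delta>) (s \<alpha> \<rho> \<delta>) (q \<alpha> \<rho> \<delta>)"
  by unfold_locales (use assms \<kappa> flow_0 flow'[of \<alpha> \<rho> \<delta>] params in auto)

lemma growth_m:
  assumes "\<alpha> \<in> {0..1::real}" "\<rho> \<in> {-R..R}" "\<delta> \<in> {0..\<Delta>}" "0 \<le> l" "l \<le> 2 * d"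
  shows "half_solution.growth (\<kappa>\<^sup>2) \<delta> l m"
proof -
  interpret half_solution "\<kappa>\<^sup>2" \<alpha> \<delta> l "\<psi> \<alpha> \<rho> \<delta>" "p \<alpha> \<rho> \<delta>" "s \<alpha> \<rho> \<delta>" "q \<alpha> \<rho> \<delta>" by (rule half[OF assms])
  have "\<delta> * exp l \<le> \<Delta> * exp (2 * d)" using assms by (intro mult_mono) auto
  then have "\<kappa> * (\<delta> * exp l) \<le> m" using \<kappa> unfolding m_def by (intro mult_left_mono) auto
  then have "(\<kappa> * (\<delta> * exp l))\<^sup>2 \<le> m\<^sup>2" using \<kappa> assms by (intro power_mono) auto
  then show ?thesis using params by (simp add: growth_def power_mult_distrib)
qed

lemma \<psi>_lower:
  assumes "\<alpha> \<in> {0..1}" "\<rho> \<in> {-R..R}" "\<delta> \<in> {0..\<Delta>}" "0 \<le> l" "l \<le> 2 * d" "0 \<le> p \<alpha> \<rho> \<delta> l"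
    and x: "0 \<le> x" "x \<le> l"
  shows "exp (- m * x) \<le> \<psi> \<alpha> \<rho> \<delta> x" "- m \<le> \<rho>"
proof -
  interpret half_solution "\<kappa>\<^sup>2" \<alpha> \<delta> l "\<psi> \<alpha> \<rho> \<delta>" "p \<alpha> \<rho> \<delta>" "s \<alpha> \<rho> \<delta>" "q \<alpha> \<rho> \<delta>"
    by (rule half[OF assms(1-5)])
  have pos: "0 < \<psi> \<alpha> \<rho> \<delta> t" if "0 \<le> t" "t < l" for t using \<psi>_pos[of t] that assms by simp
  show "exp (- m * x) \<le> \<psi> \<alpha> \<rho> \<delta> x"
    by (rule growth_bound(2)[OF growth_m[OF assms(1-5)] pos order_refl assms(6) x]) auto
  have "0 \<le> p \<alpha> \<rho> \<delta> 0 + m * \<psi> \<alpha> \<rho> \<delta> 0"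
    by (rule growth_bound(1)[OF growth_m[OF assms(1-5)] pos order_refl assms(6)]) (use assms in auto)
  then show "- m \<le> \<rho>" by (simp add: flow_0)
qed

lemma compare:
  assumes "\<alpha> \<in> {0..1}" "\<rho> \<in> {-R..R}" "\<rho>' \<in> {-R..R}" "\<delta> \<in> {0..\<Delta>}" "\<delta>' \<in> {0..\<Delta>}" "\<delta> \<le> \<delta>'"
    "0 \<le> l" "l \<le> 2 * d" and pos: "\<And>x. 0 \<le> x \<Longrightarrow> x \<le> l \<Longrightarrow> 0 < \<psi> \<alpha> \<rho> \<delta> x"
  shows "comparison (\<kappa>\<^sup>2) \<alpha> \<delta> \<delta>' l (\<psi> \<alpha> \<rho> \<delta>) (p \<alpha> \<rho> \<delta>) (s \<alpha> \<rho> \<delta>) (q \<alpha> \<rho> \<delta>)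
    (\<psi> \<alpha> \<rho>' \<delta>') (p \<alpha> \<rho>' \<delta>') (s \<alpha> \<rho>' \<delta>') (q \<alpha> \<rho>' \<delta>')"
  using half[of \<alpha> \<rho> \<delta> l] half[of \<alpha> \<rho>' \<delta>' l] assms
  by (auto simp: comparison_def comparison_axioms_def)

text \<open>At \<open>l\<close>, the new slope times the old \<psi> equals \<open>W\<close> plus the
  old slope times the new \<psi>: a positive and a nonnegative term.\<close>

lemma p_mono:
  assumes "\<alpha> \<in> {0..1}" "\<rho> \<in> {-R..R}" "\<rho>' \<in> {-R..R}" "\<delta> \<in> {0..\<Delta>}" "\<delta>' \<in> {0..\<Delta>}"
    "0 \<le> l" "l \<le> 2 * d" and less: "\<rho> < \<rho>'" "\<delta> \<le> \<delta>'" and pl: "0 \<le> p \<alpha> \<rho> \<delta> l"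
  shows "0 < p \<alpha> \<rho>' \<delta>' l"
proof -
  interpret h: half_solution "\<kappa>\<^sup>2" \<alpha> \<delta> l "\<psi> \<alpha> \<rho> \<delta>" "p \<alpha> \<rho> \<delta>" "s \<alpha> \<rho> \<delta>" "q \<alpha> \<rho> \<delta>"
    by (rule half) (use assms in auto)
  interpret c: comparison "\<kappa>\<^sup>2" \<alpha> \<delta> \<delta>' l "\<psi> \<alpha> \<rho> \<delta>" "p \<alpha> \<rho> \<delta>" "s \<alpha> \<rho> \<delta>" "q \<alpha> \<rho> \<delta>"
    "\<psi> \<alpha> \<rho>' \<delta>'" "p \<alpha> \<rho>' \<delta>'" "s \<alpha> \<rho>' \<delta>'" "q \<alpha> \<rho>' \<delta>'"
    by (rule compare) (use assms h.\<psi>_pos in auto)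
  have W: "0 < c.W l" by (rule c.W_pos) (use assms in \<open>auto simp: flow_0\<close>)
  have \<psi>: "\<psi> \<alpha> \<rho> \<delta> l \<le> \<psi> \<alpha> \<rho>' \<delta>' l" by (rule c.strictly_steeper(2)) (use assms in \<open>auto simp: flow_0\<close>)
  have pos: "0 < \<psi> \<alpha> \<rho> \<delta> l" by (rule h.\<psi>_pos) (use assms in auto)
  have "0 < p \<alpha> \<rho>' \<delta>' l * \<psi> \<alpha> \<rho> \<delta> l"
    using W pl pos \<psi> mult_nonneg_nonneg[of "p \<alpha> \<rho> \<delta> l" "\<psi> \<alpha> \<rho>' \<delta>' l"] unfolding c.W_def by linarith
  then show ?thesis using pos by (simp add: zero_less_mult_iff)
qed

text \<open>Equal slopes give \<open>W 0 = 0\<close>, which \<open>W_pos\<close> does not reach.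
  Nonnegativity of \<open>W\<close> is therefore obtained as a limit of strictly larger slopes
  \<open>r\<close>, for which there is room below \<open>R\<close>; \<open>W_pos_\<delta>\<close>
  then makes it strict at \<open>l\<close>.\<close>

lemma p_mono_\<delta>:
  assumes "\<alpha> \<in> {0..1}" "\<rho> \<in> {-R..<R}" "\<delta> \<in> {0..\<Delta>}" "\<delta>' \<in> {0..\<Delta>}"
    "0 < l" "l \<le> 2 * d" and less: "\<delta> < \<delta>'" and pl: "0 \<le> p \<alpha> \<rho> \<delta> l"
  shows "0 < p \<alpha> \<rho> \<delta>' l"
proof -
  interpret h: half_solution "\<kappa>\<^sup>2" \<alpha> \<delta> l "\<psi> \<alpha> \<rho> \<delta>" "p \<alpha> \<rho> \<delta>" "s \<alpha> \<rho> \<delta>" "q \<alpha> \<rho> \<delta>"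
    by (rule half) (use assms in auto)
  interpret c: comparison "\<kappa>\<^sup>2" \<alpha> \<delta> \<delta>' l "\<psi> \<alpha> \<rho> \<delta>" "p \<alpha> \<rho> \<delta>" "s \<alpha> \<rho> \<delta>" "q \<alpha> \<rho> \<delta>"
    "\<psi> \<alpha> \<rho> \<delta>'" "p \<alpha> \<rho> \<delta>'" "s \<alpha> \<rho> \<delta>'" "q \<alpha> \<rho> \<delta>'"
    by (rule compare) (use assms h.\<psi>_pos in auto)
  have pos: "0 < \<psi> \<alpha> \<rho> \<delta> x" if "0 \<le> x" "x \<le> l" for x by (rule h.\<psi>_pos) (use assms that in auto)
  have Wn: "0 \<le> c.W t" if t: "0 \<le> t" "t < l" for t
  proof -
    define f where "f r = p \<alpha> r \<delta>' t * \<psi> \<alpha> \<rho> \<delta> t - p \<alpha> \<rho> \<delta> t * \<psi> \<alpha> r \<delta>' t" for r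
    have "continuous_on UNIV f" unfolding f_def by (intro continuous_intros)
    then have "(f \<longlongrightarrow> f \<rho>) (at_right \<rho>)"
      by (meson UNIV_I continuous_on_def tendsto_within_subset subset_UNIV)
    moreover have "\<forall>\<^sub>F r in at_right \<rho>. 0 \<le> f r"
      unfolding eventually_at_right[of \<rho> R, OF atLeastLessThan_iff[THEN iffD1, OF assms(2), THEN conjunct2]]
    proof (intro exI[of _ R] conjI allI impI)
      fix r assume r: "\<rho> < r" "r < R"
      interpret c': comparison "\<kappa>\<^sup>2" \<alpha> \<delta> \<delta>' l "\<psi> \<alpha> \<rho> \<delta>" "p \<alpha> \<rho> \<delta>" "s \<alpha> \<rho> \<delta>" "q \<alpha> \<rho> \<delta>"
        "\<psi> \<alpha> r \<delta>'" "p \<alpha> r \<delta>'" "s \<alpha> r \<delta>'" "q \<alpha> r \<delta>'"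
        by (rule compare) (use assms pos r in auto)
      have "0 < c'.W t" by (rule c'.W_pos) (use t r in \<open>auto simp: flow_0\<close>)
      then show "0 \<le> f r" by (simp add: f_def c'.W_def)
    qed (use assms in auto)
    ultimately have "0 \<le> f \<rho>" by (rule tendsto_lowerbound) simp
    then show ?thesis by (simp add: f_def c.W_def)
  qed
  have W: "0 < c.W l" by (rule c.W_pos_\<delta>[OF Wn]) (use assms in auto)
  have "\<psi> \<alpha> \<rho> \<delta> l \<le> \<psi> \<alpha> \<rho> \<delta>' l" by (rule c.\<psi>_le[of l]) (use Wn assms in auto)
  moreover have pos_l: "0 < \<psi> \<alpha> \<rho> \<delta> l" using pos[of l] assms by simp
  ultimately have "0 < p \<alpha> \<rho> \<delta>' l * \<psi> \<alpha> \<rho> \<delta> l"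
    using W pl mult_nonneg_nonneg[of "p \<alpha> \<rho> \<delta> l" "\<psi> \<alpha> \<rho> \<delta>' l"]
    unfolding c.W_def by linarith
  then show ?thesis using pos[of l] assms by (simp add: zero_less_mult_iff)
qed

text \<open>For a solution whose \<open>a\<close> vanishes at \<open>z\<close>, the right half lives on $[0, d-z]$ and the
  reflected left half, which starts with slope \<open>-\<rho>\<close>, on $[0, d+z]$.\<close>

definition balanced :: "real \<Rightarrow> real \<Rightarrow> real \<Rightarrow> real \<Rightarrow> bool" where
  "balanced z \<alpha> \<rho> \<delta> \<longleftrightarrow> \<rho> \<in> {-R..R} \<and> \<delta> \<in> {0..\<Delta>} \<and> p \<alpha> \<rho> \<delta> (d - z) = 0 \<and> p \<alpha> (-\<rho>) \<delta> (d + z) = 0"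

lemma balanced_\<rho>:
  assumes "balanced z \<alpha> \<rho> \<delta>" "z \<in> {0..d}" "\<alpha> \<in> {0..1}"
  shows "- m \<le> \<rho>" "\<rho> \<le> m"
  using \<psi>_lower(2)[of \<alpha> \<rho> \<delta> "d - z" 0] \<psi>_lower(2)[of \<alpha> "-\<rho>" \<delta> "d + z" 0] assms
  by (auto simp: balanced_def)

text \<open>Given the smaller \<delta>, a larger \<rho> for the other pair would make its right end
  slope positive, a smaller \<rho> its left end slope. For equal \<rho> the left half decides, since
  its length \<open>d + z\<close> is positive whereas the right half may be a point.\<close>

lemma balanced_unique:
  assumes b: "balanced z \<alpha> \<rho> \<delta>" "balanced z \<alpha> \<rho>' \<delta>'" and z: "z \<in> {0..d}" and \<alpha>: "\<alpha> \<in> {0..1}"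
  shows "\<rho> = \<rho>' \<and> \<delta> = \<delta>'"
proof -
  have *: "\<rho> = \<rho>' \<and> \<delta> = \<delta>'"
    if b: "balanced z \<alpha> \<rho> \<delta>" "balanced z \<alpha> \<rho>' \<delta>'" and le: "\<delta> \<le> \<delta>'" for \<rho> \<rho>' \<delta> \<delta>'
  proof (rule ccontr)
    assume ne: "\<not> (\<rho> = \<rho>' \<and> \<delta> = \<delta>')"
    consider "\<rho> < \<rho>'" | "\<rho>' < \<rho>" | "\<rho> = \<rho>'" "\<delta> < \<delta>'" using ne le by fastforce
    then show False
    proof cases
      case 1
      then show False using p_mono[of \<alpha> \<rho> \<rho>' \<delta> \<delta>' "d - z"] b le z \<alpha> by (auto simp: balanced_def)
    next
      case 2
      then show False using p_mono[of \<alpha> "-\<rho>" "-\<rho>'" \<delta> \<delta>' "d + z"] b le z \<alpha> by (auto simp: balanced_def)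
    next
      case 3
      then show False
        using p_mono_\<delta>[of \<alpha> "-\<rho>" \<delta> \<delta>' "d + z"] b le z \<alpha> d balanced_\<rho>[OF b(1) z \<alpha>] params
        by (auto simp: balanced_def)
    qed
  qed
  show ?thesis using *[OF b] *[OF b(2,1)] by linarith
qed

text \<open>For \<open>\<rho> < \<kappa>\<close> the left half has initial slope above
  \<open>-\<kappa>\<close> and length at least \<open>d\<close>, enough for
  \<open>p_pos_if_long\<close>. For \<open>\<rho> \<ge> \<kappa>\<close> the right half is used; it
  may be very short, but \<open>p_pos_if_steep\<close> demands no length.\<close>

lemma large_\<delta>:
  assumes z: "z \<in> {0..d}" and \<alpha>: "\<alpha> \<in> {0..1}" and \<rho>: "\<rho> \<in> {-R..R}"
  shows "0 < p \<alpha> \<rho> \<Delta> (d - z) \<or> 0 < p \<alpha> (-\<rho>) \<Delta> (d + z)"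
proof (cases "\<kappa> \<le> \<rho>")
  case True
  interpret half_solution "\<kappa>\<^sup>2" \<alpha> \<Delta> "d - z" "\<psi> \<alpha> \<rho> \<Delta>" "p \<alpha> \<rho> \<Delta>" "s \<alpha> \<rho> \<Delta>" "q \<alpha> \<rho> \<Delta>"
    by (rule half) (use z \<alpha> \<rho> params in auto)
  show ?thesis using p_pos_if_steep[OF \<kappa> refl \<Delta>(1)] True by (simp add: flow_0)
next
  case False
  interpret half_solution "\<kappa>\<^sup>2" \<alpha> \<Delta> "d + z" "\<psi> \<alpha> (-\<rho>) \<Delta>" "p \<alpha> (-\<rho>) \<Delta>" "s \<alpha> (-\<rho>) \<Delta>" "q \<alpha> (-\<rho>) \<Delta>"
    by (rule half) (use z \<alpha> \<rho> params in auto)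
  have "5 * \<kappa> * min (d / 2) (1 / (5 * \<kappa>)) \<le> 5 * \<kappa> * (1 / (5 * \<kappa>))"
    using \<kappa> by (intro mult_left_mono) auto
  then have "5 * \<kappa> * min (d / 2) (1 / (5 * \<kappa>)) \<le> 1" using \<kappa> by simp
  moreover have "min (d / 2) (1 / (5 * \<kappa>)) < d + z" using d z by auto
  ultimately have "0 < p \<alpha> (-\<rho>) \<Delta> (d + z)"
    using p_pos_if_long[OF \<kappa> refl, of "min (d / 2) (1 / (5 * \<kappa>))"] False \<kappa> d \<Delta> by (simp add: flow_0)
  then show ?thesis by simp
qed

lemma negative_nearby:
  fixes f :: "real \<Rightarrow> real"
  assumes "continuous_on UNIV f" "f x < 0"
  obtains e where "0 < e" "\<And>y. \<bar>y - x\<bar> < e \<Longrightarrow> f y < 0"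
proof -
  have "open {y. f y < 0}" by (rule open_Collect_less) (use assms in auto)
  then obtain e where "0 < e" "ball x e \<subseteq> {y. f y < 0}" using assms(2) open_contains_ball by blast
  then show ?thesis using that[of e] by (auto simp: ball_def dist_real_def abs_minus_commute subset_iff)
qed

text \<open>The largest \<open>\<delta>\<close> for which neither end slope is positive makes both of them vanish: a
  strictly negative one could be traded, via \<open>\<rho>\<close>, for a larger \<open>\<delta>\<close>.\<close>

lemma balanced_exists:
  assumes z: "z \<in> {0..d}" and \<alpha>: "\<alpha> \<in> {0..1}"
  shows "\<exists>\<rho> \<delta>. balanced z \<alpha> \<rho> \<delta>"
proof -
  define P1 where "P1 \<rho> \<delta> = p \<alpha> \<rho> \<delta> (d - z)" for \<rho> \<delta>
  define P2 where "P2 \<rho> \<delta> = p \<alpha> (-\<rho>) \<delta> (d + z)" for \<rho> \<delta>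
  define S where "S = ({0..\<Delta>} \<times> {-R..R}) \<inter> {x. P1 (snd x) (fst x) \<le> 0} \<inter> {x. P2 (snd x) (fst x) \<le> 0}"
  have "compact S"
    unfolding S_def P1_def P2_def
    by (intro compact_Int_closed compact_Times compact_Icc closed_Collect_le continuous_intros)
  moreover have "(0, 0) \<in> S"
  proof -
    interpret h1: half_solution "\<kappa>\<^sup>2" \<alpha> 0 "d - z" "\<psi> \<alpha> 0 0" "p \<alpha> 0 0" "s \<alpha> 0 0" "q \<alpha> 0 0"
      by (rule half) (use z \<alpha> params in auto)
    interpret h2: half_solution "\<kappa>\<^sup>2" \<alpha> 0 "d + z" "\<psi> \<alpha> 0 0" "p \<alpha> 0 0" "s \<alpha> 0 0" "q \<alpha> 0 0"
      by (rule half) (use z \<alpha> params in auto)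
    show ?thesis
      using h1.zero_field_p_nonpos h2.zero_field_p_nonpos params by (simp add: S_def P1_def P2_def flow_0)
  qed
  ultimately obtain x where x: "x \<in> S" "\<And>y. y \<in> S \<Longrightarrow> fst y \<le> fst x"
    using continuous_attains_sup[of S fst] continuous_on_fst[OF continuous_on_id] by blast
  define \<delta> where "\<delta> = fst x"
  define \<rho> where "\<rho> = snd x"
  have \<delta>: "\<delta> \<in> {0..\<Delta>}" and \<rho>: "\<rho> \<in> {-R..R}" and neg: "P1 \<rho> \<delta> \<le> 0" "P2 \<rho> \<delta> \<le> 0"
    using x(1) by (auto simp: S_def \<delta>_def \<rho>_def)
  have \<delta>\<Delta>: "\<delta> < \<Delta>"
    using large_\<delta>[OF z \<alpha> \<rho>] neg \<delta> unfolding P1_def P2_def by (cases "\<delta> = \<Delta>") auto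
  have contr: False if r: "r \<in> {-R..R}" "P1 r \<delta> < 0" "P2 r \<delta> < 0" for r
  proof -
    have "continuous_on UNIV (P1 r)" "continuous_on UNIV (P2 r)"
      unfolding P1_def P2_def by (intro continuous_intros)+
    then obtain e1 e2 where e: "0 < e1" "\<And>y. \<bar>y - \<delta>\<bar> < e1 \<Longrightarrow> P1 r y < 0"
      "0 < e2" "\<And>y. \<bar>y - \<delta>\<bar> < e2 \<Longrightarrow> P2 r y < 0"
      using r(2,3) negative_nearby[of "P1 r" \<delta>] negative_nearby[of "P2 r" \<delta>] by metis
    define y where "y = min (\<delta> + min e1 e2 / 2) \<Delta>"
    have y: "\<delta> < y" "y \<le> \<Delta>" "\<bar>y - \<delta>\<bar> < e1" "\<bar>y - \<delta>\<bar> < e2"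
      using e(1,3) \<delta>\<Delta> by (auto simp: y_def min_def)
    have "(y, r) \<in> S" using y r \<delta> e(2,4)[of y] by (auto simp: S_def intro: less_imp_le)
    then show False using x(2)[of "(y, r)"] y by (simp add: \<delta>_def)
  qed
  have cont: "continuous_on UNIV (\<lambda>r. P1 r \<delta>)" "continuous_on UNIV (\<lambda>r. P2 r \<delta>)"
    unfolding P1_def P2_def by (intro continuous_intros)+
  have "P1 \<rho> \<delta> = 0 \<and> P2 \<rho> \<delta> = 0"
  proof (rule ccontr)
    assume "\<not> ?thesis"
    then consider "P1 \<rho> \<delta> < 0" "P2 \<rho> \<delta> < 0" | "P1 \<rho> \<delta> = 0" "P2 \<rho> \<delta> < 0" | "P1 \<rho> \<delta> < 0" "P2 \<rho> \<delta> = 0"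
      using neg by linarith
    then show False
    proof cases
      case 1
      then show False using contr \<rho> by blast
    next
      case 2
      obtain e where e: "0 < e" "\<And>y. \<bar>y - \<rho>\<bar> < e \<Longrightarrow> P2 y \<delta> < 0"
        using negative_nearby[OF cont(2) 2(2)] by blast
      \<comment> \<open>The a priori bound \<open>m < R\<close> leaves room to move \<rho> to the
        left within \<open>[-R, R]\<close>.\<close>
      have "- m \<le> \<rho>" using \<psi>_lower(2)[OF \<alpha> \<rho> \<delta>, of "d - z" 0] z 2 by (auto simp: P1_def)
      then have lt: "- R < \<rho>" using params by simp
      define r where "r = max (\<rho> - e / 2) (- R)"
      have r: "r < \<rho>" "r \<in> {-R..R}" "\<bar>r - \<rho>\<bar> < e" using e(1) lt \<rho> by (auto simp: r_def max_def)
      have "P1 r \<delta> < 0"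
        using p_mono[OF \<alpha> r(2) \<rho> \<delta> \<delta>, of "d - z"] r(1) z 2 by (force simp: P1_def)
      then show False using contr[OF r(2)] e(2)[OF r(3)] by blast
    next
      case 3
      obtain e where e: "0 < e" "\<And>y. \<bar>y - \<rho>\<bar> < e \<Longrightarrow> P1 y \<delta> < 0"
        using negative_nearby[OF cont(1) 3(1)] by blast
      have "- m \<le> - \<rho>" using \<psi>_lower(2)[OF \<alpha> _ \<delta>, of "-\<rho>" "d + z" 0] z 3 \<rho> by (auto simp: P2_def)
      then have lt: "\<rho> < R" using params by simp
      define r where "r = min (\<rho> + e / 2) R"
      have r: "\<rho> < r" "r \<in> {-R..R}" "\<bar>r - \<rho>\<bar> < e" using e(1) lt \<rho> by (auto simp: r_def min_def)
      have "P2 r \<delta> < 0"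
        using p_mono[OF \<alpha> _ _ \<delta> \<delta>, of "-r" "-\<rho>" "d + z"] r(1,2) \<rho> z 3 by (force simp: P2_def)
      then show False using contr[OF r(2)] e(2)[OF r(3)] by blast
    qed
  qed
  then show ?thesis using \<rho> \<delta> by (auto simp: balanced_def P1_def P2_def)
qed

definition slope :: "real \<times> real \<Rightarrow> real" where
  "slope x = fst (SOME y. balanced (fst x) (snd x) (fst y) (snd y))"

definition field :: "real \<times> real \<Rightarrow> real" where
  "field x = snd (SOME y. balanced (fst x) (snd x) (fst y) (snd y))"

abbreviation square :: "(real \<times> real) set" where "square \<equiv> {0..d} \<times> {0..1}"

lemma balanced_slope_field:
  assumes "(z, \<alpha>) \<in> square"
  shows "balanced z \<alpha> (slope (z, \<alpha>)) (field (z, \<alpha>))"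
proof -
  have "\<exists>y. balanced z \<alpha> (fst y) (snd y)" using balanced_exists[of z \<alpha>] assms by auto
  then show ?thesis unfolding slope_def field_def fst_conv snd_conv by (rule someI_ex)
qed

lemma slope_field_eqI:
  assumes "(z, \<alpha>) \<in> square" "balanced z \<alpha> \<rho> \<delta>"
  shows "slope (z, \<alpha>) = \<rho>" "field (z, \<alpha>) = \<delta>"
  using balanced_unique[OF balanced_slope_field[OF assms(1)] assms(2)] assms(1) by auto

lemma slope_field_bounds:
  assumes "(z, \<alpha>) \<in> square"
  shows "slope (z, \<alpha>) \<in> {-R..R}" "- slope (z, \<alpha>) \<in> {-R..R}" "field (z, \<alpha>) \<in> {0..\<Delta>}"
    "p \<alpha> (slope (z, \<alpha>)) (field (z, \<alpha>)) (d - z) = 0" "p \<alpha> (- slope (z, \<alpha>)) (field (z, \<alpha>)) (d + z) = 0"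
  using balanced_slope_field[OF assms] by (auto simp: balanced_def)

text \<open>By uniqueness the graph is the full solution set of the two end conditions, which is
  closed; a map with closed graph into a compact set is continuous.\<close>

lemma continuous_slope_field: "continuous_on square slope" "continuous_on square field"
proof -
  define f where "f x = (slope x, field x)" for x
  have "continuous_on square f"
  proof (rule continuous_from_closed_graph[of "{-R..R} \<times> {0..\<Delta>}"])
    show "compact ({-R..R} \<times> {0..\<Delta>})" by (intro compact_Times compact_Icc)
    show "f \<in> square \<rightarrow> {-R..R} \<times> {0..\<Delta>}"
      using slope_field_bounds by (auto simp: f_def)
    have "(\<lambda>x. Pair x (f x)) ` square = (square \<times> ({-R..R} \<times> {0..\<Delta>})) \<inter>
        {y. p (snd (fst y)) (fst (snd y)) (snd (snd y)) (d - fst (fst y)) = 0} \<inter>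
        {y. p (snd (fst y)) (- fst (snd y)) (snd (snd y)) (d + fst (fst y)) = 0}" (is "_ = ?S")
    proof
      show "(\<lambda>x. Pair x (f x)) ` square \<subseteq> ?S" using slope_field_bounds by (auto simp: f_def)
      show "?S \<subseteq> (\<lambda>x. Pair x (f x)) ` square"
      proof clarsimp
        fix z \<alpha> \<rho> \<delta>
        assume *: "0 \<le> z" "z \<le> d" "0 \<le> \<alpha>" "\<alpha> \<le> 1" "0 \<le> \<delta>" "\<delta> \<le> \<Delta>" "- R \<le> \<rho>" "\<rho> \<le> R"
          "p \<alpha> \<rho> \<delta> (d - z) = 0" "p \<alpha> (- \<rho>) \<delta> (d + z) = 0"
        then have "balanced z \<alpha> \<rho> \<delta>" by (auto simp: balanced_def)
        then have "f (z, \<alpha>) = (\<rho>, \<delta>)" using slope_field_eqI[of z \<alpha> \<rho> \<delta>] * by (auto simp: f_def)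
        then show "((z, \<alpha>), \<rho>, \<delta>) \<in> (\<lambda>x. (x, f x)) ` square" using * by (auto intro!: image_eqI[of _ _ "(z, \<alpha>)"])
      qed
    qed
    moreover have "closed ?S"
      by (intro closed_Int closed_Times closed_Collect_eq continuous_intros)
    ultimately show "closed ((\<lambda>x. Pair x (f x)) ` square)" by simp
  qed
  then show "continuous_on square slope" "continuous_on square field"
    using continuous_on_fst[of square f] continuous_on_snd[of square f] by (simp_all add: f_def)
qed

text \<open>For \<open>z = 0\<close> changing the sign of \<rho> exchanges the two end conditions,
  so uniqueness applies.\<close>

lemma slope_0:
  assumes "\<alpha> \<in> {0..1}"
  shows "slope (0, \<alpha>) = 0"
proof -
  have sq: "(0, \<alpha>) \<in> square" using assms d by auto
  have "balanced 0 \<alpha> (- slope (0, \<alpha>)) (field (0, \<alpha>))"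
    using slope_field_bounds[OF sq] by (auto simp: balanced_def)
  then have "slope (0, \<alpha>) = - slope (0, \<alpha>)" by (rule slope_field_eqI[OF sq])
  then show ?thesis by simp
qed

lemma slope_field_top:
  assumes "z \<in> {0..d}"
  shows "slope (z, 1) = 0" "field (z, 1) = 0"
proof -
  have sq: "(z, 1) \<in> square" using assms by auto
  define \<rho> where "\<rho> = slope (z, 1)"
  define \<delta> where "\<delta> = field (z, 1)"
  note b = slope_field_bounds[OF sq, folded \<rho>_def \<delta>_def]
  interpret h1: half_solution "\<kappa>\<^sup>2" 1 \<delta> "d - z" "\<psi> 1 \<rho> \<delta>" "p 1 \<rho> \<delta>" "s 1 \<rho> \<delta>" "q 1 \<rho> \<delta>"
    by (rule half) (use b assms in auto)
  interpret h2: half_solution "\<kappa>\<^sup>2" 1 \<delta> "d + z" "\<psi> 1 (-\<rho>) \<delta>" "p 1 (-\<rho>) \<delta>" "s 1 (-\<rho>) \<delta>" "q 1 (-\<rho>) \<delta>"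
    by (rule half) (use b assms in auto)
  have "\<rho> = 0" using h1.full_height_p0 h2.full_height_p0 b by (simp add: flow_0)
  then show "slope (z, 1) = 0" "field (z, 1) = 0"
    using h2.full_height_\<delta> b assms d by (simp_all add: flow_0 \<rho>_def \<delta>_def)
qed

text \<open>Without field, a half of positive length with nonpositive initial slope would end with
  negative slope, and one of the halves is of this kind. For \<open>z = d\<close> the right half is
  a point, which forces \<open>\<rho> = 0\<close>, and the left half serves.\<close>

lemma field_pos:
  assumes "(z, \<alpha>) \<in> square" "\<alpha> < 1"
  shows "0 < field (z, \<alpha>)"
proof (rule ccontr)
  assume "\<not> 0 < field (z, \<alpha>)"
  define \<rho> where "\<rho> = slope (z, \<alpha>)"
  note b = slope_field_bounds[OF assms(1), folded \<rho>_def]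
  have f0: "field (z, \<alpha>) = 0" using b \<open>\<not> 0 < field (z, \<alpha>)\<close> by simp
  note b = b[unfolded f0]
  show False
  proof (cases "\<rho> \<le> 0 \<and> z < d")
    case True
    interpret h1: half_solution "\<kappa>\<^sup>2" \<alpha> 0 "d - z" "\<psi> \<alpha> \<rho> 0" "p \<alpha> \<rho> 0" "s \<alpha> \<rho> 0" "q \<alpha> \<rho> 0"
      by (rule half) (use b assms in auto)
    show False using h1.zero_field_p_neg[OF refl assms(2)] True b by (simp add: flow_0)
  next
    case False
    then have "0 \<le> \<rho>" using b assms(1) flow_0 by (cases "z = d") auto
    interpret h2: half_solution "\<kappa>\<^sup>2" \<alpha> 0 "d + z" "\<psi> \<alpha> (-\<rho>) 0" "p \<alpha> (-\<rho>) 0" "s \<alpha> (-\<rho>) 0" "q \<alpha> (-\<rho>) 0"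
      by (rule half) (use b assms in auto)
    show False using h2.zero_field_p_neg[OF refl assms(2)] \<open>0 \<le> \<rho>\<close> b assms d by (simp add: flow_0)
  qed
qed

end

section \<open>The sign of the gap\<close>

context gl_flow
begin

definition gap :: "real \<times> real \<Rightarrow> real" where
  "gap x = q (snd x) (slope x) (field x) (d - fst x) - q (snd x) (- slope x) (field x) (d + fst x)"

lemma continuous_gap: "continuous_on square gap"
  unfolding gap_def by (intro continuous_intros continuous_slope_field)

lemma flow_bounded:
  "\<exists>C\<ge>1. \<forall>\<alpha>\<in>{0..1}. \<forall>\<rho>\<in>{-R..R}. \<forall>\<delta>\<in>{0..\<Delta>}. \<forall>t\<in>{0..2 * d}. \<psi> \<alpha> \<rho> \<delta> t \<le> C \<and> s \<alpha> \<rho> \<delta> t \<le> C"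
proof -
  define K where "K = {0..1::real} \<times> {-R..R} \<times> {0..\<Delta>} \<times> {0..2 * d}"
  define f where "f = (\<lambda>(\<alpha>, \<rho>, \<delta>, t). (\<psi> \<alpha> \<rho> \<delta> t, s \<alpha> \<rho> \<delta> t))"
  have "continuous_on K f" unfolding f_def case_prod_beta by (intro continuous_intros)
  moreover have "compact K" unfolding K_def by (intro compact_Times compact_Icc)
  ultimately have "compact (f ` K)" by (rule compact_continuous_image)
  then have "bounded (f ` K)" by (rule compact_imp_bounded)
  then obtain B where "\<forall>y\<in>f ` K. norm y \<le> B" by (auto simp: bounded_iff)
  then have B: "norm (f x) \<le> B" if "x \<in> K" for x using that by blast
  have "\<psi> \<alpha> \<rho> \<delta> t \<le> max 1 B \<and> s \<alpha> \<rho> \<delta> t \<le> max 1 B"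
    if "\<alpha> \<in> {0..1}" "\<rho> \<in> {-R..R}" "\<delta> \<in> {0..\<Delta>}" "t \<in> {0..2 * d}" for \<alpha> \<rho> \<delta> t
    using B[of "(\<alpha>, \<rho>, \<delta>, t)"] that norm_fst_le[of "\<psi> \<alpha> \<rho> \<delta> t" "s \<alpha> \<rho> \<delta> t"]
      norm_snd_le[of "s \<alpha> \<rho> \<delta> t" "\<psi> \<alpha> \<rho> \<delta> t"] by (auto simp: K_def f_def)
  then show ?thesis by (intro exI[of _ "max 1 B"]) auto
qed

definition flow_sup :: real where
  "flow_sup = (SOME C. 1 \<le> C \<and> (\<forall>\<alpha>\<in>{0..1}. \<forall>\<rho>\<in>{-R..R}. \<forall>\<delta>\<in>{0..\<Delta>}. \<forall>t\<in>{0..2 * d}.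
     \<psi> \<alpha> \<rho> \<delta> t \<le> C \<and> s \<alpha> \<rho> \<delta> t \<le> C))"

lemma flow_sup:
  "1 \<le> flow_sup"
  "\<alpha> \<in> {0..1} \<Longrightarrow> \<rho> \<in> {-R..R} \<Longrightarrow> \<delta> \<in> {0..\<Delta>} \<Longrightarrow> t \<in> {0..2 * d} \<Longrightarrow>
     \<psi> \<alpha> \<rho> \<delta> t \<le> flow_sup \<and> s \<alpha> \<rho> \<delta> t \<le> flow_sup"
  using someI_ex[OF flow_bounded] unfolding flow_sup_def[symmetric] by blast+

definition \<psi>_min :: real where "\<psi>_min = exp (- m * (2 * d))"

lemma \<psi>_min: "0 < \<psi>_min"
  by (simp add: \<psi>_min_def)

lemma \<psi>_ge_min:
  assumes "\<alpha> \<in> {0..1}" "\<rho> \<in> {-R..R}" "\<delta> \<in> {0..\<Delta>}" "0 \<le> l" "l \<le> 2 * d" "p \<alpha> \<rho> \<delta> l = 0"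
    and x: "0 \<le> x" "x \<le> l"
  shows "\<psi>_min \<le> \<psi> \<alpha> \<rho> \<delta> x"
proof -
  have "m * x \<le> m * (2 * d)" using params assms by (intro mult_left_mono) auto
  then have "\<psi>_min \<le> exp (- m * x)" by (simp add: \<psi>_min_def)
  also have "\<dots> \<le> \<psi> \<alpha> \<rho> \<delta> x" using \<psi>_lower(1)[OF assms(1-5) _ x] assms(6) by simp
  finally show ?thesis .
qed

lemma cutoff_eq:
  assumes "\<alpha> \<in> {0..1}" "\<rho> \<in> {-R..R}" "\<delta> \<in> {0..\<Delta>}" "0 \<le> l" "l \<le> 2 * d" "p \<alpha> \<rho> \<delta> l = 0"
    and x: "0 \<le> x" "x \<le> l"
  shows "cutoff \<alpha> (\<psi> \<alpha> \<rho> \<delta> x) = \<alpha>\<^sup>2 * (\<psi> \<alpha> \<rho> \<delta> x)\<^sup>2" "\<alpha> * \<psi> \<alpha> \<rho> \<delta> x \<le> 1"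
proof -
  interpret half_solution "\<kappa>\<^sup>2" \<alpha> \<delta> l "\<psi> \<alpha> \<rho> \<delta>" "p \<alpha> \<rho> \<delta>" "s \<alpha> \<rho> \<delta>" "q \<alpha> \<rho> \<delta>"
    by (rule half[OF assms(1-5)])
  show le: "\<alpha> * \<psi> \<alpha> \<rho> \<delta> x \<le> 1" by (rule cutoff_inactive[OF assms(6) x])
  have "0 < \<psi> \<alpha> \<rho> \<delta> x" by (rule \<psi>_pos) (use assms in auto)
  then have "(\<alpha> * \<psi> \<alpha> \<rho> \<delta> x)\<^sup>2 \<le> 1" using le assms by (intro power_le_one) auto
  then show "cutoff \<alpha> (\<psi> \<alpha> \<rho> \<delta> x) = \<alpha>\<^sup>2 * (\<psi> \<alpha> \<rho> \<delta> x)\<^sup>2" by (simp add: cutoff_def power_mult_distrib)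
qed

definition spread :: real where
  "spread = max 1 (spread_const (\<kappa>\<^sup>2) (2 * d) \<psi>_min flow_sup \<Delta>)"

end

section \<open>The two halves at one point of the rectangle\<close>

locale gl_pair = gl_flow +
  fixes z \<alpha> :: real
  assumes square: "(z, \<alpha>) \<in> square"
begin

definition \<rho> :: real where "\<rho> = slope (z, \<alpha>)"
definition \<delta> :: real where "\<delta> = field (z, \<alpha>)"

abbreviation "u1 \<equiv> \<psi> \<alpha> \<rho> \<delta>"
abbreviation "p1 \<equiv> p \<alpha> \<rho> \<delta>"
abbreviation "s1 \<equiv> s \<alpha> \<rho> \<delta>"
abbreviation "q1 \<equiv> q \<alpha> \<rho> \<delta>"
abbreviation "u2 \<equiv> \<psi> \<alpha> (-\<rho>) \<delta>"
abbreviation "p2 \<equiv> p \<alpha> (-\<rho>) \<delta>"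
abbreviation "s2 \<equiv> s \<alpha> (-\<rho>) \<delta>"
abbreviation "q2 \<equiv> q \<alpha> (-\<rho>) \<delta>"

lemmas bounds = slope_field_bounds[OF square, folded \<rho>_def \<delta>_def]

lemma \<alpha>01: "\<alpha> \<in> {0..1}" and z0d: "0 \<le> z" "z \<le> d"
  and lengths: "0 \<le> d - z" "d - z \<le> 2 * d" "0 \<le> d + z" "d + z \<le> 2 * d" "d - z \<le> d + z"
  using square by auto

sublocale h1: half_solution "\<kappa>\<^sup>2" \<alpha> \<delta> "d - z" u1 p1 s1 q1
  by (rule half) (use bounds \<alpha>01 lengths in auto)

sublocale h2: half_solution "\<kappa>\<^sup>2" \<alpha> \<delta> "d + z" u2 p2 s2 q2
  by (rule half) (use bounds \<alpha>01 lengths in auto)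

lemma gap_eq: "gap (z, \<alpha>) = q1 (d - z) - q2 (d + z)"
  by (simp add: gap_def \<rho>_def \<delta>_def)

lemma right_half:
  assumes x: "0 \<le> x" "x \<le> d - z"
  shows "0 < u1 x" "\<psi>_min \<le> u1 x" "u1 x \<le> flow_sup" "s1 x \<le> flow_sup" "\<alpha> * u1 x \<le> 1"
    "cutoff \<alpha> (u1 x) = \<alpha>\<^sup>2 * (u1 x)\<^sup>2"
  using cutoff_eq[OF \<alpha>01 bounds(1,3) lengths(1,2) bounds(4) x] flow_sup(2)[OF \<alpha>01 bounds(1,3), of x]
    \<psi>_ge_min[OF \<alpha>01 bounds(1,3) lengths(1,2) bounds(4) x] h1.\<psi>_pos[OF _ x] bounds(4) x lengths by auto

lemma left_half:
  assumes x: "0 \<le> x" "x \<le> d + z"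
  shows "0 < u2 x" "\<psi>_min \<le> u2 x" "u2 x \<le> flow_sup" "s2 x \<le> flow_sup"
    "cutoff \<alpha> (u2 x) = \<alpha>\<^sup>2 * (u2 x)\<^sup>2"
  using cutoff_eq[OF \<alpha>01 bounds(2,3) lengths(3,4) bounds(5) x] flow_sup(2)[OF \<alpha>01 bounds(2,3), of x]
    \<psi>_ge_min[OF \<alpha>01 bounds(2,3) lengths(3,4) bounds(5) x] h2.\<psi>_pos[OF _ x] bounds(5) x lengths by auto

text \<open>The right half is so short that \<open>q1 - 1\<close> stays below half of the growth
  \<open>\<alpha>\<^sup>2 * \<psi>_min\<^sup>2 * d\<^sup>2 / 2\<close> that \<open>q2 - 1\<close> is
  sure to reach. Both estimates carry \<open>\<alpha>\<^sup>2\<close>, so the threshold for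
  \<open>d - z\<close> is uniform in \<alpha>.\<close>

lemma gap_neg_if_near_right:
  assumes \<alpha>: "0 < \<alpha>" and near: "(d - z) * flow_sup ^ 3 \<le> \<psi>_min\<^sup>2 * d\<^sup>2 / 4"
  shows "gap (z, \<alpha>) < 0"
proof -
  have "q1 (d - z) - \<alpha>\<^sup>2 * flow_sup ^ 3 * (d - z) \<le> q1 0 - \<alpha>\<^sup>2 * flow_sup ^ 3 * 0"
  proof (rule derivative_nonpos_ge[OF lengths(1), where f = "\<lambda>x. q1 x - \<alpha>\<^sup>2 * flow_sup ^ 3 * x" and
        f' = "\<lambda>x. cutoff \<alpha> (u1 x) * s1 x - \<alpha>\<^sup>2 * flow_sup ^ 3"])
    fix x assume x: "0 \<le> x" "x \<le> d - z"
    show "((\<lambda>x. q1 x - \<alpha>\<^sup>2 * flow_sup ^ 3 * x) has_real_derivative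
        cutoff \<alpha> (u1 x) * s1 x - \<alpha>\<^sup>2 * flow_sup ^ 3) (at x)"
      by (intro DERIV_diff h1.q' x DERIV_cmult_Id)
    have "\<alpha>\<^sup>2 * (u1 x)\<^sup>2 * s1 x \<le> \<alpha>\<^sup>2 * flow_sup\<^sup>2 * flow_sup"
      using right_half(1,3,4)[OF x] h1.s_nonneg[OF x] flow_sup(1)
      by (intro mult_mono mult_left_mono power_mono) auto
    then show "cutoff \<alpha> (u1 x) * s1 x - \<alpha>\<^sup>2 * flow_sup ^ 3 \<le> 0"
      unfolding right_half(6)[OF x] by (simp add: power2_eq_square power3_eq_cube mult_ac)
  qed
  moreover have "\<alpha>\<^sup>2 * ((d - z) * flow_sup ^ 3) \<le> \<alpha>\<^sup>2 * (\<psi>_min\<^sup>2 * d\<^sup>2 / 4)"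
    by (intro mult_left_mono near) auto
  ultimately have 1: "q1 (d - z) \<le> 1 + \<alpha>\<^sup>2 * (\<psi>_min\<^sup>2 * d\<^sup>2 / 4)" by (simp add: flow_0 mult_ac)
  have "q2 0 - \<alpha>\<^sup>2 * \<psi>_min\<^sup>2 * 0\<^sup>2 / 2 \<le> q2 (d + z) - \<alpha>\<^sup>2 * \<psi>_min\<^sup>2 * (d + z)\<^sup>2 / 2"
  proof (rule derivative_nonneg_le[OF lengths(3), where f = "\<lambda>x. q2 x - \<alpha>\<^sup>2 * \<psi>_min\<^sup>2 * x\<^sup>2 / 2" and
        f' = "\<lambda>x. cutoff \<alpha> (u2 x) * s2 x - \<alpha>\<^sup>2 * \<psi>_min\<^sup>2 * x"])
    fix x assume x: "0 \<le> x" "x \<le> d + z"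
    show "((\<lambda>x. q2 x - \<alpha>\<^sup>2 * \<psi>_min\<^sup>2 * x\<^sup>2 / 2) has_real_derivative
        cutoff \<alpha> (u2 x) * s2 x - \<alpha>\<^sup>2 * \<psi>_min\<^sup>2 * x) (at x)"
      by (intro DERIV_diff h2.q' x) (auto intro!: derivative_eq_intros)
    have "\<alpha>\<^sup>2 * \<psi>_min\<^sup>2 * x \<le> \<alpha>\<^sup>2 * (u2 x)\<^sup>2 * s2 x"
      using x h2.s_ge[OF x] left_half(2)[OF x] \<psi>_min by (intro mult_mono mult_left_mono power_mono) auto
    then show "0 \<le> cutoff \<alpha> (u2 x) * s2 x - \<alpha>\<^sup>2 * \<psi>_min\<^sup>2 * x"
      unfolding left_half(5)[OF x] by simp
  qed
  moreover have "\<alpha>\<^sup>2 * \<psi>_min\<^sup>2 * d\<^sup>2 \<le> \<alpha>\<^sup>2 * \<psi>_min\<^sup>2 * (d + z)\<^sup>2"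
    using d z0d by (intro mult_left_mono power_mono) auto
  ultimately have 2: "1 + \<alpha>\<^sup>2 * (\<psi>_min\<^sup>2 * d\<^sup>2 / 2) \<le> q2 (d + z)" by (simp add: flow_0 algebra_simps)
  have "0 < \<alpha>\<^sup>2 * (\<psi>_min\<^sup>2 * d\<^sup>2)" using \<alpha> \<psi>_min d by simp
  then show ?thesis using 1 2 by (simp add: gap_eq)
qed

text \<open>For \<open>\<rho> \<le> 0\<close> the left half is not behind at \<open>d - z\<close>
  and then runs on. For \<open>\<rho> > 0\<close> the lead of the right half is at most a multiple
  of \<open>\<alpha>\<^sup>2 X\<close>, where \<open>-X\<close> is the slope of the left half at
  \<open>d - z\<close>. The left half must raise its slope by \<open>X\<close> on the rest, and as
  the upward force is only of order \<open>\<delta>\<^sup>2\<close>, it gains more than this lead in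
  \<open>q\<close> meanwhile.\<close>

lemma gap_neg_if_weak_field:
  assumes z: "0 < z" and \<alpha>: "0 < \<alpha>" and \<epsilon>: "\<delta> \<le> 1" "\<delta> * (spread * flow_sup * \<kappa>\<^sup>2 * flow_sup) \<le> \<psi>_min / 2"
  shows "gap (z, \<alpha>) < 0"
proof -
  define C where "C = flow_sup"
  have C: "1 \<le> C" using flow_sup by (simp add: C_def)
  have A: "1 \<le> spread" by (simp add: spread_def)
  have lt: "d - z < d + z" using z by simp
  have left: "q2 (d - z) < q2 (d + z)"
  proof (rule derivative_pos_less[OF lt h2.q'])
    fix x assume "d - z < x" "x < d + z"
    then have x: "0 < x" "x \<le> d + z" using lengths by auto
    then show "0 < cutoff \<alpha> (u2 x) * s2 x"
      using left_half[of x] h2.s_ge[of x] \<alpha> by simp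
  qed (use lengths in auto)
  consider "\<rho> < 0" | "\<rho> = 0" | "0 < \<rho>" by linarith
  then have "q1 (d - z) < q2 (d + z)"
  proof cases
    case 1
    interpret c: comparison "\<kappa>\<^sup>2" \<alpha> \<delta> \<delta> "d - z" u1 p1 s1 q1 u2 p2 s2 q2
      by (rule compare) (use bounds lengths \<alpha>01 right_half(1) in auto)
    have "q1 (d - z) \<le> q2 (d - z)"
      by (rule c.strictly_steeper(5)) (use 1 lengths in \<open>auto simp: flow_0\<close>)
    then show ?thesis using left by simp
  next
    case 2
    then show ?thesis using left by simp
  next
    case 3
    interpret c: comparison "\<kappa>\<^sup>2" \<alpha> \<delta> \<delta> "d - z" u2 p2 s2 q2 u1 p1 s1 q1
      by (rule compare) (use bounds lengths \<alpha>01 left_half(1) in auto)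
    define X where "X = - p2 (d - z)"
    \<comment> \<open>The right half ends at \<open>d - z\<close> with slope zero, so only one term
      of the Wronskian survives.\<close>
    have Wl: "c.W (d - z) = X * u1 (d - z)" using bounds by (simp add: c.W_def X_def)
    have Wpos: "0 < c.W (d - z)" by (rule c.W_pos) (use 3 lengths in \<open>auto simp: flow_0\<close>)
    then have X: "0 < X" using Wl right_half(1)[of "d - z"] lengths by (simp add: zero_less_mult_iff)
    have "q1 (d - z) - q2 (d - z) \<le> \<alpha>\<^sup>2 * spread_const (\<kappa>\<^sup>2) (2 * d) \<psi>_min C \<Delta> * c.W (d - z)"
      by (rule c.spread_bounds(1))
        (use 3 C \<psi>_min lengths bounds left_half(2) right_half(3,4) in \<open>auto simp: flow_0 C_def\<close>)
    also have "\<dots> \<le> \<alpha>\<^sup>2 * spread * c.W (d - z)"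
      using Wpos by (intro mult_right_mono mult_left_mono) (auto simp: spread_def C_def)
    also have "\<dots> \<le> \<alpha>\<^sup>2 * spread * (X * C)"
      unfolding Wl using right_half(3)[of "d - z"] lengths X A by (intro mult_left_mono) (auto simp: C_def)
    finally have 1: "q1 (d - z) - q2 (d - z) \<le> \<alpha>\<^sup>2 * spread * C * X" by (simp add: mult_ac)
    \<comment> \<open>That this function increases means that recovering the slope \<open>X\<close>
      raises \<open>q2\<close> by more than the lead of the right half.\<close>
    define \<Theta> where "\<Theta> x = q2 x - \<alpha>\<^sup>2 * spread * C * p2 x" for x
    have "\<Theta> (d - z) < \<Theta> (d + z)"
    proof (rule derivative_pos_less[OF lt, where f = \<Theta> and
          f' = "\<lambda>x. cutoff \<alpha> (u2 x) * s2 x - \<alpha>\<^sup>2 * spread * C * force (\<kappa>\<^sup>2) \<alpha> \<delta> (u2 x) (s2 x)"])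
      show "(\<Theta> has_real_derivative cutoff \<alpha> (u2 x) * s2 x
          - \<alpha>\<^sup>2 * spread * C * force (\<kappa>\<^sup>2) \<alpha> \<delta> (u2 x) (s2 x)) (at x)"
        if "d - z \<le> x" "x \<le> d + z" for x
        unfolding \<Theta>_def by (intro DERIV_diff h2.q' DERIV_cmult h2.p') (use that lengths in auto)
      fix x assume "d - z < x" "x < d + z"
      then have x: "0 \<le> x" "x \<le> d + z" "0 < x" using lengths by auto
      define u where "u = u2 x"
      define v where "v = s2 x"
      have u: "\<psi>_min \<le> u" "0 < u" using left_half(1,2)[OF x(1,2)] by (auto simp: u_def)
      have v: "0 < v" "v \<le> C" using h2.s_ge[OF x(1,2)] x left_half(4)[OF x(1,2)] by (auto simp: v_def C_def)
      have "spread * C * \<kappa>\<^sup>2 * h2.w x \<le> spread * C * \<kappa>\<^sup>2 * (\<delta> * v)\<^sup>2"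
        using h2.w_le[of x] C A by (intro mult_left_mono) (auto simp: v_def)
      also have "\<dots> = (spread * C * \<kappa>\<^sup>2) * (\<delta> * \<delta>) * v * v" by (simp add: power2_eq_square mult_ac)
      also have "\<dots> \<le> (spread * C * \<kappa>\<^sup>2) * (\<delta> * 1) * C * v"
        using \<epsilon> bounds v C A by (intro mult_right_mono mult_mono) auto
      also have "\<dots> = \<delta> * (spread * C * \<kappa>\<^sup>2 * C) * v" by (simp add: mult_ac)
      also have "\<dots> \<le> \<psi>_min / 2 * v" using \<epsilon>(2) v by (intro mult_right_mono) (auto simp: C_def)
      also have "\<dots> < u * v" using u v \<psi>_min by (intro mult_strict_right_mono) auto
      finally have "\<alpha>\<^sup>2 * u * (spread * C * \<kappa>\<^sup>2 * h2.w x) < \<alpha>\<^sup>2 * u * (u * v)"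
        using \<alpha> u by (intro mult_strict_left_mono) auto
      then show "0 < cutoff \<alpha> (u2 x) * s2 x - \<alpha>\<^sup>2 * spread * C * force (\<kappa>\<^sup>2) \<alpha> \<delta> (u2 x) (s2 x)"
        unfolding h2.force_pos[OF left_half(1)[OF x(1,2)]] left_half(5)[OF x(1,2)]
        by (simp add: u_def[symmetric] v_def[symmetric] power2_eq_square mult_ac)
    qed
    then have "q2 (d - z) + \<alpha>\<^sup>2 * spread * C * X < q2 (d + z)"
      using bounds by (simp add: \<Theta>_def X_def)
    then show ?thesis using 1 by simp
  qed
  then show ?thesis by (simp add: gap_eq)
qed

text \<open>The opposite balance. The lead of the right half at \<open>d - z\<close> is at least
  \<open>\<alpha>\<^sup>2 u X / (1500 \<kappa>^3)\<close>: \<open>q_gap\<close> gives the factor 750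
  in terms of \<open>W 0\<close>, and small \<alpha> gives \<open>W (d - z) \<le> 2 * W 0\<close>.
  On the rest of the left half the potential exceeds \<open>1500 \<kappa> s\<close>, so the slope
  \<open>X\<close> is recovered with a smaller gain in \<open>q\<close>.\<close>

lemma gap_pos_if_strong_field:
  assumes long: "4000 < \<kappa> * d" and z: "0 < z" "z \<le> d / 2" and \<alpha>: "0 < \<alpha>" "\<alpha> * spread \<le> 1 / 2"
    and \<delta>\<rho>: "\<kappa> < \<delta>" "\<bar>\<rho>\<bar> < \<kappa>"
  shows "0 < gap (z, \<alpha>)"
proof -
  have A: "1 \<le> spread" by (simp add: spread_def)
  have lt: "d - z < d + z" using z by simp
  \<comment> \<open>Here the length enters: \<open>s2 x \<ge> x \<ge> d / 2\<close> gives
    \<open>\<kappa> * s2 x > 2000\<close>, hence \<open>w \<ge> 2000 \<kappa> s2 - 1\<close>, and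
    the surplus over 1500 absorbs the 1.\<close>
  have w: "1500 * \<kappa> * s2 x < h2.w x" "0 < s2 x" if x: "d - z \<le> x" "x \<le> d + z" for x
  proof -
    have "0 \<le> x" using x lengths by simp
    have sx: "x \<le> s2 x" using h2.s_ge x lengths by simp
    have "\<kappa> * (d / 2) \<le> \<kappa> * s2 x" using sx x z \<kappa> by (intro mult_left_mono) auto
    then have big: "2000 < \<kappa> * s2 x" using long by simp
    have "(\<kappa> * s2 x)\<^sup>2 \<le> (\<delta> * s2 x)\<^sup>2"
      using \<delta>\<rho> \<kappa> sx \<open>0 \<le> x\<close> by (intro power_mono mult_right_mono) auto
    moreover have "2000 * (\<kappa> * s2 x) \<le> (\<kappa> * s2 x)\<^sup>2"
      using big by (simp add: power2_eq_square mult_right_mono)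
    ultimately show "1500 * \<kappa> * s2 x < h2.w x"
      using h2.w_ge_square[of x] big by (simp add: mult.assoc)
    show "0 < s2 x" using zero_less_mult_pos[of \<kappa> "s2 x"] big \<kappa> by simp
  qed
  have "p2 (d - z) < p2 (d + z)"
  proof (rule derivative_pos_less[OF lt h2.p'])
    fix x assume x: "d - z < x" "x < d + z"
    have "0 < 1500 * \<kappa> * s2 x" using w(2)[of x] x \<kappa> by simp
    then have "0 < h2.w x" using w(1)[of x] x by simp
    then show "0 < force (\<kappa>\<^sup>2) \<alpha> \<delta> (u2 x) (s2 x)"
      using h2.force_pos[OF left_half(1)[of x]] left_half(1)[of x] x lengths \<kappa> by simp
  qed (use lengths in auto)
  then have pneg: "p2 (d - z) < 0" using bounds by simp
  \<comment> \<open>For \<open>\<rho> = 0\<close> the halves agree and both slopes vanish at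
    \<open>d - z\<close>; for \<open>\<rho> < 0\<close> the left half is steeper, and
    \<open>p_mono\<close> makes its slope positive there.\<close>
  have \<rho>0: "0 < \<rho>"
  proof (rule ccontr)
    assume "\<not> 0 < \<rho>"
    moreover have "\<rho> \<noteq> 0" using pneg bounds by auto
    ultimately have "\<rho> < - \<rho>" by simp
    then show False
      using p_mono[OF \<alpha>01 bounds(1,2,3,3) lengths(1,2)] pneg bounds by fastforce
  qed
  interpret c: comparison "\<kappa>\<^sup>2" \<alpha> \<delta> \<delta> "d - z" u2 p2 s2 q2 u1 p1 s1 q1
    by (rule compare) (use bounds lengths \<alpha>01 left_half(1) in auto)
  define X where "X = - p2 (d - z)"
  define u where "u = u2 (d - z)"
  have X: "0 < X" using pneg by (simp add: X_def)
  have u: "0 < u" using left_half(1) lengths by (simp add: u_def)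
  have Wl: "c.W (d - z) = X * u1 (d - z)" using bounds by (simp add: c.W_def X_def)
  have Wpos: "0 < c.W (d - z)" by (rule c.W_pos) (use \<rho>0 lengths in \<open>auto simp: flow_0\<close>)
  have dec: "p2 x \<le> 0" if "0 \<le> x" "x \<le> d + z" for x
    by (rule h2.p_nonpos) (use that bounds \<rho>0 in \<open>auto simp: flow_0\<close>)
  have "c.W (d - z) - c.W 0 \<le> \<alpha>\<^sup>2 * spread_const (\<kappa>\<^sup>2) (2 * d) \<psi>_min flow_sup \<Delta> * c.W (d - z)"
    by (rule c.spread_bounds(2))
      (use \<rho>0 flow_sup(1) \<psi>_min lengths bounds left_half(2) right_half(3,4) in \<open>auto simp: flow_0\<close>)
  also have "\<dots> \<le> \<alpha>\<^sup>2 * spread * c.W (d - z)"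
    using Wpos by (intro mult_right_mono mult_left_mono) (auto simp: spread_def)
  also have "\<dots> = \<alpha> * (\<alpha> * spread) * c.W (d - z)" by (simp add: power2_eq_square)
  also have "\<dots> \<le> 1 * (1 / 2) * c.W (d - z)"
    using Wpos \<alpha> \<alpha>01 A by (intro mult_right_mono mult_mono) auto
  finally have "c.W (d - z) \<le> 2 * c.W 0" by simp
  then have "\<alpha>\<^sup>2 * c.W (d - z) \<le> \<alpha>\<^sup>2 * (2 * c.W 0)" by (intro mult_left_mono) auto
  moreover have "\<alpha>\<^sup>2 * c.W 0 \<le> 750 * \<kappa> ^ 3 * (q1 (d - z) - q2 (d - z))"
  proof (rule c.q_gap[OF \<kappa> refl])
    have "\<kappa> * (d / 2) \<le> \<kappa> * (d - z)" using z \<kappa> by (intro mult_left_mono) auto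
    then show "1 \<le> 5 * \<kappa> * (d - z)" using long by simp
  qed (use \<delta>\<rho> \<rho>0 dec lengths right_half(5) in \<open>auto simp: flow_0\<close>)
  ultimately have 1: "\<alpha>\<^sup>2 * c.W (d - z) \<le> 1500 * \<kappa> ^ 3 * (q1 (d - z) - q2 (d - z))" by simp
  have "u \<le> u1 (d - z)"
    unfolding u_def by (rule c.strictly_steeper(2)) (use \<rho>0 lengths in \<open>auto simp: flow_0\<close>)
  then have "\<alpha>\<^sup>2 * (X * u) \<le> \<alpha>\<^sup>2 * c.W (d - z)"
    unfolding Wl using X by (intro mult_left_mono) auto
  then have 2: "\<alpha>\<^sup>2 * u * X \<le> 1500 * \<kappa> ^ 3 * (q1 (d - z) - q2 (d - z))"
    using 1 by (simp add: mult_ac)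
  \<comment> \<open>Compared with the weak field the roles are exchanged: now the slope term
    dominates. The factor \<open>u\<close> bounds \<open>u2\<close> beyond \<open>d - z\<close>,
    where \<psi> is nonincreasing by \<open>p_nonpos\<close>.\<close>
  define \<Theta> where "\<Theta> x = \<alpha>\<^sup>2 * u * p2 x - 1500 * \<kappa> ^ 3 * q2 x" for x
  have "\<Theta> (d - z) < \<Theta> (d + z)"
  proof (rule derivative_pos_less[OF lt, where f = \<Theta> and
        f' = "\<lambda>x. \<alpha>\<^sup>2 * u * force (\<kappa>\<^sup>2) \<alpha> \<delta> (u2 x) (s2 x) - 1500 * \<kappa> ^ 3 * (cutoff \<alpha> (u2 x) * s2 x)"])
    show "(\<Theta> has_real_derivative \<alpha>\<^sup>2 * u * force (\<kappa>\<^sup>2) \<alpha> \<delta> (u2 x) (s2 x)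
          - 1500 * \<kappa> ^ 3 * (cutoff \<alpha> (u2 x) * s2 x)) (at x)"
      if "d - z \<le> x" "x \<le> d + z" for x
      unfolding \<Theta>_def by (intro DERIV_diff h2.q' DERIV_cmult h2.p') (use that lengths in auto)
    fix x assume x: "d - z < x" "x < d + z"
    then have x0: "0 \<le> x" "x \<le> d + z" using lengths by auto
    define y where "y = u2 x"
    define v where "v = s2 x"
    have y: "0 < y" "y \<le> u"
    proof -
      show "0 < y" using left_half(1)[OF x0] by (simp add: y_def)
      show "y \<le> u"
        unfolding y_def u_def
        by (rule derivative_nonpos_ge[where f' = p2]) (use x lengths dec h2.\<psi>' in auto)
    qed
    have v: "0 < v" "1500 * \<kappa> * v < h2.w x" using w[of x] x by (auto simp: v_def)
    have "\<alpha>\<^sup>2 * \<kappa>\<^sup>2 * y * (1500 * \<kappa> * v * y) \<le> \<alpha>\<^sup>2 * \<kappa>\<^sup>2 * y * (1500 * \<kappa> * v * u)"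
      using y v \<kappa> by (intro mult_left_mono) auto
    also have "\<dots> < \<alpha>\<^sup>2 * \<kappa>\<^sup>2 * y * (h2.w x * u)"
      using y v \<kappa> \<alpha> by (intro mult_strict_left_mono mult_strict_right_mono) auto
    finally show "0 < \<alpha>\<^sup>2 * u * force (\<kappa>\<^sup>2) \<alpha> \<delta> (u2 x) (s2 x) - 1500 * \<kappa> ^ 3 * (cutoff \<alpha> (u2 x) * s2 x)"
      unfolding h2.force_pos[OF left_half(1)[OF x0]] left_half(5)[OF x0]
      by (simp add: y_def[symmetric] v_def[symmetric] power2_eq_square power3_eq_cube mult_ac)
  qed
  then have "1500 * \<kappa> ^ 3 * (q2 (d + z) - q2 (d - z)) < \<alpha>\<^sup>2 * u * X"
    using bounds by (simp add: \<Theta>_def X_def algebra_simps)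
  then have "1500 * \<kappa> ^ 3 * (q2 (d + z) - q2 (d - z)) < 1500 * \<kappa> ^ 3 * (q1 (d - z) - q2 (d - z))"
    using 2 by simp
  then have "q2 (d + z) - q2 (d - z) < q1 (d - z) - q2 (d - z)"
    by (rule mult_left_less_imp_less) (use \<kappa> in simp)
  then show ?thesis by (simp add: gap_eq)
qed

end

section \<open>Regions in which the gap has a definite sign\<close>

context gl_flow
begin

lemma pair: "(z, \<alpha>) \<in> square \<Longrightarrow> gl_pair \<kappa> d \<Delta> R \<psi> p s q z \<alpha>"
  by unfold_locales

lemma gap_neg_right:
  obtains \<eta> where "0 < \<eta>" "\<eta> < d" "\<And>z \<alpha>. z \<in> {d - \<eta>..d} \<Longrightarrow> \<alpha> \<in> {0<..1} \<Longrightarrow> gap (z, \<alpha>) < 0"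
proof -
  define \<eta> where "\<eta> = min (d / 2) (\<psi>_min\<^sup>2 * d\<^sup>2 / 4 / flow_sup ^ 3)"
  have C3: "0 < flow_sup ^ 3" using flow_sup(1) by simp
  have \<eta>: "0 < \<eta>" "\<eta> < d" using d \<psi>_min C3 by (auto simp: \<eta>_def)
  have "gap (z, \<alpha>) < 0" if z: "z \<in> {d - \<eta>..d}" and \<alpha>: "\<alpha> \<in> {0<..1}" for z \<alpha>
  proof -
    interpret gl_pair \<kappa> d \<Delta> R \<psi> p s q z \<alpha> by (rule pair) (use z \<alpha> \<eta> in auto)
    have "\<eta> \<le> \<psi>_min\<^sup>2 * d\<^sup>2 / 4 / flow_sup ^ 3" unfolding \<eta>_def by (rule min.cobounded2)
    moreover have "d - z \<le> \<eta>" using z by simp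
    ultimately have "d - z \<le> \<psi>_min\<^sup>2 * d\<^sup>2 / 4 / flow_sup ^ 3" by linarith
    then have "(d - z) * flow_sup ^ 3 \<le> \<psi>_min\<^sup>2 * d\<^sup>2 / 4" by (simp only: pos_le_divide_eq[OF C3])
    then show ?thesis using gap_neg_if_near_right \<alpha> by simp
  qed
  then show ?thesis using that[of \<eta>] \<eta> by blast
qed

text \<open>At \<open>\<alpha> = 1\<close> the balanced pair is the constant state without field; by
  uniform continuity the field is weak near this side, uniformly in \<open>z\<close>.\<close>

lemma gap_neg_top:
  obtains \<eta> where "0 < \<eta>" "\<eta> < 1" "\<And>z \<alpha>. z \<in> {0<..d} \<Longrightarrow> \<alpha> \<in> {1 - \<eta>..1} \<Longrightarrow> gap (z, \<alpha>) < 0"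
proof -
  define B where "B = spread * flow_sup * \<kappa>\<^sup>2 * flow_sup"
  have B: "0 < B" using flow_sup(1) \<kappa> by (simp add: B_def spread_def)
  define \<epsilon> where "\<epsilon> = min 1 (\<psi>_min / 2 / B)"
  have \<epsilon>: "0 < \<epsilon>" "\<epsilon> \<le> 1" "\<epsilon> \<le> \<psi>_min / 2 / B" using B \<psi>_min by (auto simp: \<epsilon>_def)
  have "uniformly_continuous_on square field"
    by (intro compact_uniformly_continuous continuous_slope_field compact_Times compact_Icc)
  then obtain e where e: "0 < e"
    "\<And>x y. x \<in> square \<Longrightarrow> y \<in> square \<Longrightarrow> dist x y < e \<Longrightarrow> dist (field x) (field y) < \<epsilon>"
    using \<epsilon>(1) unfolding uniformly_continuous_on_def by metis
  define \<eta> where "\<eta> = min (e / 2) (1 / 2)"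
  have \<eta>: "0 < \<eta>" "\<eta> < 1" "\<eta> < e" using e(1) by (auto simp: \<eta>_def)
  have "gap (z, \<alpha>) < 0" if z: "z \<in> {0<..d}" and \<alpha>: "\<alpha> \<in> {1 - \<eta>..1}" for z \<alpha>
  proof -
    interpret gl_pair \<kappa> d \<Delta> R \<psi> p s q z \<alpha> by (rule pair) (use z \<alpha> \<eta> in auto)
    have "dist (z, \<alpha>) (z, 1) < e" using \<alpha> \<eta> by (simp add: dist_Pair_Pair dist_real_def)
    then have "dist (field (z, \<alpha>)) (field (z, 1)) < \<epsilon>" using square z by (intro e) auto
    then have \<delta>\<epsilon>: "\<delta> < \<epsilon>" using slope_field_top(2)[of z] z bounds by (simp add: \<delta>_def dist_real_def)
    then have "\<delta> \<le> \<psi>_min / 2 / B" using \<epsilon>(3) by simp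
    then have "\<delta> * B \<le> \<psi>_min / 2" by (simp only: pos_le_divide_eq[OF B])
    then show ?thesis using gap_neg_if_weak_field \<delta>\<epsilon> \<epsilon>(2) z \<alpha> \<eta> by (simp add: B_def)
  qed
  then show ?thesis using that[of \<eta>] \<eta> by blast
qed

text \<open>At the corner itself the slope is zero and the field exceeds \<kappa>, by the comparison
  with the Gaussian; both strict inequalities persist nearby.\<close>

lemma gap_pos_corner:
  assumes long: "4000 < \<kappa> * d"
  obtains \<epsilon> where "0 < \<epsilon>" "\<epsilon> < d" "\<epsilon> < 1" "\<And>z \<alpha>. z \<in> {0<..\<epsilon>} \<Longrightarrow> \<alpha> \<in> {0<..\<epsilon>} \<Longrightarrow> 0 < gap (z, \<alpha>)"
proof -
  have A: "1 \<le> spread" by (simp add: spread_def)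
  have sq0: "(0, 0) \<in> square" using d by auto
  interpret o: gl_pair \<kappa> d \<Delta> R \<psi> p s q 0 0 by (rule pair[OF sq0])
  have slope0: "slope (0, 0) = 0" using slope_0[of 0] by simp
  have field0: "\<kappa> < field (0, 0)"
    using o.h1.linear_case_\<delta>[OF refl \<kappa> refl] o.bounds slope0 d
    by (simp add: flow_0 o.\<rho>_def o.\<delta>_def)
  obtain e1 where e1: "0 < e1" "\<And>x. x \<in> square \<Longrightarrow> dist x (0, 0) < e1 \<Longrightarrow> dist (field x) (field (0, 0)) < field (0, 0) - \<kappa>"
    using continuous_slope_field(2) sq0 field0 unfolding continuous_on_iff by (metis diff_gt_0_iff_gt)
  obtain e2 where e2: "0 < e2" "\<And>x. x \<in> square \<Longrightarrow> dist x (0, 0) < e2 \<Longrightarrow> dist (slope x) (slope (0, 0)) < \<kappa>"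
    using continuous_slope_field(1) sq0 \<kappa> unfolding continuous_on_iff by metis
  \<comment> \<open>The distance to the corner is at most
    \<open>z + \<alpha> \<le> 2 * \<epsilon>\<close>, hence the quarter of the radii.\<close>
  define \<epsilon> where "\<epsilon> = min (min (d / 2) (1 / (2 * spread))) (min e1 e2 / 4)"
  have "\<epsilon> \<le> 1 / (2 * spread)" by (simp add: \<epsilon>_def)
  then have "\<epsilon> * (2 * spread) \<le> 1" using A by (simp add: field_simps)
  then have \<epsilon>: "0 < \<epsilon>" "\<epsilon> \<le> d / 2" "\<epsilon> * spread \<le> 1 / 2" "2 * \<epsilon> < e1" "2 * \<epsilon> < e2"
    using A d e1(1) e2(1) by (auto simp: \<epsilon>_def)
  have "\<epsilon> * 1 \<le> \<epsilon> * spread" using A \<epsilon> by (intro mult_left_mono) auto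
  then have \<epsilon>1: "\<epsilon> \<le> 1 / 2" using \<epsilon>(3) by linarith
  have "0 < gap (z, \<alpha>)" if z: "z \<in> {0<..\<epsilon>}" and \<alpha>: "\<alpha> \<in> {0<..\<epsilon>}" for z \<alpha>
  proof -
    interpret gl_pair \<kappa> d \<Delta> R \<psi> p s q z \<alpha> by (rule pair) (use z \<alpha> \<epsilon> \<epsilon>1 d in auto)
    have "dist (z, \<alpha>) (0, 0) \<le> \<bar>z\<bar> + \<bar>\<alpha>\<bar>"
      using norm_Pair_le[of z \<alpha>] by (simp add: dist_norm zero_prod_def[symmetric])
    then have "dist (z, \<alpha>) (0, 0) < e1" "dist (z, \<alpha>) (0, 0) < e2" using z \<alpha> \<epsilon> by auto
    then have "\<kappa> < \<delta>" "\<bar>\<rho>\<bar> < \<kappa>"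
      using e1(2)[OF square] e2(2)[OF square] slope0 by (auto simp: \<delta>_def \<rho>_def dist_real_def abs_less_iff)
    moreover have "\<alpha> * spread \<le> \<epsilon> * spread" using \<alpha> A by (intro mult_right_mono) auto
    ultimately show ?thesis using gap_pos_if_strong_field long z \<alpha> \<epsilon> by simp
  qed
  then show ?thesis using that[of \<epsilon>] \<epsilon> \<epsilon>1 d by auto
qed

end

section \<open>Topology\<close>

text \<open>Pulled back to the whole plane by arctangents, the zero set is closed, and if a closed
  plane set separates two points, one of its components does. This component approaches both sides
  \<open>z = 0\<close> and \<open>\<alpha> = 0\<close>: otherwise a path far to the left, or far
  below, would lead around it.\<close>

lemma zero_component_joins_sides:
  fixes g :: "real \<times> real \<Rightarrow> real"
  assumes d: "0 < d" and cont: "continuous_on ({0<..<d} \<times> {0<..<1}) g"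
    and \<epsilon>: "0 < \<epsilon>" "\<epsilon> < d" "\<epsilon> < 1" "\<And>z \<alpha>. z \<in> {0<..\<epsilon>} \<Longrightarrow> \<alpha> \<in> {0<..\<epsilon>} \<Longrightarrow> 0 < g (z, \<alpha>)"
    and right: "0 < \<eta>" "\<eta> < d" "\<And>z \<alpha>. z \<in> {d - \<eta>..<d} \<Longrightarrow> \<alpha> \<in> {0<..<1} \<Longrightarrow> g (z, \<alpha>) < 0"
    and top: "0 < \<theta>" "\<theta> < 1" "\<And>z \<alpha>. z \<in> {0<..<d} \<Longrightarrow> \<alpha> \<in> {1 - \<theta>..<1} \<Longrightarrow> g (z, \<alpha>) < 0"
  obtains C z \<alpha> where "C \<subseteq> {0<..<d} \<times> {0<..<1}" "\<And>x. x \<in> C \<Longrightarrow> g x = 0" "connected C"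
    "\<alpha> \<in> {0<..<1}" "(0, \<alpha>) \<in> closure C" "z \<in> {0<..<d}" "(z, 0) \<in> closure C"
proof -
  define \<sigma> where "\<sigma> u = 1 / 2 + arctan u / pi" for u
  define \<tau> where "\<tau> t = tan (pi * (t - 1 / 2))" for t
  have \<sigma>_mono: "\<sigma> u \<le> \<sigma> v \<longleftrightarrow> u \<le> v" for u v
    by (simp add: \<sigma>_def divide_le_cancel arctan_le_iff)
  have \<sigma>01: "0 < \<sigma> u" "\<sigma> u < 1" for u
    using arctan_bounded[of u] by (auto simp: \<sigma>_def field_simps)
  have \<sigma>\<tau>: "\<sigma> (\<tau> t) = t" if "0 < t" "t < 1" for t
  proof -
    have "- (pi / 2) < pi * (t - 1 / 2)" "pi * (t - 1 / 2) < pi / 2"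
      using mult_strict_left_mono[of "- 1 / 2" "t - 1 / 2" pi] mult_strict_left_mono[of "t - 1 / 2" "1 / 2" pi] that
      by simp_all
    then show ?thesis by (simp add: \<sigma>_def \<tau>_def arctan_tan)
  qed
  define \<Phi> where "\<Phi> y = (d * \<sigma> (fst y), \<sigma> (snd y))" for y :: "real \<times> real"
  have \<Phi>_cont: "continuous_on UNIV \<Phi>"
    unfolding \<Phi>_def \<sigma>_def by (intro continuous_intros) auto
  have \<Phi>_in: "\<Phi> y \<in> {0<..<d} \<times> {0<..<1}" for y
    using \<sigma>01 d by (simp add: \<Phi>_def mult_less_cancel_left2)
  define G where "G y = g (\<Phi> y)" for y
  have G_cont: "continuous_on UNIV G"
    unfolding G_def by (rule continuous_on_compose2[OF cont \<Phi>_cont]) (use \<Phi>_in in blast)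
  \<comment> \<open>The thresholds of the sign regions in plane coordinates; the value is positive
    at \<open>(a1, a2)\<close> and negative at \<open>(b1, b2)\<close>.\<close>
  define a1 a2 b1 b2 where "a1 = \<tau> (\<epsilon> / d)" and "a2 = \<tau> \<epsilon>" and "b1 = \<tau> (1 - \<eta> / d)" and "b2 = \<tau> (1 - \<theta>)"
  have ab: "\<sigma> a1 = \<epsilon> / d" "\<sigma> a2 = \<epsilon>" "\<sigma> b1 = 1 - \<eta> / d" "\<sigma> b2 = 1 - \<theta>"
    using \<epsilon> right(1,2) top(1,2) d by (simp_all add: a1_def a2_def b1_def b2_def \<sigma>\<tau>)
  have Gpos: "0 < G y" if "fst y \<le> a1" "snd y \<le> a2" for y
  proof -
    have "\<sigma> (fst y) \<le> \<epsilon> / d" "\<sigma> (snd y) \<le> \<epsilon>" using that \<sigma>_mono ab by metis+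
    then show ?thesis
      unfolding G_def \<Phi>_def using \<Phi>_in[of y] d by (intro \<epsilon>(4)) (auto simp: \<Phi>_def field_simps)
  qed
  have Gneg1: "G y < 0" if "b1 \<le> fst y" for y
  proof -
    have "1 - \<eta> / d \<le> \<sigma> (fst y)" using that \<sigma>_mono ab by metis
    then show ?thesis
      unfolding G_def \<Phi>_def using \<Phi>_in[of y] d by (intro right(3)) (auto simp: \<Phi>_def field_simps)
  qed
  have Gneg2: "G y < 0" if "b2 \<le> snd y" for y
  proof -
    have "1 - \<theta> \<le> \<sigma> (snd y)" using that \<sigma>_mono ab by metis
    then show ?thesis
      unfolding G_def \<Phi>_def using \<Phi>_in[of y] d by (intro top(3)) (auto simp: \<Phi>_def)
  qed
  define S where "S = {y. G y = 0}"
  have "closed S" unfolding S_def by (intro closed_Collect_eq G_cont continuous_intros)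
  moreover have "\<not> connected_component (- S) (a1, a2) (b1, b2)"
  proof
    assume "connected_component (- S) (a1, a2) (b1, b2)"
    then obtain T where T: "connected T" "T \<subseteq> - S" "(a1, a2) \<in> T" "(b1, b2) \<in> T"
      unfolding connected_component_def by blast
    have "connected (G ` T)"
      by (rule connected_continuous_image[OF continuous_on_subset[OF G_cont] T(1)]) simp
    moreover have "G (b1, b2) \<in> G ` T" "G (a1, a2) \<in> G ` T" using T by auto
    moreover have "G (b1, b2) \<le> 0" "0 \<le> G (a1, a2)"
      using Gpos[of "(a1, a2)"] Gneg1[of "(b1, b2)"] by auto
    ultimately have "0 \<in> G ` T" unfolding connected_iff_interval by blast
    then show False using T(2) by (auto simp: S_def)
  qed
  ultimately obtain C0 where C0: "C0 \<in> components S" "\<not> connected_component (- C0) (a1, a2) (b1, b2)"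
    using separation_by_component_closed_pointwise by blast
  have C0S: "C0 \<subseteq> S" and C0c: "connected C0"
    using C0(1) in_components_subset in_components_connected by auto
  have link: "connected_component (- C0) x y" if "convex T" "T \<inter> C0 = {}" "x \<in> T" "y \<in> T" for T x y
    using that convex_connected unfolding connected_component_def by blast
  have G0: "G y = 0" if "y \<in> C0" for y using that C0S by (auto simp: S_def)
  have corner: "{..a1} \<times> {..a2} \<inter> C0 = {}"
  proof (rule equals0I)
    fix y assume y: "y \<in> {..a1} \<times> {..a2} \<inter> C0"
    then have "fst y \<le> a1" "snd y \<le> a2" "y \<in> C0" by auto
    then show False using Gpos[of y] G0[of y] by simp
  qed
  have edge1: "{b1..} \<times> UNIV \<inter> C0 = {}"
  proof (rule equals0I)
    fix y assume y: "y \<in> {b1..} \<times> UNIV \<inter> C0"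
    then have "b1 \<le> fst y" "y \<in> C0" by auto
    then show False using Gneg1[of y] G0[of y] by simp
  qed
  have edge2: "UNIV \<times> {b2..} \<inter> C0 = {}"
  proof (rule equals0I)
    fix y assume y: "y \<in> UNIV \<times> {b2..} \<inter> C0"
    then have "b2 \<le> snd y" "y \<in> C0" by auto
    then show False using Gneg2[of y] G0[of y] by simp
  qed
  have left: "\<exists>y\<in>C0. fst y \<le> t" for t
  proof (rule ccontr)
    assume *: "\<not> (\<exists>y\<in>C0. fst y \<le> t)"
    \<comment> \<open>The detour runs left in the positive quadrant, up in a half plane supposed to
      miss \<open>C0\<close>, and right within the negative top region.\<close>
    define t' where "t' = min t a1"
    have "connected_component (- C0) (a1, a2) (t', a2)"
      by (rule link[OF _ corner]) (auto simp: t'_def intro!: convex_Times)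
    moreover have "connected_component (- C0) (t', a2) (t', b2)"
      by (rule link[of "{..t} \<times> UNIV"]) (use * in \<open>auto simp: t'_def intro!: convex_Times\<close>)
    moreover have "connected_component (- C0) (t', b2) (b1, b2)"
      by (rule link[OF _ edge2]) (auto intro!: convex_Times)
    ultimately show False using C0(2) connected_component_trans by blast
  qed
  have bottom: "\<exists>y\<in>C0. snd y \<le> t" for t
  proof (rule ccontr)
    assume *: "\<not> (\<exists>y\<in>C0. snd y \<le> t)"
    define t' where "t' = min t a2"
    have "connected_component (- C0) (a1, a2) (a1, t')"
      by (rule link[OF _ corner]) (auto simp: t'_def intro!: convex_Times)
    moreover have "connected_component (- C0) (a1, t') (b1, t')"
      by (rule link[of "UNIV \<times> {..t}"]) (use * in \<open>auto simp: t'_def intro!: convex_Times\<close>)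
    moreover have "connected_component (- C0) (b1, t') (b1, b2)"
      by (rule link[OF _ edge1]) (auto intro!: convex_Times)
    ultimately show False using C0(2) connected_component_trans by blast
  qed
  define C where "C = \<Phi> ` C0"
  have C_in: "C \<subseteq> {0<..<d} \<times> {0<..<1}" unfolding C_def using \<Phi>_in by blast
  have C_zero: "g x = 0" if "x \<in> C" for x using that G0 by (auto simp: C_def G_def)
  have C_conn: "connected C"
    unfolding C_def by (rule connected_continuous_image[OF continuous_on_subset[OF \<Phi>_cont] C0c]) simp
  \<comment> \<open>Keeps the closure of \<open>C\<close> off the corner and the other two sides, so
    that its points on \<open>z = 0\<close> and on \<open>\<alpha> = 0\<close> are interior points
    of these sides.\<close>
  define F where "F = ({0..d - \<eta>} \<times> {0..1 - \<theta>}) \<inter> ({x. \<epsilon> \<le> fst x} \<union> {x. \<epsilon> \<le> snd x})"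
  have "closed F"
    unfolding F_def by (intro closed_Int closed_Un closed_Times closed_Collect_le continuous_intros)
  moreover have "C \<subseteq> F"
  proof
    fix x assume x: "x \<in> C"
    obtain z \<alpha> where z\<alpha>: "x = (z, \<alpha>)" by (cases x)
    have *: "g (z, \<alpha>) = 0" "0 < z" "z < d" "0 < \<alpha>" "\<alpha> < 1" using C_zero[OF x] C_in x by (auto simp: z\<alpha>)
    have "\<not> (z \<le> \<epsilon> \<and> \<alpha> \<le> \<epsilon>)" using \<epsilon>(4)[of z \<alpha>] * by auto
    moreover have "\<not> d - \<eta> \<le> z" using right(3)[of z \<alpha>] * by auto
    moreover have "\<not> 1 - \<theta> \<le> \<alpha>" using top(3)[of z \<alpha>] * by auto
    ultimately show "x \<in> F" using * by (auto simp: F_def z\<alpha>)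
  qed
  ultimately have F: "closure C \<subseteq> F" by (rule closure_minimal[rotated])
  have "bounded F"
    by (rule bounded_subset[of "{0..d - \<eta>} \<times> {0..1 - \<theta>}"]) (auto simp: F_def intro!: bounded_Times)
  then have comp: "compact (closure C)" using F bounded_subset by (auto simp: compact_eq_bounded_closed)
  obtain y0 where y0: "y0 \<in> C0" using left by blast
  have ne: "closure C \<noteq> {}" using y0 by (auto simp: C_def)
  \<comment> \<open>The leftmost and the lowest point of the compact closure; as \<open>C0\<close>
    extends arbitrarily far left and down, they lie on the two sides.\<close>
  obtain x1 where x1: "x1 \<in> closure C" "\<And>x. x \<in> closure C \<Longrightarrow> fst x1 \<le> fst x"
    using continuous_attains_inf[OF comp ne, of fst] continuous_on_fst[OF continuous_on_id] by blast
  obtain x2 where x2: "x2 \<in> closure C" "\<And>x. x \<in> closure C \<Longrightarrow> snd x2 \<le> snd x"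
    using continuous_attains_inf[OF comp ne, of snd] continuous_on_snd[OF continuous_on_id] by blast
  have "fst x1 = 0"
  proof (rule ccontr)
    assume "fst x1 \<noteq> 0"
    then have pos: "0 < fst x1" "fst x1 < d" using x1(1) F right(1) by (auto simp: F_def)
    obtain y where y: "y \<in> C0" "fst y \<le> \<tau> (fst x1 / (2 * d))" using left by blast
    have "0 < fst x1 / (2 * d)" "fst x1 / (2 * d) < 1" using pos d by auto
    then have "\<sigma> (fst y) \<le> fst x1 / (2 * d)"
      using y(2) \<sigma>_mono[of "fst y" "\<tau> (fst x1 / (2 * d))"] \<sigma>\<tau>[of "fst x1 / (2 * d)"] by simp
    then have "fst (\<Phi> y) \<le> fst x1 / 2" using d by (simp add: \<Phi>_def field_simps)
    moreover have "\<Phi> y \<in> closure C" using y(1) closure_subset[of C] by (auto simp: C_def)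
    ultimately show False using x1(2)[of "\<Phi> y"] pos by simp
  qed
  moreover have "snd x2 = 0"
  proof (rule ccontr)
    assume "snd x2 \<noteq> 0"
    then have pos: "0 < snd x2" "snd x2 < 1" using x2(1) F top(1) by (auto simp: F_def)
    obtain y where y: "y \<in> C0" "snd y \<le> \<tau> (snd x2 / 2)" using bottom by blast
    have "\<sigma> (snd y) \<le> snd x2 / 2"
      using y(2) \<sigma>_mono[of "snd y" "\<tau> (snd x2 / 2)"] \<sigma>\<tau>[of "snd x2 / 2"] pos by simp
    then have "snd (\<Phi> y) \<le> snd x2 / 2" by (simp add: \<Phi>_def)
    moreover have "\<Phi> y \<in> closure C" using y(1) closure_subset[of C] by (auto simp: C_def)
    ultimately show False using x2(2)[of "\<Phi> y"] pos by simp
  qed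
  moreover have "x1 \<in> F" "x2 \<in> F" using x1(1) x2(1) F by auto
  ultimately show ?thesis
    using that[OF C_in C_zero C_conn, of "snd x1" "fst x2"] x1(1) x2(1) \<epsilon>(1) right(1) top(1)
    by (cases x1; cases x2) (auto simp: F_def)
qed

section \<open>Parametrised families in the C1 topology\<close>

lemma C1_deriv_eq:
  assumes "d > 0" "x \<in> {-d..d}" "(f has_real_derivative D) (at x within {-d..d})"
  shows "C1_deriv d f x = D"
  unfolding C1_deriv_def
  using assms by (intro vector_derivative_within_closed_interval)
    (auto simp: has_real_derivative_iff_has_vector_derivative)

lemma restrict_has_derivative:
  assumes "(f has_real_derivative D) (at x within S)" "x \<in> S"
  shows "(restrict f S has_real_derivative D) (at x within S)"
  using has_field_derivative_transform_within[OF assms(1) zero_less_one assms(2)] by auto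

text \<open>Uniform continuity on the compact product turns joint continuity of the functions and of
  their derivatives into smallness of both suprema in the C1 distance.\<close>

lemma continuous_map_C1_topology:
  fixes F F' :: "'a::metric_space \<Rightarrow> real \<Rightarrow> real"
  assumes d: "d > 0" and X: "compact X"
    and F: "continuous_on (X \<times> {-d..d}) (\<lambda>y. F (fst y) (snd y))"
    and F': "continuous_on (X \<times> {-d..d}) (\<lambda>y. F' (fst y) (snd y))"
    and der: "\<And>x t. x \<in> X \<Longrightarrow> t \<in> {-d..d} \<Longrightarrow> (F x has_real_derivative F' x t) (at t within {-d..d})"
  shows "continuous_map (top_of_set X) (C1_topology d) (\<lambda>x. restrict (F x) {-d..d})"
proof -
  interpret Metric_space "C1_space d" "C1_dist d" by (rule Metric_space_C1[OF d])
  have slice: "continuous_on {-d..d} (F' x)" if "x \<in> X" for x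
  proof -
    have "continuous_on {-d..d} (\<lambda>t. (x, t))" by (intro continuous_intros)
    from continuous_on_compose2[OF F' this] that show ?thesis by auto
  qed
  have der': "(restrict (F x) {-d..d} has_real_derivative F' x t) (at t within {-d..d})"
    if "x \<in> X" "t \<in> {-d..d}" for x t using der[OF that] that(2) by (rule restrict_has_derivative)
  have inC: "restrict (F x) {-d..d} \<in> C1_space d" if "x \<in> X" for x
    unfolding C1_space_def using slice[OF that] der'[OF that] by auto
  have D: "C1_deriv d (restrict (F x) {-d..d}) t = F' x t" if "x \<in> X" "t \<in> {-d..d}" for x t
    by (rule C1_deriv_eq[OF d that(2) der'[OF that]])
  have ne: "{-d..d} \<noteq> {}" using d by simp
  have uc: "\<exists>r>0. \<forall>y\<in>X. dist x y < r \<longrightarrow> (\<forall>t\<in>{-d..d}. \<bar>f x t - f y t\<bar> \<le> e)"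
    if x: "x \<in> X" and e: "e > 0" and f: "continuous_on (X \<times> {-d..d}) (\<lambda>y. f (fst y) (snd y))"
    for x e and f :: "'a \<Rightarrow> real \<Rightarrow> real"
  proof -
    have "uniformly_continuous_on (X \<times> {-d..d}) (\<lambda>y. f (fst y) (snd y))"
      by (intro compact_uniformly_continuous f compact_Times X compact_Icc)
    then obtain r where r: "r > 0" "\<And>u v. u \<in> X \<times> {-d..d} \<Longrightarrow> v \<in> X \<times> {-d..d} \<Longrightarrow> dist u v < r \<Longrightarrow>
        dist (f (fst u) (snd u)) (f (fst v) (snd v)) < e"
      using e unfolding uniformly_continuous_on_def by metis
    have "\<bar>f x t - f y t\<bar> \<le> e" if "y \<in> X" "dist x y < r" "t \<in> {-d..d}" for y t
      using r(2)[of "(x, t)" "(y, t)"] x that by (simp add: dist_Pair_Pair dist_real_def)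
    then show ?thesis using r(1) by blast
  qed
  show ?thesis
    unfolding C1_topology_def continuous_map_to_metric
  proof (intro ballI allI impI)
    fix x \<epsilon> assume "x \<in> topspace (top_of_set X)" and \<epsilon>: "(0::real) < \<epsilon>"
    then have x: "x \<in> X" by simp
    have e3: "\<epsilon> / 3 > 0" using \<epsilon> by simp
    obtain r1 where r1: "r1 > 0" "\<And>y t. y \<in> X \<Longrightarrow> dist x y < r1 \<Longrightarrow> t \<in> {-d..d} \<Longrightarrow> \<bar>F x t - F y t\<bar> \<le> \<epsilon> / 3"
      using uc[OF x e3 F] by blast
    obtain r2 where r2: "r2 > 0" "\<And>y t. y \<in> X \<Longrightarrow> dist x y < r2 \<Longrightarrow> t \<in> {-d..d} \<Longrightarrow> \<bar>F' x t - F' y t\<bar> \<le> \<epsilon> / 3"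
      using uc[OF x e3 F'] by blast
    have "restrict (F y) {-d..d} \<in> mball (restrict (F x) {-d..d}) \<epsilon>"
      if y: "y \<in> X" "dist x y < min r1 r2" for y
    proof -
      have "(SUP t\<in>{-d..d}. \<bar>restrict (F x) {-d..d} t - restrict (F y) {-d..d} t\<bar>) \<le> \<epsilon> / 3"
        by (rule cSUP_least[OF ne]) (use r1(2)[OF y(1)] y(2) in simp)
      moreover have "(SUP t\<in>{-d..d}. \<bar>C1_deriv d (restrict (F x) {-d..d}) t - C1_deriv d (restrict (F y) {-d..d}) t\<bar>) \<le> \<epsilon> / 3"
        by (rule cSUP_least[OF ne]) (use r2(2)[OF y(1)] y(2) D[OF x] D[OF y(1)] in simp)
      ultimately have "C1_dist d (restrict (F x) {-d..d}) (restrict (F y) {-d..d}) < \<epsilon>"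
        using inC[OF x] inC[OF y(1)] \<epsilon> by (simp add: C1_dist_def)
      then show ?thesis using inC[OF x] inC[OF y(1)] by (simp add: in_mball)
    qed
    then show "\<exists>U. openin (top_of_set X) U \<and> x \<in> U \<and>
        (\<forall>y\<in>U. restrict (F y) {-d..d} \<in> mball (restrict (F x) {-d..d}) \<epsilon>)"
      using x r1(1) r2(1) by (intro exI[of _ "X \<inter> ball x (min r1 r2)"]) (auto simp: openin_open_Int)
  qed
qed

section \<open>The branch of asymmetric solutions\<close>

text \<open>The flow starts at the zero \<open>z\<close> and is also run to negative times, which
  \<open>flow_refl\<close> identifies with the left half. The factors \<open>snd x\<close> and
  \<open>field x\<close> undo the scaling, and the last entry is the slope of \<open>a\<close> at
  \<open>d\<close>.\<close>

definition (in gl_flow) state_of :: "real \<times> real \<Rightarrow> state" where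
  "state_of x =
     (restrict (\<lambda>t. snd x * \<psi> (snd x) (slope x) (field x) (t - fst x)) {-d..d},
      restrict (\<lambda>t. field x * s (snd x) (slope x) (field x) (t - fst x)) {-d..d},
      field x * q (snd x) (slope x) (field x) (d - fst x))"

context gl_pair
begin

lemma state_of_eq:
  "state_of (z, \<alpha>) = (restrict (\<lambda>t. \<alpha> * u1 (t - z)) {-d..d}, restrict (\<lambda>t. \<delta> * s1 (t - z)) {-d..d}, \<delta> * q1 (d - z))"
  by (simp add: state_of_def \<rho>_def \<delta>_def)

lemma shifted_flow':
  assumes "t \<in> {-d..d}"
  shows "((\<lambda>t. u1 (t - z)) has_real_derivative p1 (t - z)) (at t within S)"
    "((\<lambda>t. p1 (t - z)) has_real_derivative force (\<kappa>\<^sup>2) \<alpha> \<delta> (u1 (t - z)) (s1 (t - z))) (at t within S)"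
    "((\<lambda>t. s1 (t - z)) has_real_derivative q1 (t - z)) (at t within S)"
    "((\<lambda>t. q1 (t - z)) has_real_derivative cutoff \<alpha> (u1 (t - z)) * s1 (t - z)) (at t within S)"
proof -
  have "\<bar>t - z\<bar> \<le> 2 * d" using assms z0d by auto
  then show "((\<lambda>t. u1 (t - z)) has_real_derivative p1 (t - z)) (at t within S)"
    "((\<lambda>t. p1 (t - z)) has_real_derivative force (\<kappa>\<^sup>2) \<alpha> \<delta> (u1 (t - z)) (s1 (t - z))) (at t within S)"
    "((\<lambda>t. s1 (t - z)) has_real_derivative q1 (t - z)) (at t within S)"
    "((\<lambda>t. q1 (t - z)) has_real_derivative cutoff \<alpha> (u1 (t - z)) * s1 (t - z)) (at t within S)"
    using flow'[OF \<alpha>01 bounds(1), of \<delta> "t - z"] bounds(3) params DERIV_shift[of _ _ t "- z"]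
    by (auto intro: has_field_derivative_at_within)
qed

lemma shifted_flow_true:
  assumes t: "t \<in> {-d..d}"
  shows "0 < u1 (t - z)" "cutoff \<alpha> (u1 (t - z)) = \<alpha>\<^sup>2 * (u1 (t - z))\<^sup>2"
  using right_half(1,6)[of "t - z"] left_half(1,5)[of "z - t"] flow_refl[of \<alpha> \<rho> \<delta> "z - t"] t
  by (cases "z \<le> t"; simp)+

lemma shifted_flow_GL:
  assumes J: "J \<subseteq> {-d..d}" and eq: "\<And>t. t \<in> J \<Longrightarrow> u t = \<alpha> * u1 (t - z)" "\<And>t. t \<in> J \<Longrightarrow> v t = \<delta> * s1 (t - z)"
  shows "GL_system \<kappa> J u (\<lambda>t. \<alpha> * p1 (t - z)) v (\<lambda>t. \<delta> * q1 (t - z))"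
  unfolding GL_system_def
proof (intro ballI conjI)
  fix t assume tJ: "t \<in> J"
  then have t: "t \<in> {-d..d}" using J by auto
  note der = shifted_flow'[OF t] and true = shifted_flow_true[OF t]
  show "(u has_real_derivative \<alpha> * p1 (t - z)) (at t within J)"
    by (rule has_field_derivative_transform_within[OF DERIV_cmult[OF der(1)] zero_less_one tJ]) (simp add: eq)
  show "(v has_real_derivative \<delta> * q1 (t - z)) (at t within J)"
    by (rule has_field_derivative_transform_within[OF DERIV_cmult[OF der(3)] zero_less_one tJ]) (simp add: eq)
  have "\<alpha> * force (\<kappa>\<^sup>2) \<alpha> \<delta> (u1 (t - z)) (s1 (t - z)) = \<kappa>\<^sup>2 * u t * ((u t)\<^sup>2 + (v t)\<^sup>2 - 1)"
    using true by (simp add: force_def eq[OF tJ] power_mult_distrib)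
  then show "((\<lambda>t. \<alpha> * p1 (t - z)) has_real_derivative \<kappa>\<^sup>2 * u t * ((u t)\<^sup>2 + (v t)\<^sup>2 - 1)) (at t within J)"
    using DERIV_cmult[OF der(2), of \<alpha> J] by simp
  have "\<delta> * (cutoff \<alpha> (u1 (t - z)) * s1 (t - z)) = (u t)\<^sup>2 * v t"
    using true by (simp add: eq[OF tJ] power_mult_distrib)
  then show "((\<lambda>t. \<delta> * q1 (t - z)) has_real_derivative (u t)\<^sup>2 * v t) (at t within J)"
    using DERIV_cmult[OF der(4), of \<delta> J] by simp
qed

text \<open>A vanishing gap is the condition that \<open>a'\<close> agrees at both ends. If
  \<open>a\<close> were odd, it would have a second zero at \<open>-z\<close>, against
  \<open>s2 (2 * z) \<ge> 2 * z > 0\<close>.\<close>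

lemma state_of_asymmetric:
  assumes z: "0 < z" "z < d" and \<alpha>: "0 < \<alpha>" "\<alpha> < 1" and gap: "gap (z, \<alpha>) = 0"
  shows "state_of (z, \<alpha>) \<in> asymmetric_solutions \<kappa> d"
proof -
  have \<delta>: "0 < \<delta>" using field_pos[OF square \<alpha>(2)] by (simp add: \<delta>_def)
  define u where "u = restrict (\<lambda>t. \<alpha> * u1 (t - z)) {-d..d}"
  define v where "v = restrict (\<lambda>t. \<delta> * s1 (t - z)) {-d..d}"
  define h where "h = \<delta> * q1 (d - z)"
  have S: "GL_system \<kappa> {-d..d} u (\<lambda>t. \<alpha> * p1 (t - z)) v (\<lambda>t. \<delta> * q1 (t - z))"
    by (rule shifted_flow_GL) (auto simp: u_def v_def)
  have upos: "0 < u t" if "t \<in> {-d..d}" for t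
    using shifted_flow_true(1)[OF that] that \<alpha> by (simp add: u_def)
  have hpos: "0 < h" using h1.q_pos[of "d - z"] lengths \<delta> by (simp add: h_def)
  have "p1 (- d - z) = 0" "q1 (- d - z) = q2 (d + z)"
    using flow_refl[of \<alpha> \<rho> \<delta> "d + z"] bounds by (simp_all add: algebra_simps)
  moreover have "q2 (d + z) = q1 (d - z)" using gap by (simp add: gap_eq)
  ultimately have "(u, v, h) \<in> GL_solutions \<kappa> d"
    unfolding GL_solutions_def mem_Collect_eq case_prod_conv
    by (intro conjI exI[of _ "\<lambda>t. \<alpha> * p1 (t - z)"] exI[of _ "\<lambda>t. \<delta> * q1 (t - z)"] S)
      (use hpos upos bounds in \<open>auto simp: u_def v_def h_def\<close>)
  moreover have "\<not> symmetric_state d (u, v, h)"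
  proof
    assume "symmetric_state d (u, v, h)"
    then have "v (-z) = - v z" using z by (auto simp: symmetric_state_def)
    moreover have "v z = 0" using z by (simp add: v_def flow_0)
    moreover have "v (-z) = \<delta> * s1 (- (2 * z))" using z by (simp add: v_def)
    moreover have "s1 (- (2 * z)) = - s2 (2 * z)" using flow_refl[of \<alpha> \<rho> \<delta> "2 * z"] by simp
    ultimately have "s2 (2 * z) = 0" using \<delta> by simp
    moreover have "2 * z \<le> s2 (2 * z)" by (rule h2.s_ge) (use z in auto)
    ultimately show False using z by simp
  qed
  ultimately show ?thesis by (simp add: state_of_eq asymmetric_solutions_def u_def v_def h_def)
qed

text \<open>At \<open>z = 0\<close> the slope vanishes, so \<open>flow_refl\<close> makes \<psi>
  even and \<open>s\<close> odd, in accordance with the extensions that define the curve.\<close>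

lemma state_of_symmetric:
  assumes z: "z = 0" and \<alpha>: "0 < \<alpha>" "\<alpha> < 1"
  shows "state_of (z, \<alpha>) \<in> symmetric_curve \<kappa> d"
proof -
  have \<delta>: "0 < \<delta>" using field_pos[OF square \<alpha>(2)] by (simp add: \<delta>_def)
  have shift: "t - z = t" for t using z by simp
  have \<rho>: "\<rho> = 0" unfolding \<rho>_def using slope_0[OF \<alpha>01] z by simp
  have S: "GL_system \<kappa> {0..d} (\<lambda>t. \<alpha> * u1 t) (\<lambda>t. \<alpha> * p1 t) (\<lambda>t. \<delta> * s1 t) (\<lambda>t. \<delta> * q1 t)"
    using shifted_flow_GL[of "{0..d}" "\<lambda>t. \<alpha> * u1 t" "\<lambda>t. \<delta> * s1 t"] d by (simp add: shift)
  have "shooting_solution \<kappa> d \<alpha> \<delta> (\<lambda>t. \<alpha> * u1 t) (\<lambda>t. \<alpha> * p1 t) (\<lambda>t. \<delta> * s1 t) (\<lambda>t. \<delta> * q1 t)"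
    unfolding shooting_solution_def using S right_half(1) bounds(4) \<alpha> \<rho> by (simp add: flow_0 shift)
  moreover have "state_of (z, \<alpha>) =
    (restrict (\<lambda>x. if 0 \<le> x then \<alpha> * u1 x else \<alpha> * u1 (-x)) {-d..d},
     restrict (\<lambda>x. if 0 \<le> x then \<delta> * s1 x else - (\<delta> * s1 (-x))) {-d..d}, \<delta> * q1 d)"
  proof -
    have "u1 (-x) = u1 x" "s1 (-x) = - s1 x" for x
      using flow_refl[of \<alpha> 0 \<delta> x] by (simp_all add: \<rho>)
    then show ?thesis unfolding state_of_eq shift by (auto intro!: restrict_ext)
  qed
  ultimately show ?thesis
    unfolding symmetric_curve_def using \<alpha> \<delta>
    by (simp only: mem_Collect_eq case_prod_conv)
      (rule bexI[of _ \<alpha>], rule exI[of _ \<delta>], rule conjI, assumption, (rule exI)+, intro conjI,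
        assumption, rule refl, rule refl, rule refl, simp)
qed

text \<open>Without the factor \<alpha> the equation for \<open>s\<close> is \<open>s'' = 0\<close>;
  the shift is \<open>c = - z\<close> because \<open>a\<close> vanishes at \<open>z\<close>.\<close>

lemma state_of_normal:
  assumes "\<alpha> = 0"
  shows "state_of (z, \<alpha>) = normal_state d (- z) \<delta>"
proof -
  have "s1 (t - z) = t - z" if "t \<in> {-d..d}" for t
    using h1.linear_case(2)[OF assms, of "t - z"] h2.linear_case(2)[OF assms, of "z - t"]
      flow_refl[of \<alpha> \<rho> \<delta> "z - t"] that by (cases "z \<le> t") simp_all
  moreover have "q1 (d - z) = 1" using h1.linear_case(1)[OF assms, of "d - z"] lengths by simp
  ultimately show ?thesis
    unfolding state_of_eq normal_state_def using assms by (auto intro!: restrict_ext)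
qed

end

context gl_flow
begin

lemma continuous_map_state_of: "continuous_map (top_of_set square) (state_topology d) state_of"
proof -
  note c = continuous_slope_field
  have c': "continuous_on (square \<times> {-d..d}) (\<lambda>y. slope (fst y))" "continuous_on (square \<times> {-d..d}) (\<lambda>y. field (fst y))"
    by (rule continuous_on_compose2[OF c(1)] continuous_on_compose2[OF c(2)]; auto intro!: continuous_intros)+
  have sq: "compact square" by (intro compact_Times compact_Icc)
  have der: "((\<lambda>t. snd x * \<psi> (snd x) (slope x) (field x) (t - fst x)) has_real_derivative
        snd x * p (snd x) (slope x) (field x) (t - fst x)) (at t within {-d..d})"
      "((\<lambda>t. field x * s (snd x) (slope x) (field x) (t - fst x)) has_real_derivative
        field x * q (snd x) (slope x) (field x) (t - fst x)) (at t within {-d..d})"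
    if "x \<in> square" "t \<in> {-d..d}" for x t
  proof -
    interpret gl_pair \<kappa> d \<Delta> R \<psi> p s q "fst x" "snd x" by (rule pair) (use that in auto)
    show "((\<lambda>t. snd x * \<psi> (snd x) (slope x) (field x) (t - fst x)) has_real_derivative
        snd x * p (snd x) (slope x) (field x) (t - fst x)) (at t within {-d..d})"
      "((\<lambda>t. field x * s (snd x) (slope x) (field x) (t - fst x)) has_real_derivative
        field x * q (snd x) (slope x) (field x) (t - fst x)) (at t within {-d..d})"
      using DERIV_cmult[OF shifted_flow'(1)[OF that(2)]] DERIV_cmult[OF shifted_flow'(3)[OF that(2)]]
      by (simp_all add: \<rho>_def \<delta>_def)
  qed
  have 1: "continuous_map (top_of_set square) (C1_topology d)
      (\<lambda>x. restrict (\<lambda>t. snd x * \<psi> (snd x) (slope x) (field x) (t - fst x)) {-d..d})"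
    by (rule continuous_map_C1_topology[OF d sq _ _ der(1)]; (intro continuous_intros c')?)
  have 2: "continuous_map (top_of_set square) (C1_topology d)
      (\<lambda>x. restrict (\<lambda>t. field x * s (snd x) (slope x) (field x) (t - fst x)) {-d..d})"
    by (rule continuous_map_C1_topology[OF d sq _ _ der(2)]; (intro continuous_intros c')?)
  have 3: "continuous_map (top_of_set square) euclideanreal (\<lambda>x. field x * q (snd x) (slope x) (field x) (d - fst x))"
    unfolding continuous_map_iff_continuous by (intro continuous_intros c)
  show ?thesis
    unfolding state_topology_def state_of_def[abs_def] by (intro continuous_map_pairedI 1 2 3)
qed

lemma asymmetric_branch:
  assumes long: "4000 < \<kappa> * d"
  obtains C z \<alpha> where "C \<subseteq> square" "state_of ` C \<subseteq> asymmetric_solutions \<kappa> d" "connected C"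
    "\<alpha> \<in> {0<..<1}" "(0, \<alpha>) \<in> closure C" "z \<in> {0<..<d}" "(z, 0) \<in> closure C"
proof -
  obtain \<epsilon> where \<epsilon>: "0 < \<epsilon>" "\<epsilon> < d" "\<epsilon> < 1"
    "\<And>z \<alpha>. z \<in> {0<..\<epsilon>} \<Longrightarrow> \<alpha> \<in> {0<..\<epsilon>} \<Longrightarrow> 0 < gap (z, \<alpha>)"
    by (rule gap_pos_corner[OF long]) blast
  obtain \<eta> where \<eta>: "0 < \<eta>" "\<eta> < d" "\<And>z \<alpha>. z \<in> {d - \<eta>..d} \<Longrightarrow> \<alpha> \<in> {0<..1} \<Longrightarrow> gap (z, \<alpha>) < 0"
    by (rule gap_neg_right) blast
  obtain \<theta> where \<theta>: "0 < \<theta>" "\<theta> < 1"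
    "\<And>z \<alpha>. z \<in> {0<..d} \<Longrightarrow> \<alpha> \<in> {1 - \<theta>..1} \<Longrightarrow> gap (z, \<alpha>) < 0"
    by (rule gap_neg_top) blast
  have cont: "continuous_on ({0<..<d} \<times> {0<..<1}) gap"
    by (rule continuous_on_subset[OF continuous_gap]) auto
  have neg: "gap (z, \<alpha>) < 0" if "z \<in> {d - \<eta>..<d}" "\<alpha> \<in> {0<..<1}" for z \<alpha>
    by (rule \<eta>(3)) (use that in auto)
  have neg': "gap (z, \<alpha>) < 0" if "z \<in> {0<..<d}" "\<alpha> \<in> {1 - \<theta>..<1}" for z \<alpha>
    by (rule \<theta>(3)) (use that in auto)
  show ?thesis
  proof (rule zero_component_joins_sides[where g = gap, OF d cont \<epsilon> \<eta>(1,2) neg \<theta>(1,2) neg'])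
    fix C z \<alpha>
    assume C: "C \<subseteq> {0<..<d} \<times> {0<..<1}" "\<And>x. x \<in> C \<Longrightarrow> gap x = 0" "connected C"
      "\<alpha> \<in> {0<..<1}" "(0, \<alpha>) \<in> closure C" "z \<in> {0<..<d}" "(z, 0) \<in> closure C"
    have "state_of x \<in> asymmetric_solutions \<kappa> d" if "x \<in> C" for x
    proof -
      have x: "0 < fst x" "fst x < d" "0 < snd x" "snd x < 1" using C(1) that by auto
      interpret gl_pair \<kappa> d \<Delta> R \<psi> p s q "fst x" "snd x" by (rule pair) (use x in \<open>auto simp: mem_Times_iff\<close>)
      show ?thesis using state_of_asymmetric x C(2)[OF that] by simp
    qed
    then have "state_of ` C \<subseteq> asymmetric_solutions \<kappa> d" by (rule image_subsetI)
    moreover have "C \<subseteq> square" by (rule subset_trans[OF C(1)]) auto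
    ultimately show thesis by (intro that[of C \<alpha> z] C(3-7))
  qed auto
qed

end

lemma gl_flow_exists:
  assumes \<kappa>: "0 < \<kappa>" and d: "0 < d"
  obtains \<Delta> R \<psi> p s q where "gl_flow \<kappa> d \<Delta> R \<psi> p s q"
proof -
  define \<tau> where "\<tau> = min (d / 2) (1 / (5 * \<kappa>))"
  have "0 < \<kappa> * \<tau> ^ 3" using \<kappa> d by (simp add: \<tau>_def)
  \<comment> \<open>A sum meets all lower bounds at once; \<open>1 \<le> \<Delta>\<close> allows
    \<Delta> to be replaced by its square in the condition with 6.\<close>
  define \<Delta> where "\<Delta> = 2 * \<kappa> + 1 + 6 / (\<kappa> * \<tau> ^ 3)"
  define R where "R = \<kappa> * (\<Delta> * exp (2 * d)) + \<Delta>"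
  have ge: "0 \<le> 6 / (\<kappa> * \<tau> ^ 3)" using \<open>0 < \<kappa> * \<tau> ^ 3\<close> by simp
  then have \<Delta>1: "2 * \<kappa> < \<Delta>" "1 \<le> \<Delta>" "6 / (\<kappa> * \<tau> ^ 3) \<le> \<Delta>" using \<kappa> unfolding \<Delta>_def by linarith+
  have "6 \<le> \<Delta> * (\<kappa> * \<tau> ^ 3)" using \<Delta>1(3) by (simp only: pos_divide_le_eq[OF \<open>0 < \<kappa> * \<tau> ^ 3\<close>])
  also have "\<dots> \<le> \<Delta>\<^sup>2 * (\<kappa> * \<tau> ^ 3)"
    using \<Delta>1(2) \<open>0 < \<kappa> * \<tau> ^ 3\<close> mult_left_mono[OF \<Delta>1(2), of \<Delta>]
    by (intro mult_right_mono) (auto simp: power2_eq_square)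
  finally have 6: "6 \<le> \<kappa> * \<Delta>\<^sup>2 * \<tau> ^ 3" by (simp add: mult_ac)
  have R0: "0 \<le> R" using \<kappa> \<Delta>1 by (simp add: R_def)
  have k0: "0 \<le> \<kappa>\<^sup>2" and \<tau>0: "0 \<le> 2 * d" using d by auto
  show ?thesis
    apply (rule truncated_flow[OF k0 R0 \<tau>0])
    subgoal premises flow for \<psi> p s q
      by (rule that[of \<Delta> R \<psi> p s q], rule gl_flow.intro)
        (fact \<kappa> d \<Delta>1(1) 6[unfolded \<tau>_def] R_def flow)+
    done
qed

text \<open>One branch serves both claims: its limit over \<open>(0, \<alpha>)\<close> is the
  bifurcation point, its limit over \<open>(z, 0)\<close> the normal state. The branch is connected
  already before the identification with reflections, and continuity of the quotient map preserves
  this.\<close>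

lemma asymmetric_branch_exists:
  assumes \<kappa>: "0 < \<kappa>" and d: "0 < d" and long: "4000 < \<kappa> * d"
  obtains C p c h \<sigma> where "C \<subseteq> asymmetric_solutions \<kappa> d"
    "connectedin (asymmetric_quotient \<kappa> d) (reflection_class d ` C)"
    "p \<in> symmetric_curve \<kappa> d" "p \<in> state_topology d closure_of C"
    "c \<noteq> 0" "0 < h" "normal_state d c h \<in> state_topology d closure_of C"
    "\<And>n::nat. \<sigma> n \<in> asymmetric_solutions \<kappa> d" "limitin (state_topology d) \<sigma> p sequentially"
proof -
  obtain \<Delta> R \<psi> p s q where "gl_flow \<kappa> d \<Delta> R \<psi> p s q"
    by (rule gl_flow_exists[OF \<kappa> d])
  then interpret gl_flow \<kappa> d \<Delta> R \<psi> p s q .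
  obtain C z \<alpha> where C: "C \<subseteq> square" "state_of ` C \<subseteq> asymmetric_solutions \<kappa> d" "connected C"
    "\<alpha> \<in> {0<..<1}" "(0, \<alpha>) \<in> closure C" "z \<in> {0<..<d}" "(z, 0) \<in> closure C"
    by (rule asymmetric_branch[OF long])
  define f where "f = state_of"
  note cont = continuous_map_state_of[folded f_def]
  have clos: "f x \<in> state_topology d closure_of (f ` C)" if "x \<in> closure C" "x \<in> square" for x
  proof -
    have "x \<in> top_of_set square closure_of C"
      using that C(1) by (simp add: closure_of_subtopology Int_absorb1)
    then show ?thesis using continuous_map_image_closure_subset[OF cont, of C] by blast
  qed
  have sq: "(0, \<alpha>) \<in> square" "(z, 0) \<in> square" using C(4,6) d by auto
  interpret l: gl_pair \<kappa> d \<Delta> R \<psi> p s q 0 \<alpha> by (rule pair[OF sq(1)])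
  interpret b: gl_pair \<kappa> d \<Delta> R \<psi> p s q z 0 by (rule pair[OF sq(2)])
  have "continuous_map (top_of_set C) (state_topology d) f"
    using continuous_map_from_subtopology[OF cont, of C] C(1) by (simp add: subtopology_subtopology Int_absorb1)
  then have "continuous_map (top_of_set C) (subtopology (state_topology d) (asymmetric_solutions \<kappa> d)) f"
    using C(2) by (simp add: continuous_map_in_subtopology f_def image_subset_iff_funcset)
  moreover have "continuous_map (subtopology (state_topology d) (asymmetric_solutions \<kappa> d))
      (asymmetric_quotient \<kappa> d) (reflection_class d)"
    unfolding asymmetric_quotient_def
    by (rule quotient_imp_continuous_map[OF quotient_map_quotient_topology])
  ultimately have "continuous_map (top_of_set C) (asymmetric_quotient \<kappa> d) (reflection_class d \<circ> f)"
    by (rule continuous_map_compose)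
  moreover have "connectedin (top_of_set C) C" using C(3) by (simp add: connectedin_subtopology)
  ultimately have "connectedin (asymmetric_quotient \<kappa> d) ((reflection_class d \<circ> f) ` C)"
    by (rule connectedin_continuous_map_image)
  then have conn: "connectedin (asymmetric_quotient \<kappa> d) (reflection_class d ` f ` C)"
    by (simp add: image_comp)
  \<comment> \<open>The parameters live in a metric space, so the closure point is the limit of a
    sequence; its image is the required sequence of asymmetric solutions.\<close>
  obtain x where x: "\<And>n. x n \<in> C" "x \<longlonglongrightarrow> (0, \<alpha>)" using C(5) unfolding closure_sequential by blast
  have "limitin (top_of_set square) x (0, \<alpha>) sequentially"
    using x C(1) sq by (auto simp: limitin_subtopology intro!: always_eventually)
  then have lim: "limitin (state_topology d) (f \<circ> x) (f (0, \<alpha>)) sequentially"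
    by (rule continuous_map_limit[OF cont])
  show ?thesis
  proof (rule that[of "f ` C" "f (0, \<alpha>)" "- z" "field (z, 0)" "f \<circ> x"])
    show "f ` C \<subseteq> asymmetric_solutions \<kappa> d" using C(2) by (simp add: f_def)
    show "f (0, \<alpha>) \<in> symmetric_curve \<kappa> d" using l.state_of_symmetric C(4) by (simp add: f_def)
    show "f (0, \<alpha>) \<in> state_topology d closure_of f ` C" by (rule clos[OF C(5) sq(1)])
    show "- z \<noteq> 0" using C(6) by simp
    show "0 < field (z, 0)" by (rule field_pos[OF sq(2)]) simp
    show "normal_state d (- z) (field (z, 0)) \<in> state_topology d closure_of f ` C"
      using clos[OF C(7) sq(2)] b.state_of_normal by (simp add: f_def b.\<delta>_def)
    show "(f \<circ> x) n \<in> asymmetric_solutions \<kappa> d" for n using x(1) C(2) by (auto simp: f_def)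
  qed (rule conn lim)+
qed

theorem theorem8:
  shows "(\<exists>K>0. \<forall>\<kappa>>0. \<forall>d>0. \<kappa> * d > K \<longrightarrow>
            (\<exists>p\<in>symmetric_curve \<kappa> d. \<exists>\<sigma>::nat \<Rightarrow> state.
               (\<forall>n. \<sigma> n \<in> asymmetric_solutions \<kappa> d) \<and>
               limitin (state_topology d) \<sigma> p sequentially)) \<and>
         (\<forall>\<kappa>>0. \<exists>d0>0. \<forall>d>d0.
            (\<exists>C\<subseteq>asymmetric_solutions \<kappa> d.
               connectedin (asymmetric_quotient \<kappa> d) (reflection_class d ` C) \<and>
               (\<exists>p\<in>symmetric_curve \<kappa> d. p \<in> state_topology d closure_of C) \<and>
               (\<exists>c1 h1. c1 \<noteq> 0 \<and> h1 > 0 \<and>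
                  normal_state d c1 h1 \<in> state_topology d closure_of C)))"
proof (rule conjI)
  have "\<exists>p\<in>symmetric_curve \<kappa> d. \<exists>\<sigma>::nat \<Rightarrow> state.
      (\<forall>n. \<sigma> n \<in> asymmetric_solutions \<kappa> d) \<and> limitin (state_topology d) \<sigma> p sequentially"
    if "0 < \<kappa>" "0 < d" "4000 < \<kappa> * d" for \<kappa> d
    using asymmetric_branch_exists[OF that] by metis
  then show "\<exists>K>0. \<forall>\<kappa>>0. \<forall>d>0. \<kappa> * d > K \<longrightarrow>
            (\<exists>p\<in>symmetric_curve \<kappa> d. \<exists>\<sigma>::nat \<Rightarrow> state.
               (\<forall>n. \<sigma> n \<in> asymmetric_solutions \<kappa> d) \<and>
               limitin (state_topology d) \<sigma> p sequentially)"
    by (intro exI[of _ 4000]) auto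
next
  have "\<exists>C\<subseteq>asymmetric_solutions \<kappa> d.
      connectedin (asymmetric_quotient \<kappa> d) (reflection_class d ` C) \<and>
      (\<exists>p\<in>symmetric_curve \<kappa> d. p \<in> state_topology d closure_of C) \<and>
      (\<exists>c1 h1. c1 \<noteq> 0 \<and> h1 > 0 \<and> normal_state d c1 h1 \<in> state_topology d closure_of C)"
    if \<kappa>: "0 < \<kappa>" and d: "4000 / \<kappa> < d" for \<kappa> d
  proof -
    have "0 < 4000 / \<kappa>" "4000 < \<kappa> * d" using \<kappa> d by (simp_all add: field_simps)
    then have "0 < d" "4000 < \<kappa> * d" using d by linarith+
    from asymmetric_branch_exists[OF \<kappa> this] show ?thesis by metis
  qed
  then show "\<forall>\<kappa>>0. \<exists>d0>0. \<forall>d>d0.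
            (\<exists>C\<subseteq>asymmetric_solutions \<kappa> d.
               connectedin (asymmetric_quotient \<kappa> d) (reflection_class d ` C) \<and>
               (\<exists>p\<in>symmetric_curve \<kappa> d. p \<in> state_topology d closure_of C) \<and>
               (\<exists>c1 h1. c1 \<noteq> 0 \<and> h1 > 0 \<and>
                  normal_state d c1 h1 \<in> state_topology d closure_of C))"
    by (meson divide_pos_pos zero_less_numeral)
qed

end
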